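(* Let $\alpha$ be a set with an involution $\tau$, let $\pi=\pi(\alpha,\tau)$, and let $\varphi:\pi\to\mathbb Z$ be an additive homomorphism such that $\varphi(a)\in\{+1,-1\}$ for all $a\in\alpha$. For any nanowords $w,v$ over $\alpha$, $$\rho_{br}(w,v)\ \ge\ \tfrac12\,\sigma_\varphi(p_w\oplus p_v^-),$$ where $p_w=p(w)$ and $p_v=p(v)$ are the $\alpha$-pairings of $w$ and $v$, $\sigma_\varphi$ is the $\varphi$-genus, and $\rho_{br}(w,v)=\|wv^-\|_{br}$ is the bridge metric.
   Context: **Nanowords.** $\alpha$ is a set with an involution $\tau:\alpha\to\alpha$ ($\tau^2=\mathrm{id}$). An $\alpha$-alphabet is a set $\mathcal A$ with a map $\mathcal A\to\alpha$, $A\mapsto|A|$. A nanoword of length $n$ over $\alpha$ is a pair $(\mathcal A,w)$ with $\mathcal A$ an $\alpha$-alphabet and $w:\{1,\dots,n\}\to\mathcal A$ a map (written $w(1)\cdots w(n)$) taking every value in $\mathcal A$ exactly twice; $\emptyset$ is the empty nanoword. Nanowords $(\mathcal A,w),(\mathcal A',w')$ are isomorphic if $w'=fw$ for a bijection $f:\mathcal A\to\mathcal A'$ with $|f(A)|=|A|$. The opposite word is $w^-=w(n)\cdots w(1)$. The product of nanowords is concatenation, after making the alphabets disjoint. **Homotopy moves.** (1) $(\mathcal A,xAAy)\mapsto(\mathcal A-\{A\},xy)$; (2) $(\mathcal A,xAByBAz)\mapsto(\mathcal A-\{A,B\},xyz)$ if $|B|=\tau(|A|)$; (3) $(\mathcal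 A,xAByACzBCt)\mapsto(\mathcal A,xBAyCAzCBt)$ for distinct $A,B,C$ with $|A|=|B|=|C|$. **Bridge moves.** A factor of $(\mathcal A,w)$ is a sequence of words $\nabla=(\mathcal B,(v_1|\cdots|v_k))$ in a subset $\mathcal B\subset\mathcal A$, each letter of $\mathcal B$ occurring exactly twice in $v_1\cdots v_k$, such that $w=x_1v_1x_2v_2\cdots x_kv_kx_{k+1}$ with $x_i$ words in $\mathcal A-\mathcal B$. A quasi-bridge in $w$ is a pair $(\nabla,\kappa)$ with $\nabla=(\mathcal B,(v_1|\cdots|v_k))$ a factor of $(\mathcal A,w)$, $k\ge1$, and $\kappa$ an involutive permutation of $\{1,\dots,k\}$ such that (a) $v_r$ has even length whenever $\kappa(r)=r$; (b) there is a map $\iota:\mathcal B\to\mathcal B$ with $\iota v_r=v_{\kappa(r)}^-$ for all $r$. The occurrence of $B\in\mathcal B$ in position $j$ of $v_r$ is symmetric to the occurrence of $\iota(B)$ in position $n_r+1-j$ of $v_{\kappa(r)}$, where $n_r$ is the length of $v_r$. Put $\varepsilon(B)=1$ if the occurrence symmetric to the leftmost occurrence of $B$ in $w$ is the leftmost occurrence of $\iota(B)$ in $w$, and $\varepsilon(B)=0$ otherwise. A quasi-bridge is a bridge if $|\iota(B)|=\tau^{\varepsilon(B)}(|B|)$ for all $B\in\mathcal B$. The corresponding bridge move $m$ transforms $(\mathcal A,w)$ into $(\mathcal A-\mathcal B,x_1x_2\cdots x_{k+1})$; its number of arches $g(m)=g(m^{-1})$ is the number of 2-element orbits of $\kappa$.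 (A bridge move is always considered together with the bridge defining it.) **Bridge norm and metric.** A metamorphosis $m:v\to w$ is a finite sequence $m=(m_1,\dots,m_n)$ of isomorphisms, homotopy moves, bridge moves, and inverses of such moves, transforming $v$ into $w$; $g(m)=\sum_ig(m_i)$ where $g(m_i)$ is the number of arches if $m_i$ is a bridge move or the inverse of one, and $g(m_i)=0$ otherwise. $\|w\|_{br}=\min_mg(m)$ over all metamorphoses $m:w\to\emptyset$. Set $\rho_{br}(w,v)=\|wv^-\|_{br}$. **$\alpha$-pairings.** $\pi=\pi(\alpha,\tau)$ is the additive abelian group with generators $a\in\alpha$ and relations $a+\tau(a)=0$. An $\alpha$-pairing is a triple $p=(S,s,e)$: a set $S$ (here finite), $s\in S$, a map $S^\circ=S-\{s\}\to\alpha$, $A\mapsto|A|$, and a map $e:S\times S\to\pi$, extended to a bilinear form $\tilde e:\mathbb ZS\times\mathbb ZS\to\pi$. The opposite is $p^-=(S,s,-e)$. The sum $p_1\oplus p_2$ of $p_i=(S_i,s_i,e_i)$ is $(S_1^\circ\sqcup S_2^\circ\sqcup\{s\},s,e)$ with inherited projections, $e=e_i$ on $S_i^\circ\times S_i^\circ$, $e(S_1^\circ,S_2^\circ)=e(S_2^\circ,S_1^\circ)=0$, $e(A,s)=e_i(A,s_i)$, $e(s,A)=e_i(s_i,A)$ for $A\in S_i^\circ$, $e(s,s)=e_1(s_1,s_1)+e_2(s_2,s_2)$. A vector $x\in\mathbb ZS$ is short if $x=A\in S^\circ$, or $x=A+B$ with $A\ne B\in S^\circ$, $|A|=|B|$,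 or $x=A-B$ with $A\ne B\in S^\circ$, $|A|=\tau(|B|)$. A filling of $p$ is a finite family $\{\lambda_i\}$ in $\mathbb ZS$ such that one $\lambda_i$ equals $s$, all others are short, and every element of $S^\circ$ occurs with non-zero coefficient in exactly one $\lambda_i$. The $\varphi$-genus is $\sigma_\varphi(p)=\min_\lambda\frac12\operatorname{rk}\big(\varphi\tilde e(\lambda_i,\lambda_j)\big)_{i,j}$, the minimum over all fillings $\lambda$ of $p$ (rank over $\mathbb Q$). **The $\alpha$-pairing of a nanoword $(\mathcal A,w)$.** $p_w=p(w)=(\mathcal A\cup\{s\},s,e_w)$ with the given projection $\mathcal A\to\alpha$. For $A,B\in\mathcal A$ let $n_w(A,B)=1$ if $w=\cdots A\cdots B\cdots A\cdots B\cdots$, $-1$ if $w=\cdots B\cdots A\cdots B\cdots A\cdots$, $0$ otherwise. Let $i_A<j_A$ be the elements of $w^{-1}(A)$, and $A\circ_wB=\sum|D|\in\pi$ over $D\in\mathcal A$ with $i_A<i_D<j_A$ and $i_B<j_D<j_B$. Then $e_w(A,B)=2(A\circ_wB-B\circ_wA)+n_w(A,B)(|A|+|B|)$, $e_w(A,s)=-e_w(s,A)=\sum_{D\in\mathcal A}n_w(A,D)|D|$, $e_w(s,s)=0$. *)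

theory Defs
  imports
    "HOL-Algebra.Free_Abelian_Groups"
    "HOL-Algebra.Elementary_Groups"
    "HOL-Algebra.Coset"
    "HOL-Combinatorics.Permutations"
    "Jordan_Normal_Form.DL_Rank"
begin

section \<open>Nanowords\<close>

text \<open>
  Values of \<open>lproj\<close> outside \<open>letters\<close> carry no meaning; two nanowords that differ only there
  are isomorphic via the identity.
\<close>

record ('a, 'b) nanoword =
  letters :: "'b set"
  lproj :: "'b \<Rightarrow> 'a"
  word :: "'b list"

definition is_nanoword :: "'a set \<Rightarrow> ('a, 'b) nanoword \<Rightarrow> bool" where
  "is_nanoword \<alpha> W \<longleftrightarrow>
     lproj W \<in> letters W \<rightarrow> \<alpha> \<and>
     set (word W) \<subseteq> letters W \<and>
     (\<forall>A \<in> letters W. count_list (word W) A = 2)"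

definition empty_nanoword :: "('a, 'b) nanoword" where
  "empty_nanoword = \<lparr>letters = {}, lproj = (\<lambda>_. undefined), word = []\<rparr>"

definition nw_isomorphic :: "('a, 'b) nanoword \<Rightarrow> ('a, 'c) nanoword \<Rightarrow> bool" where
  "nw_isomorphic W W' \<longleftrightarrow>
     (\<exists>f. bij_betw f (letters W) (letters W') \<and>
          (\<forall>A \<in> letters W. lproj W' (f A) = lproj W A) \<and>
          word W' = map f (word W))"

definition nw_opposite :: "('a, 'b) nanoword \<Rightarrow> ('a, 'b) nanoword" where
  "nw_opposite W = W\<lparr>word := rev (word W)\<rparr>"

definition nw_product :: "('a, 'b) nanoword \<Rightarrow> ('a, 'c) nanoword \<Rightarrow> ('a, 'b + 'c) nanoword" where
  "nw_product W V =
     \<lparr>letters = letters W <+> letters V,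
      lproj = case_sum (lproj W) (lproj V),
      word = map Inl (word W) @ map Inr (word V)\<rparr>"

definition first_occ :: "'b list \<Rightarrow> 'b \<Rightarrow> nat" where
  "first_occ w A = Min {i. i < length w \<and> w ! i = A}"

definition last_occ :: "'b list \<Rightarrow> 'b \<Rightarrow> nat" where
  "last_occ w A = Max {i. i < length w \<and> w ! i = A}"


section \<open>Homotopy moves\<close>

inductive homotopy_move ::
    "('a \<Rightarrow> 'a) \<Rightarrow> ('a, 'b) nanoword \<Rightarrow> ('a, 'b) nanoword \<Rightarrow> bool" for \<tau> where
  move1: "word W = x @ [A, A] @ y \<Longrightarrow>
    homotopy_move \<tau> W (W\<lparr>letters := letters W - {A}, word := x @ y\<rparr>)"
| move2: "word W = x @ [A, B] @ y @ [B, A] @ z \<Longrightarrow> lproj W B = \<tau> (lproj W A) \<Longrightarrow>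
    homotopy_move \<tau> W (W\<lparr>letters := letters W - {A, B}, word := x @ y @ z\<rparr>)"
| move3: "word W = x @ [A, B] @ y @ [A, C] @ z @ [B, C] @ t \<Longrightarrow> distinct [A, B, C] \<Longrightarrow>
    lproj W A = lproj W B \<Longrightarrow> lproj W B = lproj W C \<Longrightarrow>
    homotopy_move \<tau> W (W\<lparr>word := x @ [B, A] @ y @ [C, A] @ z @ [C, B] @ t\<rparr>)"


section \<open>Bridge moves\<close>

text \<open>
  A factorization \<open>x\<^sub>1 v\<^sub>1 \<dots> x\<^sub>k v\<^sub>k x\<^sub>k\<^sub>+\<^sub>1\<close> is given by the lists \<open>xs = [x\<^sub>1, \<dots>, x\<^sub>k]\<close> and
  \<open>vs = [v\<^sub>1, \<dots>, v\<^sub>k]\<close> and the word \<open>z = x\<^sub>k\<^sub>+\<^sub>1\<close>.  The indices \<open>r\<close> and the positions inside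
  words start at 0.
\<close>

definition interleave :: "'b list list \<Rightarrow> 'b list list \<Rightarrow> 'b list" where
  "interleave xs vs = concat (map2 (@) xs vs)"

definition is_factor ::
    "('a, 'b) nanoword \<Rightarrow> 'b set \<Rightarrow> 'b list list \<Rightarrow> 'b list list \<Rightarrow> 'b list \<Rightarrow> bool" where
  "is_factor W \<B> xs vs z \<longleftrightarrow>
     \<B> \<subseteq> letters W \<and>
     set (concat vs) \<subseteq> \<B> \<and> (\<forall>B \<in> \<B>. count_list (concat vs) B = 2) \<and>
     length xs = length vs \<and>
     word W = interleave xs vs @ z \<and>
     set (concat xs @ z) \<subseteq> letters W - \<B>"

definition is_quasi_bridge ::
    "('a, 'b) nanoword \<Rightarrow> 'b set \<Rightarrow> 'b list list \<Rightarrow> 'b list list \<Rightarrow> 'b list \<Rightarrow>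
      (nat \<Rightarrow> nat) \<Rightarrow> ('b \<Rightarrow> 'b) \<Rightarrow> bool" where
  "is_quasi_bridge W \<B> xs vs z \<kappa> \<iota> \<longleftrightarrow>
     is_factor W \<B> xs vs z \<and> length vs \<ge> 1 \<and>
     \<kappa> permutes {..<length vs} \<and> \<kappa> \<circ> \<kappa> = id \<and>
     (\<forall>r < length vs. \<kappa> r = r \<longrightarrow> even (length (vs ! r))) \<and>
     \<iota> \<in> \<B> \<rightarrow> \<B> \<and>
     (\<forall>r < length vs. map \<iota> (vs ! r) = rev (vs ! \<kappa> r))"

definition occ_pos :: "'b list list \<Rightarrow> 'b list list \<Rightarrow> nat \<Rightarrow> nat \<Rightarrow> nat" where
  \<comment> \<open>the place in the whole word of position \<open>j\<close> of \<open>vs ! r\<close>\<close>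
  "occ_pos xs vs r j = length (interleave (take r xs) (take r vs)) + length (xs ! r) + j"

definition bridge_eps ::
    "('a, 'b) nanoword \<Rightarrow> 'b list list \<Rightarrow> 'b list list \<Rightarrow> (nat \<Rightarrow> nat) \<Rightarrow> ('b \<Rightarrow> 'b) \<Rightarrow> 'b \<Rightarrow> nat" where
  "bridge_eps W xs vs \<kappa> \<iota> B =
     (if \<exists>r j. r < length vs \<and> j < length (vs ! r) \<and>
               occ_pos xs vs r j = first_occ (word W) B \<and>
               occ_pos xs vs (\<kappa> r) (length (vs ! r) - 1 - j) = first_occ (word W) (\<iota> B)
      then 1 else 0)"

text \<open>The map \<open>\<iota>\<close> is determined on \<open>\<B>\<close> by \<open>vs\<close> and \<open>\<kappa>\<close>, so it may be quantified here.\<close>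

definition is_bridge ::
    "('a \<Rightarrow> 'a) \<Rightarrow> ('a, 'b) nanoword \<Rightarrow> 'b set \<Rightarrow> 'b list list \<Rightarrow> 'b list list \<Rightarrow> 'b list \<Rightarrow>
      (nat \<Rightarrow> nat) \<Rightarrow> bool" where
  "is_bridge \<tau> W \<B> xs vs z \<kappa> \<longleftrightarrow>
     (\<exists>\<iota>. is_quasi_bridge W \<B> xs vs z \<kappa> \<iota> \<and>
          (\<forall>B \<in> \<B>. lproj W (\<iota> B) = (\<tau> ^^ bridge_eps W xs vs \<kappa> \<iota> B) (lproj W B)))"

definition arches :: "nat \<Rightarrow> (nat \<Rightarrow> nat) \<Rightarrow> nat" where
  "arches k \<kappa> = card {{r, \<kappa> r} | r. r < k \<and> \<kappa> r \<noteq> r}"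

inductive bridge_move ::
    "('a \<Rightarrow> 'a) \<Rightarrow> ('a, 'b) nanoword \<Rightarrow> nat \<Rightarrow> ('a, 'b) nanoword \<Rightarrow> bool" for \<tau> where
  "is_bridge \<tau> W \<B> xs vs z \<kappa> \<Longrightarrow>
    bridge_move \<tau> W (arches (length vs) \<kappa>)
      (W\<lparr>letters := letters W - \<B>, word := concat xs @ z\<rparr>)"


section \<open>Metamorphoses and the bridge metric\<close>

text \<open>\<open>elementary_step \<tau> W g W'\<close>: one step \<open>m\<^sub>i : W \<rightarrow> W'\<close> of a metamorphosis, with \<open>g(m\<^sub>i) = g\<close>.\<close>

inductive elementary_step ::
    "('a \<Rightarrow> 'a) \<Rightarrow> ('a, 'b) nanoword \<Rightarrow> nat \<Rightarrow> ('a, 'b) nanoword \<Rightarrow> bool" for \<tau> where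
  "nw_isomorphic W W' \<Longrightarrow> elementary_step \<tau> W 0 W'"
| "homotopy_move \<tau> W W' \<Longrightarrow> elementary_step \<tau> W 0 W'"
| "homotopy_move \<tau> W' W \<Longrightarrow> elementary_step \<tau> W 0 W'"
| "bridge_move \<tau> W g W' \<Longrightarrow> elementary_step \<tau> W g W'"
| "bridge_move \<tau> W' g W \<Longrightarrow> elementary_step \<tau> W g W'"

text \<open>\<open>metamorphosis \<alpha> \<tau> W g V\<close>: there is a metamorphosis \<open>m : W \<rightarrow> V\<close> with \<open>g(m) = g\<close>.\<close>

inductive metamorphosis ::
    "'a set \<Rightarrow> ('a \<Rightarrow> 'a) \<Rightarrow> ('a, 'b) nanoword \<Rightarrow> nat \<Rightarrow> ('a, 'b) nanoword \<Rightarrow> bool"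
  for \<alpha> \<tau> where
  Nil: "is_nanoword \<alpha> W \<Longrightarrow> metamorphosis \<alpha> \<tau> W 0 W"
| Cons: "is_nanoword \<alpha> W \<Longrightarrow> elementary_step \<tau> W g W' \<Longrightarrow> metamorphosis \<alpha> \<tau> W' h V \<Longrightarrow>
    metamorphosis \<alpha> \<tau> W (g + h) V"

text \<open>
  Inverse moves need fresh letters, so a metamorphosis may not be confined to the letter type of
  the given nanoword, which could be finite.  Every alphabet of a nanoword is finite and hence has
  an isomorphic copy in the natural numbers; the metamorphosis starts with an isomorphism
  (at no cost) onto such a copy \<open>U\<close> and then stays among nanowords with letters in \<open>nat\<close>.
  The set below is never empty: a letter \<open>A\<close> can always be removed at the cost of one arch,
  by the bridge \<open>(A|A)\<close> whose \<open>\<kappa>\<close> is the transposition.  So \<open>Inf\<close> is a minimum.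
\<close>

definition bridge_norm :: "'a set \<Rightarrow> ('a \<Rightarrow> 'a) \<Rightarrow> ('a, 'b) nanoword \<Rightarrow> nat" where
  "bridge_norm \<alpha> \<tau> W =
     Inf {g. \<exists>U :: ('a, nat) nanoword. nw_isomorphic W U \<and> metamorphosis \<alpha> \<tau> U g empty_nanoword}"

definition bridge_metric ::
    "'a set \<Rightarrow> ('a \<Rightarrow> 'a) \<Rightarrow> ('a, 'b) nanoword \<Rightarrow> ('a, 'c) nanoword \<Rightarrow> nat" where
  "bridge_metric \<alpha> \<tau> W V = bridge_norm \<alpha> \<tau> (nw_product W (nw_opposite V))"


section \<open>The group \<open>\<pi>(\<alpha>, \<tau>)\<close>\<close>

text \<open>The additive group \<open>\<pi>\<close> appears as a multiplicatively written \<open>monoid\<close> record.\<close>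

definition pi_relations :: "'a set \<Rightarrow> ('a \<Rightarrow> 'a) \<Rightarrow> ('a \<Rightarrow>\<^sub>0 int) set" where
  "pi_relations \<alpha> \<tau> =
     generate (free_Abelian_group \<alpha>) {frag_of a + frag_of (\<tau> a) | a. a \<in> \<alpha>}"

definition pi_group :: "'a set \<Rightarrow> ('a \<Rightarrow> 'a) \<Rightarrow> ('a \<Rightarrow>\<^sub>0 int) set monoid" where
  "pi_group \<alpha> \<tau> = free_Abelian_group \<alpha> Mod pi_relations \<alpha> \<tau>"

definition pi_gen :: "'a set \<Rightarrow> ('a \<Rightarrow> 'a) \<Rightarrow> 'a \<Rightarrow> ('a \<Rightarrow>\<^sub>0 int) set" where
  "pi_gen \<alpha> \<tau> a = pi_relations \<alpha> \<tau> #>\<^bsub>free_Abelian_group \<alpha>\<^esub> frag_of a"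


section \<open>Pairings\<close>

record ('a, 's) pairing =
  pset :: "'s set"
  pbase :: "'s"
  pproj :: "'s \<Rightarrow> 'a"
  pform :: "'s \<Rightarrow> 's \<Rightarrow> ('a \<Rightarrow>\<^sub>0 int) set"

definition pset0 :: "('a, 's) pairing \<Rightarrow> 's set" where
  "pset0 p = pset p - {pbase p}"

definition is_pairing :: "'a set \<Rightarrow> ('a \<Rightarrow> 'a) \<Rightarrow> ('a, 's) pairing \<Rightarrow> bool" where
  "is_pairing \<alpha> \<tau> p \<longleftrightarrow>
     finite (pset p) \<and> pbase p \<in> pset p \<and>
     pproj p \<in> pset0 p \<rightarrow> \<alpha> \<and>
     (\<forall>A \<in> pset p. \<forall>B \<in> pset p. pform p A B \<in> carrier (pi_group \<alpha> \<tau>))"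

definition pairing_opposite ::
    "'a set \<Rightarrow> ('a \<Rightarrow> 'a) \<Rightarrow> ('a, 's) pairing \<Rightarrow> ('a, 's) pairing" where
  "pairing_opposite \<alpha> \<tau> p = p\<lparr>pform := (\<lambda>A B. inv\<^bsub>pi_group \<alpha> \<tau>\<^esub> pform p A B)\<rparr>"

text \<open>In the sum, \<open>None\<close> is the new distinguished element.\<close>

definition pairing_sum ::
    "'a set \<Rightarrow> ('a \<Rightarrow> 'a) \<Rightarrow> ('a, 's) pairing \<Rightarrow> ('a, 't) pairing \<Rightarrow> ('a, ('s + 't) option) pairing"
  where
  "pairing_sum \<alpha> \<tau> p q =
     \<lparr>pset = insert None (Some ` (pset0 p <+> pset0 q)),
      pbase = None,
      pproj = (\<lambda>X. case X of
          Some (Inl A) \<Rightarrow> pproj p A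
        | Some (Inr A) \<Rightarrow> pproj q A
        | None \<Rightarrow> undefined),
      pform = (\<lambda>X Y. case (X, Y) of
          (Some (Inl A), Some (Inl B)) \<Rightarrow> pform p A B
        | (Some (Inr A), Some (Inr B)) \<Rightarrow> pform q A B
        | (Some (Inl A), Some (Inr B)) \<Rightarrow> \<one>\<^bsub>pi_group \<alpha> \<tau>\<^esub>
        | (Some (Inr A), Some (Inl B)) \<Rightarrow> \<one>\<^bsub>pi_group \<alpha> \<tau>\<^esub>
        | (Some (Inl A), None) \<Rightarrow> pform p A (pbase p)
        | (Some (Inr A), None) \<Rightarrow> pform q A (pbase q)
        | (None, Some (Inl A)) \<Rightarrow> pform p (pbase p) A
        | (None, Some (Inr A)) \<Rightarrow> pform q (pbase q) A
        | (None, None) \<Rightarrow>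
            pform p (pbase p) (pbase p) \<otimes>\<^bsub>pi_group \<alpha> \<tau>\<^esub> pform q (pbase q) (pbase q))\<rparr>"

text \<open>Vectors in \<open>\<int>S\<close> are elements of \<open>'s \<Rightarrow>\<^sub>0 int\<close> with support in \<open>S\<close>.\<close>

definition bilinear_form ::
    "'a set \<Rightarrow> ('a \<Rightarrow> 'a) \<Rightarrow> ('a, 's) pairing \<Rightarrow> ('s \<Rightarrow>\<^sub>0 int) \<Rightarrow> ('s \<Rightarrow>\<^sub>0 int) \<Rightarrow> ('a \<Rightarrow>\<^sub>0 int) set" where
  "bilinear_form \<alpha> \<tau> p x y =
     finprod (pi_group \<alpha> \<tau>)
       (\<lambda>(A, B). pform p A B [^]\<^bsub>pi_group \<alpha> \<tau>\<^esub> (Poly_Mapping.lookup x A * Poly_Mapping.lookup y B))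
       (pset p \<times> pset p)"

definition short_vector :: "('a \<Rightarrow> 'a) \<Rightarrow> ('a, 's) pairing \<Rightarrow> ('s \<Rightarrow>\<^sub>0 int) \<Rightarrow> bool" where
  "short_vector \<tau> p x \<longleftrightarrow>
     (\<exists>A \<in> pset0 p. x = frag_of A) \<or>
     (\<exists>A \<in> pset0 p. \<exists>B \<in> pset0 p. A \<noteq> B \<and> pproj p A = pproj p B \<and> x = frag_of A + frag_of B) \<or>
     (\<exists>A \<in> pset0 p. \<exists>B \<in> pset0 p. A \<noteq> B \<and> pproj p A = \<tau> (pproj p B) \<and> x = frag_of A - frag_of B)"

definition is_filling :: "('a \<Rightarrow> 'a) \<Rightarrow> ('a, 's) pairing \<Rightarrow> ('s \<Rightarrow>\<^sub>0 int) list \<Rightarrow> bool" where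
  "is_filling \<tau> p \<Lambda> \<longleftrightarrow>
     (\<exists>i\<^sub>0 < length \<Lambda>. \<Lambda> ! i\<^sub>0 = frag_of (pbase p) \<and>
        (\<forall>i < length \<Lambda>. i \<noteq> i\<^sub>0 \<longrightarrow> short_vector \<tau> p (\<Lambda> ! i))) \<and>
     (\<forall>A \<in> pset0 p. \<exists>!i. i < length \<Lambda> \<and> Poly_Mapping.lookup (\<Lambda> ! i) A \<noteq> 0)"

definition filling_matrix ::
    "'a set \<Rightarrow> ('a \<Rightarrow> 'a) \<Rightarrow> (('a \<Rightarrow>\<^sub>0 int) set \<Rightarrow> int) \<Rightarrow> ('a, 's) pairing \<Rightarrow>
      ('s \<Rightarrow>\<^sub>0 int) list \<Rightarrow> rat mat" where
  "filling_matrix \<alpha> \<tau> \<phi> p \<Lambda> =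
     mat (length \<Lambda>) (length \<Lambda>)
       (\<lambda>(i, j). rat_of_int (\<phi> (bilinear_form \<alpha> \<tau> p (\<Lambda> ! i) (\<Lambda> ! j))))"

text \<open>
  Fillings always exist (take \<open>s\<close> and all elements of \<open>S - {s}\<close>), so \<open>Inf\<close>, taken in \<open>nat\<close>,
  is a minimum.
\<close>

definition genus ::
    "'a set \<Rightarrow> ('a \<Rightarrow> 'a) \<Rightarrow> (('a \<Rightarrow>\<^sub>0 int) set \<Rightarrow> int) \<Rightarrow> ('a, 's) pairing \<Rightarrow> real" where
  "genus \<alpha> \<tau> \<phi> p =
     1 / 2 * real (Inf {vec_space.rank (length \<Lambda>) (filling_matrix \<alpha> \<tau> \<phi> p \<Lambda>) | \<Lambda>.
                        is_filling \<tau> p \<Lambda>})"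


section \<open>The pairing of a nanoword\<close>

definition alternates :: "'b list \<Rightarrow> 'b \<Rightarrow> 'b \<Rightarrow> bool" where
  "alternates w A B \<longleftrightarrow>
     (\<exists>x y z t u. w = x @ [A] @ y @ [B] @ z @ [A] @ t @ [B] @ u)"

definition link_number :: "'b list \<Rightarrow> 'b \<Rightarrow> 'b \<Rightarrow> int" where
  "link_number w A B =
     (if alternates w A B then 1 else if alternates w B A then - 1 else 0)"

definition nw_circ ::
    "'a set \<Rightarrow> ('a \<Rightarrow> 'a) \<Rightarrow> ('a, 'b) nanoword \<Rightarrow> 'b \<Rightarrow> 'b \<Rightarrow> ('a \<Rightarrow>\<^sub>0 int) set" where
  "nw_circ \<alpha> \<tau> W A B =
     finprod (pi_group \<alpha> \<tau>) (\<lambda>D. pi_gen \<alpha> \<tau> (lproj W D))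
       {D \<in> letters W.
          first_occ (word W) A < first_occ (word W) D \<and> first_occ (word W) D < last_occ (word W) A \<and>
          first_occ (word W) B < last_occ (word W) D \<and> last_occ (word W) D < last_occ (word W) B}"

definition nw_form_letters ::
    "'a set \<Rightarrow> ('a \<Rightarrow> 'a) \<Rightarrow> ('a, 'b) nanoword \<Rightarrow> 'b \<Rightarrow> 'b \<Rightarrow> ('a \<Rightarrow>\<^sub>0 int) set" where
  "nw_form_letters \<alpha> \<tau> W A B =
     (let \<pi> = pi_group \<alpha> \<tau> in
      (nw_circ \<alpha> \<tau> W A B \<otimes>\<^bsub>\<pi>\<^esub> inv\<^bsub>\<pi>\<^esub> nw_circ \<alpha> \<tau> W B A) [^]\<^bsub>\<pi>\<^esub> (2 :: nat) \<otimes>\<^bsub>\<pi>\<^esub>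
      (pi_gen \<alpha> \<tau> (lproj W A) \<otimes>\<^bsub>\<pi>\<^esub> pi_gen \<alpha> \<tau> (lproj W B)) [^]\<^bsub>\<pi>\<^esub> link_number (word W) A B)"

definition nw_form_base ::
    "'a set \<Rightarrow> ('a \<Rightarrow> 'a) \<Rightarrow> ('a, 'b) nanoword \<Rightarrow> 'b \<Rightarrow> ('a \<Rightarrow>\<^sub>0 int) set" where
  "nw_form_base \<alpha> \<tau> W A =
     finprod (pi_group \<alpha> \<tau>)
       (\<lambda>D. pi_gen \<alpha> \<tau> (lproj W D) [^]\<^bsub>pi_group \<alpha> \<tau>\<^esub> link_number (word W) A D) (letters W)"

definition nw_pairing ::
    "'a set \<Rightarrow> ('a \<Rightarrow> 'a) \<Rightarrow> ('a, 'b) nanoword \<Rightarrow> ('a, 'b option) pairing" where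
  "nw_pairing \<alpha> \<tau> W =
     \<lparr>pset = insert None (Some ` letters W),
      pbase = None,
      pproj = (\<lambda>X. lproj W (the X)),
      pform = (\<lambda>X Y. case (X, Y) of
          (Some A, Some B) \<Rightarrow> nw_form_letters \<alpha> \<tau> W A B
        | (Some A, None) \<Rightarrow> nw_form_base \<alpha> \<tau> W A
        | (None, Some A) \<Rightarrow> inv\<^bsub>pi_group \<alpha> \<tau>\<^esub> nw_form_base \<alpha> \<tau> W A
        | (None, None) \<Rightarrow> \<one>\<^bsub>pi_group \<alpha> \<tau>\<^esub>)\<rparr>"


subsection \<open>Well-definedness\<close>

lemma comm_group_pi_group: "comm_group (pi_group \<alpha> \<tau>)"
  if "\<tau> \<in> \<alpha> \<rightarrow> \<alpha>" for \<alpha> :: "'a set"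
proof -
  interpret F: comm_group "free_Abelian_group \<alpha>" by (rule abelian_free_Abelian_group)
  have "{frag_of a + frag_of (\<tau> a) | a. a \<in> \<alpha>} \<subseteq> carrier (free_Abelian_group \<alpha>)"
    using that by (auto simp: Pi_iff dest!: subsetD[OF keys_add])
  then have "subgroup (pi_relations \<alpha> \<tau>) (free_Abelian_group \<alpha>)"
    unfolding pi_relations_def by (rule F.generate_is_subgroup)
  then show ?thesis
    unfolding pi_group_def by (rule F.abelian_FactGroup)
qed

lemma pi_gen_closed: "pi_gen \<alpha> \<tau> a \<in> carrier (pi_group \<alpha> \<tau>)" if "a \<in> \<alpha>"
  using that by (auto simp: pi_gen_def pi_group_def FactGroup_def RCOSETS_def)

lemma finite_letters: "finite (letters W)" if "is_nanoword \<alpha> W"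
proof -
  have "letters W \<subseteq> set (word W)"
    using that unfolding is_nanoword_def
    by (metis count_notin subsetI zero_neq_numeral)
  then show ?thesis by (rule finite_subset) simp
qed

lemma is_pairing_nw_pairing: "is_pairing \<alpha> \<tau> (nw_pairing \<alpha> \<tau> W)"
  if "\<tau> \<in> \<alpha> \<rightarrow> \<alpha>" "is_nanoword \<alpha> W"
proof -
  interpret P: comm_group "pi_group \<alpha> \<tau>" using that(1) by (rule comm_group_pi_group)
  have g: "pi_gen \<alpha> \<tau> (lproj W D) \<in> carrier (pi_group \<alpha> \<tau>)" if "D \<in> letters W" for D
    using \<open>is_nanoword \<alpha> W\<close> that by (auto simp: is_nanoword_def intro!: pi_gen_closed)
  have c: "nw_circ \<alpha> \<tau> W A B \<in> carrier (pi_group \<alpha> \<tau>)" for A B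
    unfolding nw_circ_def by (rule P.finprod_closed) (use g in auto)
  have b: "nw_form_base \<alpha> \<tau> W A \<in> carrier (pi_group \<alpha> \<tau>)" for A
    unfolding nw_form_base_def by (rule P.finprod_closed) (use g in auto)
  have l: "nw_form_letters \<alpha> \<tau> W A B \<in> carrier (pi_group \<alpha> \<tau>)"
    if "A \<in> letters W" "B \<in> letters W" for A B
    unfolding nw_form_letters_def Let_def using that c g by simp
  show ?thesis
    using b l finite_letters[OF that(2)] that(2)
    by (auto simp: is_pairing_def nw_pairing_def pset0_def is_nanoword_def)
qed

lemma is_pairing_opposite: "is_pairing \<alpha> \<tau> (pairing_opposite \<alpha> \<tau> p)"
  if "\<tau> \<in> \<alpha> \<rightarrow> \<alpha>" "is_pairing \<alpha> \<tau> p"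
proof -
  interpret P: comm_group "pi_group \<alpha> \<tau>" using that(1) by (rule comm_group_pi_group)
  show ?thesis using that(2) by (auto simp: is_pairing_def pairing_opposite_def pset0_def)
qed

lemma is_pairing_sum: "is_pairing \<alpha> \<tau> (pairing_sum \<alpha> \<tau> p q)"
  if "\<tau> \<in> \<alpha> \<rightarrow> \<alpha>" "is_pairing \<alpha> \<tau> p" "is_pairing \<alpha> \<tau> q"
proof -
  interpret P: comm_group "pi_group \<alpha> \<tau>" using that(1) by (rule comm_group_pi_group)
  show ?thesis using that(2,3)
    by (auto simp: is_pairing_def pairing_sum_def pset0_def)
qed

end

theory Submission
  imports Defs
begin

text \<open>
  Assign to every letter of a word the (doubled) winding number of its loop, a function on the
  positions of the word.  Then \<open>\<phi> e\<^sub>w\<close> is half the antisymmetric form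
  \<open>\<Omega>(F, G) = \<Sum>\<^sub>D \<phi>|D| (F(i\<^sub>D) G(j\<^sub>D) - F(j\<^sub>D) G(i\<^sub>D))\<close>.  This shows that the pairing of
  \<open>w v\<^sup>-\<close> is the sum of \<open>p\<^sub>w\<close> and the opposite of \<open>p\<^sub>v\<close>, and it remains to find, for a nanoword joined to
  the empty one by a metamorphosis with \<open>g\<close> arches, a filling whose Gram matrix is a sum of \<open>4 g\<close>
  matrices of rank at most 1.

  Isomorphisms and the third homotopy move preserve the form, and the first two homotopy moves are
  bridge moves without arches.  For a bridge, fill the removed letters by the vectors
  \<open>B \<plusminus> \<iota>(B)\<close>.  On the remaining letters the heights of these vectors lie in a space spanned by one
  function per arch.  On the removed letters the reflection of the blocks reverses the sign of
  \<open>\<Omega>\<close>, and the relevant heights are reflection invariant up to one function per arch.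
  Expanding the difference of the forms before and after the move gives four products per arch.
  A filling is carried through a move in either direction, by adding the vectors \<open>B \<plusminus> \<iota>(B)\<close> or by
  eliminating the letters \<open>B\<close> with their help.
\<close>

section \<open>Fillings and eliminations of letters\<close>

text \<open>The obstacle is a bridge passed from the larger word to the smaller one: the given
  filling may pair removed letters with surviving ones, so it need not contain a filling of what is
  left. What is carried along is therefore a subspace M of rational vectors that contains the
  vectors of a filling, with a bound on the form over \<open>UNIV \<times> M\<close>. Signed sums of
  short vectors stay in M, as the elimination requires, and the coordinate of s is left free because
  s belongs to every filling. The count of four products per arch is 2 + 2. On the surviving letters
  the heights of the removed part enter through either argument of the form. On the removed letters
  the form is averaged with its reflection, and each argument contributes its failure to be
  reflection invariant. Blocks fixed by \<kappa> cost nothing: all block coefficients are made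
  antisymmetric under \<kappa>, hence vanish there. A Gram matrix of rank at most 4 g gives genus at
  most 2 g, which explains the factor 1/2 in the theorem.\<close>

lemma rank_le_sum_of_products:
  assumes "A \<in> carrier_mat n nc"
    and "\<And>i j. i < n \<Longrightarrow> j < nc \<Longrightarrow> A $$ (i, j) = (\<Sum>l<m. f l i * g l j :: 'a :: field)"
  shows "vec_space.rank n A \<le> m"
  using assms
proof (induction m arbitrary: A)
  case 0
  then have "A = 0\<^sub>m n nc" by (intro eq_matI) auto
  then show ?case by (simp add: vec_space.rank_0I)
next
  case (Suc m)
  define B where "B = mat n nc (\<lambda>(i, j). \<Sum>l<m. f l i * g l j)"
  define C where "C = mat n nc (\<lambda>(i, j). f m i * g m j)"
  have "A = B + C" using Suc.prems by (intro eq_matI) (auto simp: B_def C_def)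
  moreover have "vec_space.rank n B \<le> m" by (rule Suc.IH) (auto simp: B_def)
  moreover have "vec_space.rank n C \<le> 1"
    by (rule vec_space.rank_le_1_product_entries[where nc = nc and f = "f m" and g = "g m"])
      (auto simp: C_def)
  moreover have "vec_space.rank n (B + C) \<le> vec_space.rank n B + vec_space.rank n C"
    by (rule vec_space.rank_subadditive[where nc = nc]) (auto simp: B_def C_def)
  ultimately show ?case by simp
qed

definition basis_vec :: "'b \<Rightarrow> 'b \<Rightarrow> rat" where
  "basis_vec A = (\<lambda>B. if B = A then 1 else 0)"

definition vec_subspace :: "('b \<Rightarrow> rat) set \<Rightarrow> bool" where
  "vec_subspace M \<longleftrightarrow> (\<lambda>_. 0) \<in> M \<and>
     (\<forall>x \<in> M. \<forall>y \<in> M. (\<lambda>A. x A + y A) \<in> M) \<and> (\<forall>x \<in> M. \<forall>q. (\<lambda>A. q * x A) \<in> M)"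

text \<open>The sign s is the coefficient of B in the short vector A + B or A - B. Treating both
  kinds as one signed relation lets signs be multiplied along chains of pairs.\<close>

definition short_pair :: "('a \<Rightarrow> 'a) \<Rightarrow> ('b \<Rightarrow> 'a) \<Rightarrow> 'b \<Rightarrow> 'b \<Rightarrow> rat \<Rightarrow> bool" where
  "short_pair \<tau> pr A B s \<longleftrightarrow> A \<noteq> B \<and>
     (s = 1 \<and> pr A = pr B \<or> s = - 1 \<and> pr A = \<tau> (pr B))"

definition pair_vec :: "'b \<Rightarrow> 'b \<Rightarrow> rat \<Rightarrow> 'b \<Rightarrow> rat" where
  "pair_vec A B s = (\<lambda>C. basis_vec A C + s * basis_vec B C)"

text \<open>A derivation is a partition of S into singles and pairs whose short vectors lie in M,
  that is, a filling without its vector s. M may be larger than the span of these vectors, which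
  leaves room for exchange arguments.\<close>

inductive fillable :: "('a \<Rightarrow> 'a) \<Rightarrow> ('b \<Rightarrow> 'a) \<Rightarrow> ('b \<Rightarrow> rat) set \<Rightarrow> 'b set \<Rightarrow> bool"
  for \<tau> pr M where
  empty: "fillable \<tau> pr M {}"
| single: "fillable \<tau> pr M S \<Longrightarrow> A \<notin> S \<Longrightarrow> basis_vec A \<in> M \<Longrightarrow> fillable \<tau> pr M (insert A S)"
| pair: "fillable \<tau> pr M S \<Longrightarrow> A \<notin> S \<Longrightarrow> B \<notin> S \<Longrightarrow> short_pair \<tau> pr A B s \<Longrightarrow>
    pair_vec A B s \<in> M \<Longrightarrow> fillable \<tau> pr M (insert A (insert B S))"

locale signed_involution =
  fixes \<alpha> :: "'a set" and \<tau> :: "'a \<Rightarrow> 'a" and \<chi> :: "'a \<Rightarrow> rat"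
  assumes tau_closed: "a \<in> \<alpha> \<Longrightarrow> \<tau> a \<in> \<alpha>"
    and tau_tau: "a \<in> \<alpha> \<Longrightarrow> \<tau> (\<tau> a) = a"
    and chi_tau: "a \<in> \<alpha> \<Longrightarrow> \<chi> (\<tau> a) = - \<chi> a"
    and chi_nonzero: "a \<in> \<alpha> \<Longrightarrow> \<chi> a \<noteq> 0"
begin

lemma short_pair_sym: "short_pair \<tau> pr B A s" if "short_pair \<tau> pr A B s" "pr B \<in> \<alpha>"
  using that by (auto simp: short_pair_def tau_tau)


lemma tau_inj: "a = b" if "\<tau> a = \<tau> b" "a \<in> \<alpha>" "b \<in> \<alpha>"
  using that tau_tau by metis

text \<open>The projections along the chain D, A, B, E agree up to \<tau>, and each use of \<tau> is
  recorded by a sign -1. Since \<tau> is an involution, the signs multiply.\<close>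

lemma short_pair_comp:
  assumes "short_pair \<tau> pr A D t" "short_pair \<tau> pr A B s" "short_pair \<tau> pr B E u"
    and "D \<noteq> E" "pr D \<in> \<alpha>" "pr E \<in> \<alpha>"
  shows "short_pair \<tau> pr D E (t * s * u)"
  using assms tau_inj[of "pr D" "pr E"]
  by (elim disjE conjE short_pair_def[THEN iffD1, elim_format]) (simp_all add: short_pair_def tau_tau)

end

lemma vec_subspace_add: "(\<lambda>A. x A + y A) \<in> M" if "vec_subspace M" "x \<in> M" "y \<in> M"
  using that by (simp add: vec_subspace_def)

lemma vec_subspace_scale: "(\<lambda>A. q * x A) \<in> M" if "vec_subspace M" "x \<in> M"
  using that by (simp add: vec_subspace_def)

lemma vec_subspace_comb:
  "(\<lambda>A. p * x A + q * y A) \<in> M" if "vec_subspace M" "x \<in> M" "y \<in> M"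
  by (rule vec_subspace_add[OF that(1) vec_subspace_scale[OF that(1,2)] vec_subspace_scale[OF that(1,3)]])

lemma fillable_mono:
  assumes "fillable \<tau> pr M S"
    and "\<And>A. A \<in> S \<Longrightarrow> basis_vec A \<in> M \<Longrightarrow> basis_vec A \<in> M'"
    and "\<And>A B s. A \<in> S \<Longrightarrow> B \<in> S \<Longrightarrow> pair_vec A B s \<in> M \<Longrightarrow> pair_vec A B s \<in> M'"
  shows "fillable \<tau> pr M' S"
  using assms by (induction) (auto intro: fillable.intros)

lemma fillable_Un:
  assumes "fillable \<tau> pr M S" "fillable \<tau> pr M T" "S \<inter> T = {}"
  shows "fillable \<tau> pr M (S \<union> T)"
  using assms by (induction) (auto intro: fillable.intros)

context signed_involution
begin

text \<open>The parts of a filling can be added in any order, so the part containing A may be taken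
  as the last one. Only a pair in which A is the second member has to be turned around.\<close>

lemma fillable_exchange:
  assumes "fillable \<tau> pr M S" "vec_subspace M" "pr \<in> S \<rightarrow> \<alpha>" "A \<in> S"
  shows "basis_vec A \<in> M \<and> fillable \<tau> pr M (S - {A}) \<or>
    (\<exists>B s. B \<in> S \<and> short_pair \<tau> pr A B s \<and> pair_vec A B s \<in> M \<and> fillable \<tau> pr M (S - {A, B}))"
  using assms
proof (induction)
  case empty
  then show ?case by simp
next
  case (single S C)
  show ?case
  proof (cases "A = C")
    case True
    then show ?thesis using single.hyps by simp
  next
    case False
    then have A: "A \<in> S" using single.prems by auto
    consider "basis_vec A \<in> M" "fillable \<tau> pr M (S - {A})"
      | B s where "B \<in> S" "short_pair \<tau> pr A B s" "pair_vec A B s \<in> M"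
          "fillable \<tau> pr M (S - {A, B})"
      using single.IH single.prems A by auto
    then show ?thesis
    proof cases
      case 1
      have "fillable \<tau> pr M (insert C (S - {A}))" using 1 single.hyps by (intro fillable.single) auto
      also have "insert C (S - {A}) = insert C S - {A}" using False by auto
      finally show ?thesis using 1 by auto
    next
      case 2
      have "fillable \<tau> pr M (insert C (S - {A, B}))" using 2 single.hyps by (intro fillable.single) auto
      also have "insert C (S - {A, B}) = insert C S - {A, B}" using False 2 single.hyps by auto
      finally show ?thesis using 2 by auto
    qed
  qed
next
  case (pair S C D t)
  have cd: "C \<noteq> D" using pair.hyps by (auto simp: short_pair_def)
  have t: "t = 1 \<or> t = - 1" using pair.hyps by (auto simp: short_pair_def)
  consider "A = C" | "A = D" | "A \<noteq> C" "A \<noteq> D" by auto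
  then show ?case
  proof cases
    case 1
    have "insert C (insert D S) - {C, D} = S" using pair.hyps by auto
    then show ?thesis using 1 pair.hyps by (intro disjI2 exI[of _ D] exI[of _ t]) simp
  next
    case 2
    \<comment> \<open>As t * t = 1, D + t C is t times C + t D. The term with coefficient 0 is there
      to match \<open>vec_subspace_comb\<close>.\<close>
    have "pair_vec D C t = (\<lambda>X. t * pair_vec C D t X + 0 * pair_vec C D t X)"
      using t by (auto simp: pair_vec_def)
    also have "\<dots> \<in> M" by (rule vec_subspace_comb[OF pair.prems(1) pair.hyps(5) pair.hyps(5)])
    finally have "pair_vec D C t \<in> M" .
    moreover have "short_pair \<tau> pr D C t" using pair.hyps pair.prems by (auto intro!: short_pair_sym[OF pair.hyps(4)])
    moreover have "insert C (insert D S) - {D, C} = S" using pair.hyps by auto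
    ultimately show ?thesis using 2 pair.hyps by (intro disjI2 exI[of _ C] exI[of _ t]) simp
  next
    case 3
    then have A: "A \<in> S" using pair.prems by auto
    consider "basis_vec A \<in> M" "fillable \<tau> pr M (S - {A})"
      | B s where "B \<in> S" "short_pair \<tau> pr A B s" "pair_vec A B s \<in> M"
          "fillable \<tau> pr M (S - {A, B})"
      using pair.IH pair.prems A by auto
    then show ?thesis
    proof cases
      case 1
      have "fillable \<tau> pr M (insert C (insert D (S - {A})))"
        using 1 pair.hyps by (intro fillable.pair) auto
      also have "insert C (insert D (S - {A})) = insert C (insert D S) - {A}" using 3 by auto
      finally show ?thesis using 1 by auto
    next
      case (2 B s)
      have "fillable \<tau> pr M (insert C (insert D (S - {A, B})))"
        using 2 pair.hyps by (intro fillable.pair) auto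
      also have "insert C (insert D (S - {A, B})) = insert C (insert D S) - {A, B}"
        using 3 2 pair.hyps by auto
      finally show ?thesis using 2 by auto
    qed
  qed
qed

text \<open>If A is paired with B, subtracting the unit vector of A from the pair leaves the unit
  vector of B up to sign, and B survives as a single.\<close>

lemma fillable_remove_single:
  assumes "fillable \<tau> pr M S" "vec_subspace M" "pr \<in> S \<rightarrow> \<alpha>" "A \<in> S" "basis_vec A \<in> M"
  shows "fillable \<tau> pr M (S - {A})"
  using fillable_exchange[OF assms(1-4)]
proof (elim disjE exE conjE)
  fix B s
  assume B: "B \<in> S" "short_pair \<tau> pr A B s" "pair_vec A B s \<in> M" "fillable \<tau> pr M (S - {A, B})"
  have s: "s = 1 \<or> s = - 1" "A \<noteq> B" using B by (auto simp: short_pair_def)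
  have "basis_vec B = (\<lambda>X. s * pair_vec A B s X + (- s) * basis_vec A X)"
    using s by (auto simp: pair_vec_def)
  also have "\<dots> \<in> M" by (rule vec_subspace_comb[OF assms(2) B(3) assms(5)])
  finally have "fillable \<tau> pr M (insert B (S - {A, B}))" using B by (intro fillable.single) auto
  also have "insert B (S - {A, B}) = S - {A}" using B s by auto
  finally show ?thesis .
qed

text \<open>If A and B have different partners D and E, the three vectors form a path D, A, B, E
  whose ends become a new pair. If one of A, B is a single, then both unit vectors lie in M, and a
  former partner of the other becomes a single.\<close>

lemma fillable_remove_pair:
  assumes fS: "fillable \<tau> pr M S" and M: "vec_subspace M" and pr: "pr \<in> S \<rightarrow> \<alpha>"
    and AB: "A \<in> S" "B \<in> S" "short_pair \<tau> pr A B s" "pair_vec A B s \<in> M"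
  shows "fillable \<tau> pr M (S - {A, B})"
proof -
  have ab: "A \<noteq> B" and s: "s = 1 \<or> s = - 1" using AB by (auto simp: short_pair_def)
  have unitB: "basis_vec B \<in> M" if "basis_vec A \<in> M"
  proof -
    have "basis_vec B = (\<lambda>X. s * pair_vec A B s X + (- s) * basis_vec A X)"
      using s by (auto simp: pair_vec_def)
    also have "\<dots> \<in> M" by (rule vec_subspace_comb[OF M AB(4) that])
    finally show ?thesis .
  qed
  have del: "S - {A, B} = S - {A} - {B}" by auto
  show ?thesis
    using fillable_exchange[OF fS M pr AB(1)]
  proof (elim disjE exE conjE)
    assume "basis_vec A \<in> M" "fillable \<tau> pr M (S - {A})"
    then show ?thesis
      unfolding del using pr ab AB M unitB by (intro fillable_remove_single[of _ _ "S - {A}"]) auto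
  next
    fix D t
    assume D: "D \<in> S" "short_pair \<tau> pr A D t" "pair_vec A D t \<in> M" "fillable \<tau> pr M (S - {A, D})"
    have t: "t = 1 \<or> t = - 1" "A \<noteq> D" using D by (auto simp: short_pair_def)
    show ?thesis
    proof (cases "D = B")
      case True
      then show ?thesis using D by simp
    next
      case False
      have "B \<in> S - {A, D}" using AB ab False by auto
      from fillable_exchange[OF D(4) M _ this] pr
      consider "basis_vec B \<in> M" "fillable \<tau> pr M (S - {A, D} - {B})"
        | E u where "E \<in> S - {A, D}" "short_pair \<tau> pr B E u" "pair_vec B E u \<in> M"
            "fillable \<tau> pr M (S - {A, D} - {B, E})" by auto
      then show ?thesis
      proof cases
        case 1
        have "basis_vec A = (\<lambda>X. 1 * pair_vec A B s X + (- s) * basis_vec B X)"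
          by (auto simp: pair_vec_def)
        also have "\<dots> \<in> M" by (rule vec_subspace_comb[OF M AB(4) 1(1)])
        finally have A: "basis_vec A \<in> M" .
        have "basis_vec D = (\<lambda>X. t * pair_vec A D t X + (- t) * basis_vec A X)"
          using t by (auto simp: pair_vec_def)
        also have "\<dots> \<in> M" by (rule vec_subspace_comb[OF M D(3) A])
        finally have "fillable \<tau> pr M (insert D (S - {A, D} - {B}))"
          using 1 by (intro fillable.single) auto
        also have "insert D (S - {A, D} - {B}) = S - {A, B}" using D t False by auto
        finally show ?thesis .
      next
        case (2 E u)
        have u: "u = 1 \<or> u = - 1" "E \<noteq> B" using 2 by (auto simp: short_pair_def)
        \<comment> \<open>The coefficients make A and B cancel and give D the coefficient t * t =
          1.\<close>
        have "pair_vec D E (t * s * u) =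
          (\<lambda>X. 1 * (t * pair_vec A D t X + (- t) * pair_vec A B s X) + (t * s) * pair_vec B E u X)"
          using t by (auto simp: pair_vec_def algebra_simps)
        also have "\<dots> \<in> M"
          by (rule vec_subspace_comb[OF M vec_subspace_comb[OF M D(3) AB(4)] 2(3)])
        finally have "pair_vec D E (t * s * u) \<in> M" .
        moreover have "short_pair \<tau> pr D E (t * s * u)"
          using 2 D AB pr by (intro short_pair_comp[of pr A D t B s]) auto
        ultimately have "fillable \<tau> pr M (insert D (insert E (S - {A, D} - {B, E})))"
          using 2 by (intro fillable.pair) auto
        also have "insert D (insert E (S - {A, D} - {B, E})) = S - {A, B}" using D 2 t u False by auto
        finally show ?thesis .
      qed
    qed
  qed
qed

text \<open>
  The pairs of two overlapping fillings form paths and cycles; letters are eliminated by replacing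
  each path by the signed sum of its pairs.
\<close>

lemma fillable_Diff:
  assumes "fillable \<tau> pr M T" "fillable \<tau> pr M S" "vec_subspace M" "pr \<in> S \<rightarrow> \<alpha>" "T \<subseteq> S"
  shows "fillable \<tau> pr M (S - T)"
  using assms
proof (induction arbitrary: S)
  case empty
  then show ?case by simp
next
  case (single T A)
  then have "fillable \<tau> pr M (S - T - {A})" by (intro fillable_remove_single) auto
  also have "S - T - {A} = S - insert A T" by auto
  finally show ?case .
next
  case (pair T A B s)
  then have "fillable \<tau> pr M (S - T - {A, B})" by (intro fillable_remove_pair) auto
  also have "S - T - {A, B} = S - insert A (insert B T)" by auto
  finally show ?case .
qed

text \<open>The parts are the orbits of \<iota>, split off one at a time.\<close>

lemma fillable_of_involution:
  assumes "finite T" and "\<And>A. A \<in> T \<Longrightarrow> \<iota> A \<in> T" and "\<And>A. A \<in> T \<Longrightarrow> \<iota> (\<iota> A) = A"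
    and "\<And>A. A \<in> T \<Longrightarrow> \<iota> A = A \<Longrightarrow> basis_vec A \<in> M"
    and "\<And>A. A \<in> T \<Longrightarrow> \<iota> A \<noteq> A \<Longrightarrow> short_pair \<tau> pr A (\<iota> A) (s A) \<and> pair_vec A (\<iota> A) (s A) \<in> M"
  shows "fillable \<tau> pr M T"
  using assms
proof (induction "card T" arbitrary: T rule: less_induct)
  case less
  show ?case
  proof (cases "T = {}")
    case True
    then show ?thesis by (simp add: fillable.empty)
  next
    case False
    then obtain A where A: "A \<in> T" by auto
    have "fillable \<tau> pr M (T - {A, \<iota> A})"
    proof (rule less.hyps)
      show "card (T - {A, \<iota> A}) < card T" using A less.prems(1) by (intro psubset_card_mono) auto
      show "\<And>B. B \<in> T - {A, \<iota> A} \<Longrightarrow> \<iota> B \<in> T - {A, \<iota> A}"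
        using less.prems(2,3) A by (metis Diff_iff insert_iff empty_iff)
    qed (use less.prems in auto)
    moreover have "insert A (insert (\<iota> A) (T - {A, \<iota> A})) = T" using A less.prems(2) by auto
    ultimately show ?thesis
      using fillable.single[of \<tau> pr M "T - {A, \<iota> A}" A]
        fillable.pair[of \<tau> pr M "T - {A, \<iota> A}" A "\<iota> A" "s A"] less.prems(4,5)[OF A]
      by (cases "\<iota> A = A") auto
  qed
qed

end

section \<open>The intersection form of a word\<close>

lemma occurrences:
  assumes "count_list w A = 2"
  shows "first_occ w A < last_occ w A"
    and "{i. i < length w \<and> w ! i = A} = {first_occ w A, last_occ w A}"
proof -
  let ?X = "{i. i < length w \<and> w ! i = A}"
  have "?X = {i. i < length w \<and> A = w ! i}" by auto
  then have "card ?X = 2"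
    using assms by (simp add: count_list_eq_length_filter length_filter_conv_card)
  then obtain a b where ab: "?X = {a, b}" "a \<noteq> b" by (meson card_2_iff)
  then have "first_occ w A = min a b" "last_occ w A = max a b"
    by (auto simp: first_occ_def last_occ_def)
  then show "first_occ w A < last_occ w A" "?X = {first_occ w A, last_occ w A}"
    using ab by (auto simp: min_def max_def)
qed

lemma occurrencesI:
  assumes "{i. i < length w \<and> w ! i = A} = {a, b}" "a < b"
  shows "first_occ w A = a" "last_occ w A = b"
  using assms by (auto simp: first_occ_def last_occ_def)

lemma occurrence_nth:
  assumes "count_list w A = 2"
  shows "first_occ w A < length w" "last_occ w A < length w"
    "w ! first_occ w A = A" "w ! last_occ w A = A"
  using occurrences(2)[OF assms] by blast+

lemma occurrence_cases:
  assumes "count_list w A = 2" "i < length w" "w ! i = A"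
  shows "i = first_occ w A \<or> i = last_occ w A"
  using occurrences(2)[OF assms(1)] assms(2,3) by blast

text \<open>The map h lists the surviving positions in increasing order. Deleting letters thus keeps
  the relative order of the others, which is all that the form depends on.\<close>

lemma filter_positions:
  "\<exists>h. strict_mono_on {..<length (filter P w)} h \<and>
       h ` {..<length (filter P w)} = {i. i < length w \<and> P (w ! i)} \<and>
       (\<forall>i < length (filter P w). filter P w ! i = w ! h i)"
proof (induction w rule: rev_induct)
  case Nil
  then show ?case by (auto simp: strict_mono_on_def)
next
  case (snoc a w)
  then obtain h where h: "strict_mono_on {..<length (filter P w)} h"
    "h ` {..<length (filter P w)} = {i. i < length w \<and> P (w ! i)}"
    "\<And>i. i < length (filter P w) \<Longrightarrow> filter P w ! i = w ! h i" by auto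
  let ?n = "length (filter P w)"
  have lt: "h i < length w" if "i < ?n" for i using h(2) that by blast
  show ?case
  proof (cases "P a")
    case False
    then have "{i. i < length (w @ [a]) \<and> P ((w @ [a]) ! i)} = {i. i < length w \<and> P (w ! i)}"
      by (auto simp: nth_append less_Suc_eq)
    then show ?thesis using False h lt by (intro exI[of _ h]) (auto simp: nth_append)
  next
    case True
    define h' where "h' = h(?n := length w)"
    have "{..<length (filter P (w @ [a]))} = insert ?n {..<?n}" using True by auto
    moreover have "h' ` {..<?n} = h ` {..<?n}" by (auto simp: h'_def)
    ultimately have "h' ` {..<length (filter P (w @ [a]))} =
      insert (length w) {i. i < length w \<and> P (w ! i)}"
      using h(2) by (simp only: image_insert) (simp add: h'_def)
    also have "\<dots> = {i. i < length (w @ [a]) \<and> P ((w @ [a]) ! i)}"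
      using True by (auto simp: nth_append less_Suc_eq)
    finally have "h' ` {..<length (filter P (w @ [a]))} = \<dots>" .
    moreover have "strict_mono_on {..<length (filter P (w @ [a]))} h'"
      using True h(1) lt by (auto simp: h'_def strict_mono_on_def less_Suc_eq)
    moreover have "filter P (w @ [a]) ! i = (w @ [a]) ! h' i" if "i < length (filter P (w @ [a]))" for i
      using that True h(3) lt by (auto simp: h'_def nth_append less_Suc_eq)
    ultimately show ?thesis by blast
  qed
qed

section \<open>Heights and the antisymmetric form\<close>

definition sg :: "nat \<Rightarrow> nat \<Rightarrow> rat" where
  "sg p q = of_int (sgn (int p - int q))"

lemma sg_swap: "sg q p = - sg p q"
  by (simp add: sg_def sgn_if)

lemma sg_simps: "p < q \<Longrightarrow> sg p q = - 1" "q < p \<Longrightarrow> sg p q = 1" "sg p p = 0"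
  by (auto simp: sg_def)

lemma sg_strict_mono_on:
  fixes h :: "nat \<Rightarrow> nat"
  assumes "strict_mono_on X h" "p \<in> X" "q \<in> X"
  shows "sg (h p) (h q) = sg p q"
  using assms(2,3) strict_mono_onD[OF assms(1), of p q] strict_mono_onD[OF assms(1), of q p]
  by (cases p q rule: linorder_cases) (auto simp: sg_simps)

text \<open>
  Heights are doubled winding numbers: the loop of a letter has height 2 inside, 0 outside, and 1
  at the two occurrences of the letter itself.  The value 1 at the ends produces the term
  \<open>n\<^sub>w(A, B) (|A| + |B|)\<close> of \<open>e\<^sub>w(A, B)\<close>; the element \<open>s\<close> has constant height 1.
\<close>

definition loop_height :: "'b list \<Rightarrow> 'b \<Rightarrow> nat \<Rightarrow> rat" where
  "loop_height w A p = sg p (first_occ w A) - sg p (last_occ w A)"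

definition height :: "'b list \<Rightarrow> 'b set \<Rightarrow> rat \<Rightarrow> ('b \<Rightarrow> rat) \<Rightarrow> nat \<Rightarrow> rat" where
  "height w L t x p = t + (\<Sum>A\<in>L. x A * loop_height w A p)"

text \<open>An alternating form on functions of positions: each letter contributes a weighted 2 by 2
  determinant of the values at its two occurrences.\<close>

definition omega :: "('b \<Rightarrow> rat) \<Rightarrow> 'b list \<Rightarrow> 'b set \<Rightarrow> (nat \<Rightarrow> rat) \<Rightarrow> (nat \<Rightarrow> rat) \<Rightarrow> rat" where
  "omega c w L F G =
     (\<Sum>D\<in>L. c D * (F (first_occ w D) * G (last_occ w D) - F (last_occ w D) * G (first_occ w D)))"

definition word_form ::
    "('b \<Rightarrow> rat) \<Rightarrow> 'b list \<Rightarrow> 'b set \<Rightarrow> rat \<Rightarrow> ('b \<Rightarrow> rat) \<Rightarrow> rat \<Rightarrow> ('b \<Rightarrow> rat) \<Rightarrow> rat" where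
  "word_form c w L t x u y = omega c w L (height w L t x) (height w L u y) / 2"

lemma omega_cong:
  assumes "\<And>D. D \<in> L \<Longrightarrow> c D = c' D"
    and "\<And>D. D \<in> L \<Longrightarrow> F (first_occ w D) = F' (first_occ w D) \<and> F (last_occ w D) = F' (last_occ w D)"
    and "\<And>D. D \<in> L \<Longrightarrow> G (first_occ w D) = G' (first_occ w D) \<and> G (last_occ w D) = G' (last_occ w D)"
  shows "omega c w L F G = omega c' w L F' G'"
  unfolding omega_def by (rule sum.cong) (use assms in auto)

lemma omega_add_left: "omega c w L (\<lambda>p. F p + F' p) G = omega c w L F G + omega c w L F' G"
  by (simp add: omega_def sum.distrib[symmetric] algebra_simps)

lemma omega_add_right: "omega c w L F (\<lambda>p. G p + G' p) = omega c w L F G + omega c w L F G'"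
  by (simp add: omega_def sum.distrib[symmetric] algebra_simps)

lemma omega_sum_left:
  "omega c w L (\<lambda>p. \<Sum>i\<in>I. q i * F i p) G = (\<Sum>i\<in>I. q i * omega c w L (F i) G)"
proof -
  have "omega c w L (\<lambda>p. \<Sum>i\<in>I. q i * F i p) G = (\<Sum>D\<in>L. \<Sum>i\<in>I. q i * (c D *
    (F i (first_occ w D) * G (last_occ w D) - F i (last_occ w D) * G (first_occ w D))))"
    unfolding omega_def
    by (rule sum.cong) (simp_all add: sum_distrib_left sum_distrib_right sum_subtractf algebra_simps)
  also have "\<dots> = (\<Sum>i\<in>I. q i * omega c w L (F i) G)"
    unfolding omega_def by (subst sum.swap) (simp add: sum_distrib_left)
  finally show ?thesis .
qed

lemma omega_swap: "omega c w L G F = - omega c w L F G"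
  unfolding omega_def sum_negf[symmetric] by (rule sum.cong) (auto simp: algebra_simps)

lemma omega_Un:
  assumes "finite L" "finite L'" "L \<inter> L' = {}"
  shows "omega c w (L \<union> L') F G = omega c w L F G + omega c w L' F G"
  unfolding omega_def by (rule sum.union_disjoint) (use assms in auto)

lemma height_add:
  "height w L (t + u) (\<lambda>A. x A + y A) p = height w L t x p + height w L u y p"
  by (simp add: height_def algebra_simps sum.distrib)

lemma height_supp:
  assumes "finite L'" "L \<subseteq> L'" "\<And>A. A \<in> L' - L \<Longrightarrow> x A = 0"
  shows "height w L' t x p = height w L t x p"
  unfolding height_def by (intro arg_cong2[where f = "(+)"] sum.mono_neutral_right) (use assms in auto)

text \<open>Heights are built from signs of differences of positions, so an increasing map of
  positions preserves them. With h = id this serves isomorphisms, and with h the list of surviving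
  positions it serves the deletion of letters.\<close>

lemma word_form_transfer:
  assumes g: "bij_betw g L L'"
    and first: "\<And>A. A \<in> L \<Longrightarrow> first_occ w' (g A) = h (first_occ w A)"
    and last: "\<And>A. A \<in> L \<Longrightarrow> last_occ w' (g A) = h (last_occ w A)"
    and h: "strict_mono_on X h"
    and X: "\<And>A. A \<in> L \<Longrightarrow> first_occ w A \<in> X \<and> last_occ w A \<in> X"
    and c: "\<And>A. A \<in> L \<Longrightarrow> c' (g A) = c A"
  shows "word_form c' w' L' t x u y = word_form c w L t (x \<circ> g) u (y \<circ> g)"
proof -
  have loop_height: "loop_height w' (g A) (h p) = loop_height w A p" if "A \<in> L" "p \<in> X" for A p
    using that X[OF that(1)] by (simp add: loop_height_def first last sg_strict_mono_on[OF h])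
  have height: "height w' L' t x (h p) = height w L t (x \<circ> g) p" if "p \<in> X" for t x p
    unfolding height_def sum.reindex_bij_betw[OF g, symmetric]
    using that by (simp add: loop_height)
  show ?thesis
    unfolding word_form_def omega_def sum.reindex_bij_betw[OF g, symmetric]
    by (simp add: first last X height c)
qed

text \<open>Every Gram matrix of e on a finite family in X then has rank at most m. The factors are
  arbitrary functions instead of linear forms, so that they can be composed with vectors picked by
  choice.\<close>

definition product_rank_le :: "nat \<Rightarrow> ('x \<Rightarrow> 'x \<Rightarrow> rat) \<Rightarrow> 'x set \<Rightarrow> bool" where
  "product_rank_le m e X \<longleftrightarrow>
     (\<exists>f g :: nat \<Rightarrow> 'x \<Rightarrow> rat. \<forall>x\<in>X. \<forall>y\<in>X. e x y = (\<Sum>l<m. f l x * g l y))"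

text \<open>The old factors are pulled back along h, and the products of the correction term are
  appended to them.\<close>

lemma product_rank_le_transfer:
  assumes e: "product_rank_le m e X" and I: "finite I" "card I = n"
    and h: "\<And>x. x \<in> Y \<Longrightarrow> h x \<in> X"
    and e': "\<And>x y. x \<in> Y \<Longrightarrow> y \<in> Y \<Longrightarrow> e' x y = e (h x) (h y) + (\<Sum>i\<in>I. p i x * q i y)"
  shows "product_rank_le (m + n) e' Y"
proof -
  obtain f g where fg: "\<And>x y. x \<in> X \<Longrightarrow> y \<in> X \<Longrightarrow> e x y = (\<Sum>l<m. f l x * g l y)"
    using e unfolding product_rank_le_def by auto
  obtain k where k: "bij_betw k {..<n} I"
    using ex_bij_betw_nat_finite[OF I(1)] I(2) by (auto simp: atLeast0LessThan)
  have split: "(\<Sum>l<m + n. r l) = (\<Sum>l<m. r l) + (\<Sum>l<n. r (m + l))" for r :: "nat \<Rightarrow> rat"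
    by (induction n) auto
  define F where "F l x = (if l < m then f l (h x) else p (k (l - m)) x)" for l x
  define G where "G l y = (if l < m then g l (h y) else q (k (l - m)) y)" for l y
  have "e' x y = (\<Sum>l<m + n. F l x * G l y)" if "x \<in> Y" "y \<in> Y" for x y
    unfolding split e'[OF that] fg[OF h[OF that(1)] h[OF that(2)]]
      sum.reindex_bij_betw[OF k, symmetric] by (simp add: F_def G_def)
  then show ?thesis unfolding product_rank_le_def by (intro exI[of _ F] exI[of _ G] ballI)
qed

context signed_involution
begin

definition weight :: "('a, 'b) nanoword \<Rightarrow> 'b \<Rightarrow> rat" where
  "weight W A = \<chi> (lproj W A)"

definition nw_form :: "('a, 'b) nanoword \<Rightarrow> rat \<times> ('b \<Rightarrow> rat) \<Rightarrow> rat \<times> ('b \<Rightarrow> rat) \<Rightarrow> rat" where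
  "nw_form W x y = word_form (weight W) (word W) (letters W) (fst x) (snd x) (fst y) (snd y)"

text \<open>A pair \<open>(t, x)\<close> stands for the vector \<open>t s + x\<close>.\<close>

definition low_rank_filling :: "nat \<Rightarrow> ('a, 'b) nanoword \<Rightarrow> bool" where
  "low_rank_filling m W \<longleftrightarrow> (\<exists>M. vec_subspace M \<and> fillable \<tau> (lproj W) M (letters W) \<and>
     product_rank_le m (nw_form W) (UNIV \<times> M))"

lemma low_rank_filling_isomorphic:
  assumes W: "is_nanoword \<alpha> W" and W': "is_nanoword \<alpha> W'"
    and iso: "nw_isomorphic W W'" and low_rank_filling: "low_rank_filling m W'"
  shows "low_rank_filling m W"
proof -
  obtain f where f: "bij_betw f (letters W) (letters W')"
    and lp: "\<And>A. A \<in> letters W \<Longrightarrow> lproj W' (f A) = lproj W A" and wd: "word W' = map f (word W)"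
    using iso unfolding nw_isomorphic_def by auto
  define g where "g = inv_into (letters W) f"
  have g: "bij_betw g (letters W') (letters W)" unfolding g_def using f by (rule bij_betw_inv_into)
  have fg: "f (g B) = B" if "B \<in> letters W'" for B
    unfolding g_def using f that by (simp add: bij_betw_inv_into_right)
  have gf: "g (f A) = A" if "A \<in> letters W" for A
    unfolding g_def using f that by (simp add: bij_betw_inv_into_left)
  have gL: "g B \<in> letters W" if "B \<in> letters W'" for B using g that by (auto simp: bij_betw_def)
  have g_inj: "g B = g C \<longleftrightarrow> B = C" if "B \<in> letters W'" "C \<in> letters W'" for B C
    using fg[OF that(1)] fg[OF that(2)] by metis
  have fL: "f A \<in> letters W'" if "A \<in> letters W" for A using f that by (auto simp: bij_betw_def)
  have occ: "first_occ (word W) A = first_occ (word W') (f A)"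
    "last_occ (word W) A = last_occ (word W') (f A)" if "A \<in> letters W" for A
  proof -
    have "{i. i < length (word W) \<and> word W ! i = A} = {i. i < length (word W') \<and> word W' ! i = f A}"
      using W that gf unfolding wd is_nanoword_def
      by (auto simp: subset_iff) (metis nth_mem)
    then show "first_occ (word W) A = first_occ (word W') (f A)"
      "last_occ (word W) A = last_occ (word W') (f A)"
      unfolding first_occ_def last_occ_def by simp_all
  qed
  have occ_g: "lproj W (g B) = lproj W' B" "first_occ (word W) (g B) = first_occ (word W') B"
    "last_occ (word W) (g B) = last_occ (word W') B" if "B \<in> letters W'" for B
    using occ[of "g B"] lp[of "g B"] gL fg that by simp_all
  obtain M where M: "vec_subspace M" "fillable \<tau> (lproj W') M (letters W')"
    "product_rank_le m (nw_form W') (UNIV \<times> M)" using low_rank_filling unfolding low_rank_filling_def by auto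
  \<comment> \<open>Vectors are functions on the whole type, so values off the alphabet are cut
    away; otherwise a unit vector on W might not restrict to a unit vector on
    \<open>W'\<close>.\<close>
  define res where "res x = (\<lambda>B. if B \<in> letters W' then x (g B) else 0)" for x :: "'b \<Rightarrow> rat"
  define N where "N = {x. res x \<in> M}"
  have "vec_subspace N"
  proof -
    have "res (\<lambda>A. x A + y A) = (\<lambda>B. res x B + res y B)" "res (\<lambda>A. q * x A) = (\<lambda>B. q * res x B)"
      "res (\<lambda>_. 0) = (\<lambda>_. 0)" for x y q
      by (auto simp: res_def)
    then show ?thesis using M(1) unfolding vec_subspace_def N_def by simp
  qed
  moreover have "fillable \<tau> (lproj W) N (g ` S)" if "fillable \<tau> (lproj W') M S" "S \<subseteq> letters W'" for S
    using that
  proof (induction)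
    case empty
    then show ?case by (simp add: fillable.empty)
  next
    case (single S A)
    then have "res (basis_vec (g A)) = basis_vec A"
      by (auto simp: res_def basis_vec_def fun_eq_iff g_inj)
    then have "basis_vec (g A) \<in> N" using single by (simp add: N_def)
    moreover have "g A \<notin> g ` S" using single fg by (metis image_iff insert_subset subsetD)
    ultimately show ?case using single by (simp add: fillable.single)
  next
    case (pair S A B s)
    then have "res (pair_vec (g A) (g B) s) = pair_vec A B s"
      by (auto simp: res_def basis_vec_def fun_eq_iff pair_vec_def g_inj)
    then have "pair_vec (g A) (g B) s \<in> N" using pair by (simp add: N_def)
    moreover have "g A \<notin> g ` S" "g B \<notin> g ` S"
      using pair fg by (metis image_iff insert_subset subsetD)+
    moreover have "short_pair \<tau> (lproj W) (g A) (g B) s"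
      using pair lp[of "g A"] lp[of "g B"] gL fg g_inj[of A B] by (auto simp: short_pair_def)
    ultimately show ?case using pair by (simp add: fillable.pair)
  qed
  from this[OF M(2)] have "fillable \<tau> (lproj W) N (letters W)" using g by (simp add: bij_betw_def)
  moreover have "product_rank_le (m + 0) (nw_form W) (UNIV \<times> N)"
  proof (rule product_rank_le_transfer[OF M(3), where I = "{} :: nat set" and p = "\<lambda>_ _. 0"
        and q = "\<lambda>_ _. 0" and h = "\<lambda>(t, x). (t, res x)"])
    fix X Y :: "rat \<times> ('b \<Rightarrow> rat)"
    obtain t x u y where [simp]: "X = (t, x)" "Y = (u, y)" by fastforce
    have "word_form (weight W) (word W) (letters W) t x u y =
      word_form (weight W') (word W') (letters W') t (x \<circ> g) u (y \<circ> g)"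
      by (rule word_form_transfer[OF g, where h = id and X = UNIV])
        (auto simp: weight_def strict_mono_on_def occ_g)
    also have "\<dots> = word_form (weight W') (word W') (letters W') t (res x) u (res y)"
    proof -
      have "height (word W') (letters W') t (x \<circ> g) = height (word W') (letters W') t (res x)" for t x
        by (rule ext) (simp add: height_def res_def)
      then show ?thesis unfolding word_form_def by simp
    qed
    finally show "nw_form W X Y =
      nw_form W' (case X of (t, x) \<Rightarrow> (t, res x)) (case Y of (t, x) \<Rightarrow> (t, res x)) +
      (\<Sum>i\<in>({} :: nat set). 0 * 0)" by (simp add: nw_form_def)
  qed (auto simp: N_def)
  ultimately show ?thesis unfolding low_rank_filling_def by auto
qed

lemma low_rank_filling_empty: "low_rank_filling 0 W" if "letters W = {}"
  unfolding low_rank_filling_def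
  by (rule exI[of _ UNIV])
    (auto simp: that vec_subspace_def fillable.empty product_rank_le_def nw_form_def word_form_def omega_def)

end

section \<open>The third homotopy move\<close>

context signed_involution
begin

text \<open>The move transposes two adjacent places three times, so heights can change only at these
  six places. All other letters contribute the same determinants as before, and the contributions of
  A, B, C are compared by direct computation.\<close>

lemma word_form_move3:
  assumes W: "is_nanoword \<alpha> W"
    and w: "word W = x @ [A, B] @ y @ [A, C] @ z @ [B, C] @ t"
    and w': "w' = x @ [B, A] @ y @ [C, A] @ z @ [C, B] @ t"
    and ABC: "distinct [A, B, C]" and c: "c A = c B" "c B = c C"
  shows "word_form c w' (letters W) p f q g = word_form c (word W) (letters W) p f q g"
proof -
  define L where "L = letters W"
  define w where "w = word W"
  \<comment> \<open>The left places of the three transposed pairs; the right places are their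
    successors.\<close>
  define a b d where "a = length x" and "b = length x + length y + 2"
    and "d = length x + length y + length z + 4"
  have abd: "Suc a < b" "Suc b < d" by (auto simp: a_def b_def d_def)
  have len: "length w = length w'" unfolding w_def assms(2) w' by simp
  have nth: "w ! a = A" "w ! Suc a = B" "w ! b = A" "w ! Suc b = C" "w ! d = B" "w ! Suc d = C"
    unfolding w_def assms(2) a_def b_def d_def by (simp_all add: nth_append)
  have nth': "w' ! a = B" "w' ! Suc a = A" "w' ! b = C" "w' ! Suc b = A" "w' ! d = C" "w' ! Suc d = B"
    unfolding w' a_def b_def d_def by (simp_all add: nth_append)
  have inb: "Suc d < length w" unfolding w_def assms(2) d_def by simp
  have other: "w' ! i = w ! i" if "i \<notin> {a, Suc a, b, Suc b, d, Suc d}" for i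
    using that unfolding w_def assms(2) w' a_def b_def d_def
    by (auto simp: nth_append nth_Cons split: nat.splits)
  have cnt: "count_list w D = 2" if "D \<in> L" for D
    using W that by (simp add: is_nanoword_def L_def w_def)
  have sub: "set w \<subseteq> L" using W by (simp add: is_nanoword_def L_def w_def)
  have in_L: "A \<in> L" "B \<in> L" "C \<in> L" using sub by (auto simp: w_def assms(2))
  have fin: "finite L" using W by (simp add: finite_letters L_def)
  have occ3: "{i. i < length w \<and> w ! i = A} = {a, b}" "{i. i < length w \<and> w ! i = B} = {Suc a, d}"
    "{i. i < length w \<and> w ! i = C} = {Suc b, Suc d}"
  proof -
    have *: "{i. i < length w \<and> w ! i = D} = {i, j}"
      if "D \<in> L" "i < j" "j < length w" "w ! i = D" "w ! j = D" for D i j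
    proof -
      have "{i, j} \<subseteq> {first_occ w D, last_occ w D}"
        unfolding occurrences(2)[OF cnt[OF that(1)], symmetric] using that by auto
      then show ?thesis unfolding occurrences(2)[OF cnt[OF that(1)]] using that(2) by auto
    qed
    show "{i. i < length w \<and> w ! i = A} = {a, b}" "{i. i < length w \<and> w ! i = B} = {Suc a, d}"
      "{i. i < length w \<and> w ! i = C} = {Suc b, Suc d}"
      using * in_L nth abd inb by auto
  qed
  have other_letter: "w ! i \<notin> {A, B, C}" if "i < length w" "i \<notin> {a, Suc a, b, Suc b, d, Suc d}" for i
    using that occ3 by blast
  have occ3': "{i. i < length w' \<and> w' ! i = A} = {Suc a, Suc b}"
    "{i. i < length w' \<and> w' ! i = B} = {a, Suc d}"
    "{i. i < length w' \<and> w' ! i = C} = {b, d}"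
  proof -
    have *: "i \<in> {a, Suc a, b, Suc b, d, Suc d}" if "i < length w'" "w' ! i \<in> {A, B, C}" for i
      using that other[of i] other_letter[of i] len by metis
    have six: "i < length w'" if "i \<in> {a, Suc a, b, Suc b, d, Suc d}" for i
      using that abd inb len by auto
    have **: "{i. i < length w' \<and> w' ! i = D} = {i \<in> {a, Suc a, b, Suc b, d, Suc d}. w' ! i = D}"
      if "D \<in> {A, B, C}" for D
      using *[of _] six that by (intro Collect_cong) metis
    show "{i. i < length w' \<and> w' ! i = A} = {Suc a, Suc b}"
      unfolding **[of A, simplified] using nth' ABC by auto
    show "{i. i < length w' \<and> w' ! i = B} = {a, Suc d}"
      unfolding **[of B, simplified] using nth' ABC by auto
    show "{i. i < length w' \<and> w' ! i = C} = {b, d}"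
      unfolding **[of C, simplified] using nth' ABC by auto
  qed
  have occD: "{i. i < length w' \<and> w' ! i = D} = {i. i < length w \<and> w ! i = D}"
    if "D \<notin> {A, B, C}" for D
  proof (rule Collect_cong)
    fix i
    show "i < length w' \<and> w' ! i = D \<longleftrightarrow> i < length w \<and> w ! i = D"
    proof (cases "i \<in> {a, Suc a, b, Suc b, d, Suc d}")
      case True
      then have "w ! i \<in> {A, B, C}" "w' ! i \<in> {A, B, C}" using nth nth' by auto
      then show ?thesis using that by metis
    next
      case False
      then show ?thesis using other len by simp
    qed
  qed
  note fl = occurrencesI[OF occ3(1)] occurrencesI[OF occ3(2)] occurrencesI[OF occ3(3)]
    occurrencesI[OF occ3'(1)] occurrencesI[OF occ3'(2)] occurrencesI[OF occ3'(3)]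
  have FL: "first_occ w A = a" "last_occ w A = b" "first_occ w B = Suc a" "last_occ w B = d"
    "first_occ w C = Suc b" "last_occ w C = Suc d"
    "first_occ w' A = Suc a" "last_occ w' A = Suc b" "first_occ w' B = a" "last_occ w' B = Suc d"
    "first_occ w' C = b" "last_occ w' C = d"
    using fl abd by auto
  have FLD: "first_occ w' D = first_occ w D" "last_occ w' D = last_occ w D"
    if "D \<notin> {A, B, C}" for D
    using occD[OF that] by (simp_all add: first_occ_def last_occ_def)
  define R where "R = L - {A, B, C}"
  have LR: "L = insert A (insert B (insert C R))" using in_L by (auto simp: R_def)
  have R: "finite R" "A \<notin> R" "B \<notin> R" "C \<notin> R" "A \<noteq> B" "A \<noteq> C" "B \<noteq> C"
    using fin ABC by (auto simp: R_def)
  have FLR: "first_occ w' D = first_occ w D" "last_occ w' D = last_occ w D" if "D \<in> R" for D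
    using that FLD[of D] by (auto simp: R_def)
  define pos where "pos = {i. i \<notin> {a, Suc a, b, Suc b, d, Suc d}}"
  have posR: "first_occ w D \<in> pos" "last_occ w D \<in> pos" if "D \<in> R" for D
    using occurrence_nth[OF cnt[of D]] that nth unfolding pos_def R_def by (auto 4 3)
  have base: "height w' R t f i = height w R t f i" for t f i
    unfolding height_def by (intro arg_cong2[where f = "(+)"] sum.cong) (auto simp: loop_height_def FLR)
  have hL: "height v L t f i = height v R t f i + f A * loop_height v A i + f B * loop_height v B i + f C * loop_height v C i"
    for v t f i unfolding height_def LR using R by simp
  have sg_pos: "sg (Suc a) i = sg a i" "sg (Suc b) i = sg b i" "sg (Suc d) i = sg d i"
    "sg i (Suc a) = sg i a" "sg i (Suc b) = sg i b" "sg i (Suc d) = sg i d"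
    if "i \<in> pos" for i
    using that by (auto simp: pos_def sg_def sgn_if)
  \<comment> \<open>The letters in R have no end at the six places, so their loops do not separate
    the two places of a pair.\<close>
  have flat: "height w R t f (Suc a) = height w R t f a" "height w R t f (Suc b) = height w R t f b"
    "height w R t f (Suc d) = height w R t f d" for t f
    unfolding height_def loop_height_def by (simp_all add: sg_pos posR)
  have same: "height w' L t f i = height w L t f i" if "i \<in> pos" for t f i
    unfolding hL base using that by (simp add: loop_height_def FL sg_pos)
  have rest: "omega c w' R (height w' L p f) (height w' L q g) =
    omega c w R (height w L p f) (height w L q g)"
    unfolding omega_def by (rule sum.cong) (simp_all add: FLR same posR)
  have sgv: "sg a (Suc a) = - 1" "sg (Suc a) a = 1" "sg a b = - 1" "sg b a = 1" "sg a (Suc b) = - 1"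
    "sg (Suc b) a = 1" "sg (Suc a) b = - 1" "sg b (Suc a) = 1" "sg (Suc a) (Suc b) = - 1"
    "sg (Suc b) (Suc a) = 1" "sg a d = - 1" "sg d a = 1" "sg a (Suc d) = - 1" "sg (Suc d) a = 1"
    "sg (Suc a) d = - 1" "sg d (Suc a) = 1" "sg (Suc a) (Suc d) = - 1" "sg (Suc d) (Suc a) = 1"
    "sg b (Suc b) = - 1" "sg (Suc b) b = 1" "sg b d = - 1" "sg d b = 1" "sg b (Suc d) = - 1"
    "sg (Suc d) b = 1" "sg (Suc b) d = - 1" "sg d (Suc b) = 1" "sg (Suc b) (Suc d) = - 1"
    "sg (Suc d) (Suc b) = 1" "sg d (Suc d) = - 1" "sg (Suc d) d = 1" "sg i i = 0" for i
    using abd by (auto simp: sg_simps)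
  have three: "omega c v L F G =
    c A * (F (first_occ v A) * G (last_occ v A) - F (last_occ v A) * G (first_occ v A)) +
    c B * (F (first_occ v B) * G (last_occ v B) - F (last_occ v B) * G (first_occ v B)) +
    c C * (F (first_occ v C) * G (last_occ v C) - F (last_occ v C) * G (first_occ v C)) +
    omega c v R F G" for v F G
    unfolding omega_def LR using R by simp
  \<comment> \<open>With equal weights this is a polynomial identity in the coefficients of A, B, C
    and the heights of the other letters at a, b, d.\<close>
  have "omega c w' L (height w' L p f) (height w' L q g) = omega c w L (height w L p f) (height w L q g)"
    unfolding three rest unfolding hL base FL loop_height_def flat sgv c by (simp add: algebra_simps)
  then show ?thesis unfolding word_form_def L_def w_def by simp
qed

lemma low_rank_filling_move3:
  assumes W: "is_nanoword \<alpha> W"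
    and w: "word W = x @ [A, B] @ y @ [A, C] @ z @ [B, C] @ t"
    and ABC: "distinct [A, B, C]" and lp: "lproj W A = lproj W B" "lproj W B = lproj W C"
  shows "low_rank_filling m (W\<lparr>word := x @ [B, A] @ y @ [C, A] @ z @ [C, B] @ t\<rparr>) \<longleftrightarrow> low_rank_filling m W"
proof -
  let ?W' = "W\<lparr>word := x @ [B, A] @ y @ [C, A] @ z @ [C, B] @ t\<rparr>"
  have "weight ?W' = weight W" by (rule ext) (simp add: weight_def)
  moreover have "weight W A = weight W B" "weight W B = weight W C"
    using lp by (simp_all add: weight_def)
  ultimately have "nw_form ?W' = nw_form W"
    using word_form_move3[OF W w refl ABC, of "weight W"] by (intro ext) (simp add: nw_form_def)
  then show ?thesis unfolding low_rank_filling_def by simp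
qed

end

section \<open>Reflected letters of a bridge\<close>

text \<open>At a fixed point y equals its own negative and vanishes; the two terms of an arch
  combine into one. This is how sums over blocks become sums over arches.\<close>

lemma sum_antisymmetric_orbits:
  fixes y g :: "nat \<Rightarrow> rat"
  assumes lt: "\<And>r. r < k \<Longrightarrow> \<kappa> r < k" and inv: "\<And>r. r < k \<Longrightarrow> \<kappa> (\<kappa> r) = r"
    and y: "\<And>r. r < k \<Longrightarrow> y (\<kappa> r) = - y r"
  shows "(\<Sum>r<k. y r * g r) = (\<Sum>r | r < k \<and> r < \<kappa> r. y r * (g r - g (\<kappa> r)))"
proof -
  let ?O = "{r. r < k \<and> r < \<kappa> r}" and ?E = "{r. r < k \<and> r = \<kappa> r}" and ?U = "{r. r < k \<and> \<kappa> r < r}"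
  have split: "{..<k} = (?O \<union> ?U) \<union> ?E" by auto
  have E: "y r = 0" if "r \<in> ?E" for r using y[of r] that by auto
  have "(\<Sum>r<k. y r * g r) = (\<Sum>r\<in>?O \<union> ?U. y r * g r) + (\<Sum>r\<in>?E. y r * g r)"
    unfolding split by (rule sum.union_disjoint) auto
  also have "(\<Sum>r\<in>?E. y r * g r) = 0" by (rule sum.neutral) (simp add: E)
  also have "(\<Sum>r\<in>?O \<union> ?U. y r * g r) = (\<Sum>r\<in>?O. y r * g r) + (\<Sum>r\<in>?U. y r * g r)"
    by (rule sum.union_disjoint) auto
  also have "(\<Sum>r\<in>?U. y r * g r) = (\<Sum>r\<in>?O. y (\<kappa> r) * g (\<kappa> r))"
    by (rule sum.reindex_bij_witness[where i = \<kappa> and j = \<kappa>]) (auto simp: lt inv)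
  also have "\<dots> = (\<Sum>r\<in>?O. - (y r * g (\<kappa> r)))" by (rule sum.cong) (auto simp: y)
  finally show ?thesis by (simp add: sum.distrib[symmetric] algebra_simps)
qed

lemma arches_card:
  assumes lt: "\<And>r. r < k \<Longrightarrow> \<kappa> r < k" and inv: "\<And>r. r < k \<Longrightarrow> \<kappa> (\<kappa> r) = r"
  shows "arches k \<kappa> = card {r. r < k \<and> r < \<kappa> r}"
proof -
  have "{{r, \<kappa> r} | r. r < k \<and> \<kappa> r \<noteq> r} = (\<lambda>r. {r, \<kappa> r}) ` {r. r < k \<and> r < \<kappa> r}"
  proof (intro equalityI subsetI)
    fix X assume "X \<in> {{r, \<kappa> r} | r. r < k \<and> \<kappa> r \<noteq> r}"
    then obtain r where r: "X = {r, \<kappa> r}" "r < k" "\<kappa> r \<noteq> r" by auto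
    show "X \<in> (\<lambda>r. {r, \<kappa> r}) ` {r. r < k \<and> r < \<kappa> r}"
    proof (cases "r < \<kappa> r")
      case True
      then show ?thesis using r by auto
    next
      case False
      then have "X = {\<kappa> r, \<kappa> (\<kappa> r)}" "\<kappa> r < \<kappa> (\<kappa> r)" "\<kappa> r < k" using r lt inv by auto
      then show ?thesis by blast
    qed
  qed auto
  moreover have "inj_on (\<lambda>r. {r, \<kappa> r}) {r. r < k \<and> r < \<kappa> r}"
    by (auto simp: inj_on_def doubleton_eq_iff)
  ultimately show ?thesis unfolding arches_def by (simp add: card_image)
qed

text \<open>
  \<open>blk\<close> sends a position to the index of its block \<open>v\<^sub>r\<close>, and \<open>R\<close> to the symmetric position in
  the block \<open>v\<^bsub>\<kappa>(r)\<^esub>\<close>.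
\<close>

locale reflection = signed_involution \<alpha> \<tau> \<chi>
  for \<alpha> :: "'a set" and \<tau> :: "'a \<Rightarrow> 'a" and \<chi> :: "'a \<Rightarrow> rat" +
  fixes W :: "('a, 'b) nanoword" and \<B> :: "'b set" and k :: nat
    and \<kappa> blk R :: "nat \<Rightarrow> nat" and \<iota> :: "'b \<Rightarrow> 'b" and Pos :: "nat set"
  assumes nanoword: "is_nanoword \<alpha> W" and B_sub: "\<B> \<subseteq> letters W"
    and Pos: "Pos = {p. p < length (word W) \<and> word W ! p \<in> \<B>}"
    and R_Pos: "p \<in> Pos \<Longrightarrow> R p \<in> Pos" and R_R: "p \<in> Pos \<Longrightarrow> R (R p) = p"
    and blk_lt: "p \<in> Pos \<Longrightarrow> blk p < k" and blk_R: "p \<in> Pos \<Longrightarrow> blk (R p) = \<kappa> (blk p)"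
    and kappa_lt: "r < k \<Longrightarrow> \<kappa> r < k" and kappa_kappa: "r < k \<Longrightarrow> \<kappa> (\<kappa> r) = r"
    and sg_same: "p \<in> Pos \<Longrightarrow> q \<in> Pos \<Longrightarrow> blk p = blk q \<Longrightarrow> sg (R p) (R q) = - sg p q"
    and sg_diff: "p \<in> Pos \<Longrightarrow> q \<in> Pos \<Longrightarrow> blk p \<noteq> blk q \<Longrightarrow> sg p q = sg (blk p) (blk q)"
    and sg_out: "i < length (word W) \<Longrightarrow> i \<notin> Pos \<Longrightarrow> p \<in> Pos \<Longrightarrow> q \<in> Pos \<Longrightarrow> blk p = blk q \<Longrightarrow>
      sg i p = sg i q"
    and letter_R: "p \<in> Pos \<Longrightarrow> word W ! R p = \<iota> (word W ! p)"
    and lproj_iota: "B \<in> \<B> \<Longrightarrow> lproj W (\<iota> B) =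
      (if R (first_occ (word W) B) = first_occ (word W) (\<iota> B) then \<tau> (lproj W B) else lproj W B)"
begin

abbreviation "w \<equiv> word W"
abbreviation "L \<equiv> letters W - \<B>"
abbreviation "c \<equiv> weight W"
abbreviation "orbs \<equiv> {r. r < k \<and> r < \<kappa> r}"

lemma count: "count_list w A = 2" if "A \<in> letters W"
  using nanoword that by (simp add: is_nanoword_def)

lemma finite_letters_W: "finite (letters W)" using nanoword by (rule finite_letters)

lemma finite_B: "finite \<B>" using B_sub finite_letters_W by (rule finite_subset)

lemma finite_Pos: "finite Pos" by (simp add: Pos)

lemma lproj_in: "A \<in> letters W \<Longrightarrow> lproj W A \<in> \<alpha>"
  using nanoword by (auto simp: is_nanoword_def)

lemma first_Pos: "B \<in> \<B> \<Longrightarrow> first_occ w B \<in> Pos"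
  and last_Pos: "B \<in> \<B> \<Longrightarrow> last_occ w B \<in> Pos"
  using occurrence_nth[OF count[of B]] B_sub by (auto simp: Pos)

lemma outside_Pos: "A \<in> L \<Longrightarrow> first_occ w A \<notin> Pos \<and> last_occ w A \<notin> Pos"
  using occurrence_nth[OF count[of A]] by (auto simp: Pos)

lemma Pos_letter: "p \<in> Pos \<Longrightarrow> w ! p \<in> \<B>" by (simp add: Pos)

text \<open>The orientation sign with which an occurrence enters both the loop height of its letter
  and the determinants of \<open>omega\<close>.\<close>

definition osg :: "nat \<Rightarrow> rat" where "osg p = (if p = first_occ w (w ! p) then 1 else - 1)"

definition partner :: "nat \<Rightarrow> nat" where
  "partner p = (if p = first_occ w (w ! p) then last_occ w (w ! p) else first_occ w (w ! p))"

text \<open>The sign (-1) to the power \<epsilon>(B). It is the coefficient for which B + delta(B)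
  \<iota>(B) is short when \<iota>(B) differs from B.\<close>

definition delta :: "'b \<Rightarrow> rat" where
  "delta B = (if R (first_occ w B) = first_occ w (\<iota> B) then - 1 else 1)"

lemma iota_B: "\<iota> B \<in> \<B>" and iota_iota: "\<iota> (\<iota> B) = B" if "B \<in> \<B>"
proof -
  let ?p = "first_occ w B"
  have p: "?p \<in> Pos" "w ! ?p = B" using first_Pos occurrence_nth[OF count[of B]] B_sub that by auto
  show "\<iota> B \<in> \<B>" using letter_R[OF p(1)] Pos_letter[OF R_Pos[OF p(1)]] p by simp
  show "\<iota> (\<iota> B) = B" using letter_R[OF R_Pos[OF p(1)]] letter_R[OF p(1)] R_R[OF p(1)] p by simp
qed

lemma occ_facts:
  assumes "B \<in> \<B>"
  shows "first_occ w B < last_occ w B" "w ! first_occ w B = B" "w ! last_occ w B = B"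
    "osg (first_occ w B) = 1" "osg (last_occ w B) = - 1"
    "partner (first_occ w B) = last_occ w B" "partner (last_occ w B) = first_occ w B"
  using occurrence_nth[OF count[of B]] occurrences(1)[OF count[of B]] B_sub assms
  by (auto simp: osg_def partner_def)

lemma Pos_cases:
  assumes "p \<in> Pos"
  obtains B where "B \<in> \<B>" "p = first_occ w B" | B where "B \<in> \<B>" "p = last_occ w B"
  using occurrence_cases[OF count[of "w ! p"], of p] assms B_sub by (auto simp: Pos)

text \<open>The reflection is injective and maps the two occurrences of B to occurrences of
  \<iota>(B), so the image of the first one determines the image of the last one.\<close>

lemma R_occ:
  assumes "B \<in> \<B>"
  shows "R (first_occ w B) = (if delta B = - 1 then first_occ w (\<iota> B) else last_occ w (\<iota> B))"
    and "R (last_occ w B) = (if delta B = - 1 then last_occ w (\<iota> B) else first_occ w (\<iota> B))"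
proof -
  let ?f = "first_occ w B" and ?l = "last_occ w B"
  have 1: "R ?f \<in> Pos" "R ?l \<in> Pos" using R_Pos first_Pos last_Pos assms by auto
  have 2: "w ! R ?f = \<iota> B" "w ! R ?l = \<iota> B"
    using letter_R first_Pos last_Pos occ_facts(2,3) assms by auto
  have 3: "R ?f \<noteq> R ?l" using R_R first_Pos last_Pos occ_facts(1) assms by (metis less_irrefl)
  have "R ?f = first_occ w (\<iota> B) \<or> R ?f = last_occ w (\<iota> B)"
    "R ?l = first_occ w (\<iota> B) \<or> R ?l = last_occ w (\<iota> B)"
    using occurrence_cases[OF count[of "\<iota> B"]] iota_B[OF assms] B_sub 1 2 by (auto simp: Pos)
  then show "R ?f = (if delta B = - 1 then first_occ w (\<iota> B) else last_occ w (\<iota> B))"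
    "R ?l = (if delta B = - 1 then last_occ w (\<iota> B) else first_occ w (\<iota> B))"
    using 3 occ_facts(1)[OF iota_B[OF assms]] by (auto simp: delta_def)
qed

lemma delta_cases: "delta B = 1 \<or> delta B = - 1" by (simp add: delta_def)

text \<open>R sends first occurrences to first ones exactly when \<open>delta\<close> is -1, and
  only then is the orientation sign kept.\<close>

lemma osg_R: "osg (R p) = - delta (w ! p) * osg p"
  and partner_R: "partner (R p) = R (partner p)" if "p \<in> Pos"
proof -
  show "osg (R p) = - delta (w ! p) * osg p"
    using that
  proof (cases rule: Pos_cases)
    case (1 B)
    then show ?thesis
      using occ_facts[of B] occ_facts[OF iota_B[of B]] R_occ[of B] delta_cases[of B] by auto
  next
    case (2 B)
    then show ?thesis
      using occ_facts[of B] occ_facts[OF iota_B[of B]] R_occ[of B] delta_cases[of B] by auto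
  qed
  show "partner (R p) = R (partner p)"
    using that
  proof (cases rule: Pos_cases)
    case (1 B)
    then show ?thesis
      using occ_facts[of B] occ_facts[OF iota_B[of B]] R_occ[of B] by auto
  next
    case (2 B)
    then show ?thesis
      using occ_facts[of B] occ_facts[OF iota_B[of B]] R_occ[of B] by auto
  qed
qed

lemma partner_Pos: "p \<in> Pos \<Longrightarrow> partner p \<in> Pos"
  by (erule Pos_cases) (auto simp: occ_facts first_Pos last_Pos)

lemma delta_iota: "B \<in> \<B> \<Longrightarrow> delta (\<iota> B) = delta B"
  using R_occ[of B] R_R[OF first_Pos, of B] occ_facts(1)[of B] R_R[OF last_Pos, of B]
  by (auto simp: delta_def iota_iota split: if_splits)

text \<open>The bridge condition applies \<tau> to the projection exactly when \<open>delta\<close>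
  is -1, and \<chi> turns \<tau> into a sign.\<close>

lemma c_iota: "B \<in> \<B> \<Longrightarrow> c (\<iota> B) = delta B * c B"
  using lproj_iota[of B] lproj_in[of B] B_sub
  by (auto simp: weight_def delta_def chi_tau)

text \<open>
  Both \<open>c_hat\<close> and, for \<open>\<beta> \<in> bridge_vecs\<close>, \<open>b_hat \<beta>\<close> change sign under \<open>R\<close>.  Hence \<open>R\<close> negates
  the part of the form carried by \<open>\<B>\<close>, so that this part only sees the jumps \<open>F p - F (R p)\<close> of
  heights, which are constant on blocks and antisymmetric under \<open>\<kappa>\<close>.
\<close>

definition c_hat :: "nat \<Rightarrow> rat" where "c_hat p = osg p * c (w ! p)"

lemma c_hat_R: "p \<in> Pos \<Longrightarrow> c_hat (R p) = - c_hat p"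
  using delta_cases[of "w ! p"] by (auto simp: c_hat_def osg_R letter_R c_iota Pos_letter)

text \<open>The span of the vectors B + delta(B) \<iota>(B), described by the symmetry of the
  coefficients, from which the sign change of \<open>b_hat\<close> can be read off.\<close>

definition bridge_vecs :: "('b \<Rightarrow> rat) set" where
  "bridge_vecs = {\<beta>. (\<forall>A. A \<notin> \<B> \<longrightarrow> \<beta> A = 0) \<and> (\<forall>A \<in> \<B>. \<beta> (\<iota> A) = delta A * \<beta> A)}"

definition b_hat :: "('b \<Rightarrow> rat) \<Rightarrow> nat \<Rightarrow> rat" where "b_hat \<beta> p = osg p * \<beta> (w ! p)"

lemma b_hat_R: "\<beta> \<in> bridge_vecs \<Longrightarrow> p \<in> Pos \<Longrightarrow> b_hat \<beta> (R p) = - b_hat \<beta> p"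
  using delta_cases[of "w ! p"] by (auto simp: b_hat_def osg_R letter_R bridge_vecs_def Pos_letter)

lemma subspace_bridge_vecs: "vec_subspace bridge_vecs"
  by (auto simp: vec_subspace_def bridge_vecs_def algebra_simps)

lemma fillable_bridge_vecs: "fillable \<tau> (lproj W) bridge_vecs \<B>"
proof (rule fillable_of_involution[where \<iota> = \<iota> and s = delta, OF finite_B iota_B iota_iota])
  fix A assume A: "A \<in> \<B>"
  {
    assume fx: "\<iota> A = A"
    \<comment> \<open>A fixed letter with \<open>delta\<close> equal to -1 would have a weight equal
      to its own negative, but \<chi> does not vanish on \<alpha>.\<close>
    have "delta A \<noteq> - 1"
      using c_iota[OF A] fx lproj_in[of A] A B_sub chi_nonzero by (auto simp: weight_def)
    then have "delta A = 1" using delta_cases[of A] by simp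
    then show "basis_vec A \<in> bridge_vecs"
      using A fx iota_iota by (auto simp: bridge_vecs_def basis_vec_def)
  }
  {
    assume ne: "\<iota> A \<noteq> A"
    have d: "lproj W (\<iota> A) = (if delta A = - 1 then \<tau> (lproj W A) else lproj W A)"
      using lproj_iota[OF A] by (auto simp: delta_def)
    have "short_pair \<tau> (lproj W) A (\<iota> A) (delta A)"
      using d ne delta_cases[of A] tau_tau[OF lproj_in, of A] A B_sub by (auto simp: short_pair_def)
    moreover have "\<iota> C = \<iota> A \<longleftrightarrow> C = A" if "C \<in> \<B>" for C
      using iota_iota[OF that] iota_iota[OF A] by metis
    then have "pair_vec A (\<iota> A) (delta A) \<in> bridge_vecs"
      using A ne iota_iota iota_B delta_iota delta_cases[of A]
      by (auto simp: bridge_vecs_def pair_vec_def basis_vec_def)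
    ultimately show "short_pair \<tau> (lproj W) A (\<iota> A) (delta A) \<and> pair_vec A (\<iota> A) (delta A) \<in> bridge_vecs"
      by simp
  }
qed

section \<open>Heights of bridge vectors and their fluxes through blocks\<close>

lemma sum_over_Pos:
  fixes h :: "nat \<Rightarrow> rat"
  shows "(\<Sum>D\<in>\<B>. h (first_occ w D) + h (last_occ w D)) = (\<Sum>p\<in>Pos. h p)"
proof -
  have "Pos = (\<Union>D\<in>\<B>. {first_occ w D, last_occ w D})"
    using first_Pos last_Pos by (auto elim: Pos_cases)
  moreover have "(\<Sum>p\<in>(\<Union>D\<in>\<B>. {first_occ w D, last_occ w D}). h p) =
    (\<Sum>D\<in>\<B>. \<Sum>p\<in>{first_occ w D, last_occ w D}. h p)"
  proof (rule sum.UNION_disjoint)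
    show "\<forall>D\<in>\<B>. \<forall>E\<in>\<B>. D \<noteq> E \<longrightarrow>
      {first_occ w D, last_occ w D} \<inter> {first_occ w E, last_occ w E} = {}"
    proof (intro ballI impI)
      fix D E assume DE: "D \<in> \<B>" "E \<in> \<B>" "D \<noteq> E"
      have "w ! p = D" if "p \<in> {first_occ w D, last_occ w D}" for p
        using that occ_facts[OF DE(1)] by auto
      moreover have "w ! p = E" if "p \<in> {first_occ w E, last_occ w E}" for p
        using that occ_facts[OF DE(2)] by auto
      ultimately show "{first_occ w D, last_occ w D} \<inter> {first_occ w E, last_occ w E} = {}"
        using DE(3) unfolding disjoint_iff by metis
    qed
  qed (use finite_B in auto)
  moreover have "(\<Sum>p\<in>{first_occ w D, last_occ w D}. h p) = h (first_occ w D) + h (last_occ w D)"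
    if "D \<in> \<B>" for D using occ_facts(1)[OF that] by simp
  ultimately show ?thesis by (simp cong: sum.cong)
qed

lemma sum_Pos_R: "(\<Sum>p\<in>Pos. h (R p)) = (\<Sum>p\<in>Pos. h p :: rat)"
  by (rule sum.reindex_bij_witness[where i = R and j = R]) (auto simp: R_Pos R_R)

lemma sum_Pos_blk:
  assumes "\<And>p. p \<in> Pos \<Longrightarrow> b p < k"
  shows "(\<Sum>p\<in>Pos. g (b p) * h p) = (\<Sum>r<k. g r * (\<Sum>p | p \<in> Pos \<and> b p = r. h p) :: rat)"
proof -
  have "(\<Sum>p\<in>Pos. g (b p) * h p) = (\<Sum>r<k. \<Sum>p | p \<in> Pos \<and> b p = r. g (b p) * h p)"
    by (rule sum.group[symmetric]) (use assms finite_Pos in auto)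
  also have "\<dots> = (\<Sum>r<k. g r * (\<Sum>p | p \<in> Pos \<and> b p = r. h p))"
    by (simp add: sum_distrib_left)
  finally show ?thesis .
qed

text \<open>Each occurrence p contributes a step at p with coefficient \<open>b_hat\<close>. As a
  sum over positions the height can be reindexed by R.\<close>

lemma height_B: "height w \<B> 0 \<beta> i = (\<Sum>p\<in>Pos. b_hat \<beta> p * sg i p)"
  unfolding sum_over_Pos[symmetric] height_def
  by (simp add: b_hat_def occ_facts loop_height_def algebra_simps cong: sum.cong)

definition blk_rep :: "nat \<Rightarrow> nat" where "blk_rep r = (SOME p. p \<in> Pos \<and> blk p = r)"

lemma blk_rep: "p \<in> Pos \<Longrightarrow> blk_rep (blk p) \<in> Pos \<and> blk (blk_rep (blk p)) = blk p"
  unfolding blk_rep_def by (rule someI[of _ p]) simp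

text \<open>Half of the change of the height of \<beta> between the two sides of block r, since each
  sign jumps by 2.\<close>

definition flux :: "('b \<Rightarrow> rat) \<Rightarrow> nat \<Rightarrow> rat" where
  "flux \<beta> r = (\<Sum>p | p \<in> Pos \<and> blk p = r. b_hat \<beta> p)"

lemma flux_kappa:
  assumes "\<beta> \<in> bridge_vecs" "r < k"
  shows "flux \<beta> (\<kappa> r) = - flux \<beta> r"
  unfolding flux_def sum_negf[symmetric]
  by (rule sum.reindex_bij_witness[where i = R and j = R])
    (use assms in \<open>auto simp: R_Pos R_R blk_R kappa_kappa b_hat_R blk_lt\<close>)

text \<open>Seen from a position outside the blocks, each block lies entirely on one side, so its
  steps act as one step weighted by \<open>flux\<close>. For an empty block \<open>blk_rep\<close>
  is meaningless, but the flux is 0. Antisymmetry under \<kappa> then leaves one function per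
  arch.\<close>

lemma height_outside:
  assumes "\<beta> \<in> bridge_vecs" "i < length w" "i \<notin> Pos"
  shows "height w \<B> 0 \<beta> i =
    (\<Sum>r\<in>orbs. flux \<beta> r * (sg i (blk_rep r) - sg i (blk_rep (\<kappa> r))))"
proof -
  have "height w \<B> 0 \<beta> i = (\<Sum>p\<in>Pos. sg i (blk_rep (blk p)) * b_hat \<beta> p)"
    unfolding height_B
  proof (rule sum.cong)
    fix p assume p: "p \<in> Pos"
    then show "b_hat \<beta> p * sg i p = sg i (blk_rep (blk p)) * b_hat \<beta> p"
      using sg_out[OF assms(2,3) p, of "blk_rep (blk p)"] blk_rep[OF p] by simp
  qed simp
  also have "\<dots> = (\<Sum>r<k. sg i (blk_rep r) * flux \<beta> r)"
    unfolding flux_def by (rule sum_Pos_blk) (rule blk_lt)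
  also have "\<dots> = (\<Sum>r<k. flux \<beta> r * sg i (blk_rep r))" by (simp add: mult.commute)
  also have "\<dots> = (\<Sum>r\<in>orbs. flux \<beta> r * (sg i (blk_rep r) - sg i (blk_rep (\<kappa> r))))"
    by (rule sum_antisymmetric_orbits) (auto simp: kappa_lt kappa_kappa flux_kappa assms)
  finally show ?thesis .
qed

text \<open>Inside a block R reverses the order and the two signs cancel; between different blocks
  only the order of the blocks matters. Either way the sum is a function of the blocks
  alone.\<close>

lemma sg_add_R:
  assumes "p \<in> Pos" "q \<in> Pos"
  shows "sg p q + sg (R p) (R q) = sg (blk p) (blk q) + sg (\<kappa> (blk p)) (\<kappa> (blk q))"
proof (cases "blk p = blk q")
  case True
  then show ?thesis using sg_same[OF assms] by (simp add: sg_simps)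
next
  case False
  then have "\<kappa> (blk p) \<noteq> \<kappa> (blk q)" using kappa_kappa blk_lt assms by metis
  then show ?thesis using sg_diff False assms R_Pos blk_R by metis
qed

definition admissible :: "('b \<Rightarrow> rat) \<Rightarrow> ('b \<Rightarrow> rat) \<Rightarrow> bool" where
  "admissible a \<beta> \<longleftrightarrow> (\<forall>A. A \<notin> L \<longrightarrow> a A = 0) \<and> \<beta> \<in> bridge_vecs"

definition total_height :: "rat \<Rightarrow> ('b \<Rightarrow> rat) \<Rightarrow> ('b \<Rightarrow> rat) \<Rightarrow> nat \<Rightarrow> rat" where
  "total_height t a \<beta> i = height w L t a i + height w \<B> 0 \<beta> i"

lemma height_total:
  assumes "admissible a \<beta>"
  shows "height w (letters W) t (\<lambda>A. a A + \<beta> A) = total_height t a \<beta>"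
proof
  fix i
  have "height w (letters W) t (\<lambda>A. a A + \<beta> A) i =
    height w (letters W) t a i + height w (letters W) 0 \<beta> i"
    using height_add[of w "letters W" t 0] by simp
  also have "height w (letters W) t a i = height w L t a i"
    by (rule height_supp) (use assms finite_letters_W in \<open>auto simp: admissible_def\<close>)
  also have "height w (letters W) 0 \<beta> i = height w \<B> 0 \<beta> i"
    by (rule height_supp) (use assms finite_letters_W B_sub in \<open>auto simp: admissible_def bridge_vecs_def\<close>)
  finally show "height w (letters W) t (\<lambda>A. a A + \<beta> A) i = total_height t a \<beta> i"
    by (simp add: total_height_def)
qed

text \<open>No loop of a surviving letter begins or ends inside a block.\<close>

lemma height_L_blk:
  assumes "p \<in> Pos" "q \<in> Pos" "blk p = blk q"
  shows "height w L t a p = height w L t a q"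
proof -
  have "loop_height w A p = loop_height w A q" if A: "A \<in> L" for A
    using sg_out[OF _ _ assms] occurrence_nth[OF count] outside_Pos[OF A] A
      sg_swap[of p] sg_swap[of q] by (simp add: loop_height_def)
  then show ?thesis unfolding height_def by (intro arg_cong2[where f = "(+)"] sum.cong) simp_all
qed

text \<open>Reindexing the height at R p by R, with the sign change of \<open>b_hat\<close>, turns
  the difference into a sum over s of multiples of \<open>sg p s + sg (R p) (R s)\<close>, which by
  \<open>sg_add_R\<close> sees p only through its block.\<close>

lemma jump_blk:
  assumes adm: "admissible a \<beta>" and pq: "p \<in> Pos" "q \<in> Pos" "blk p = blk q"
  shows "total_height t a \<beta> p - total_height t a \<beta> (R p) =
    total_height t a \<beta> q - total_height t a \<beta> (R q)"
proof -
  have bv: "\<beta> \<in> bridge_vecs" using adm by (simp add: admissible_def)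
  have "height w \<B> 0 \<beta> p - height w \<B> 0 \<beta> (R p) =
    (\<Sum>s\<in>Pos. b_hat \<beta> s * (sg (blk p) (blk s) + sg (\<kappa> (blk p)) (\<kappa> (blk s))))"
    if p: "p \<in> Pos" for p
  proof -
    have "height w \<B> 0 \<beta> (R p) = (\<Sum>s\<in>Pos. b_hat \<beta> (R s) * sg (R p) (R s))"
      unfolding height_B by (rule sum_Pos_R[symmetric])
    also have "\<dots> = (\<Sum>s\<in>Pos. - (b_hat \<beta> s * sg (R p) (R s)))"
      by (rule sum.cong) (simp_all add: b_hat_R[OF bv])
    finally have "height w \<B> 0 \<beta> p - height w \<B> 0 \<beta> (R p) =
      (\<Sum>s\<in>Pos. b_hat \<beta> s * (sg p s + sg (R p) (R s)))"
      unfolding height_B by (simp add: sum_negf sum.distrib algebra_simps)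
    then show ?thesis using p by (simp add: sg_add_R cong: sum.cong)
  qed
  then have "height w \<B> 0 \<beta> p - height w \<B> 0 \<beta> (R p) = height w \<B> 0 \<beta> q - height w \<B> 0 \<beta> (R q)"
    using pq by simp
  moreover have "height w L t a p = height w L t a q" using pq by (rule height_L_blk)
  moreover have "height w L t a (R p) = height w L t a (R q)"
    using pq by (intro height_L_blk) (simp_all add: R_Pos blk_R)
  ultimately show ?thesis by (simp add: total_height_def)
qed

text \<open>The failure of a height to be invariant under R, read off at any position of block r.
  The default 0 at empty blocks is compatible with antisymmetry, as \<kappa> maps empty blocks to
  empty blocks.\<close>

definition jump :: "(nat \<Rightarrow> rat) \<Rightarrow> nat \<Rightarrow> rat" where
  "jump F r = (if \<exists>p. p \<in> Pos \<and> blk p = r then F (blk_rep r) - F (R (blk_rep r)) else 0)"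

lemma jump:
  assumes "admissible a \<beta>" "p \<in> Pos"
  shows "total_height t a \<beta> p - total_height t a \<beta> (R p) = jump (total_height t a \<beta>) (blk p)"
  using jump_blk[OF assms(1), of p "blk_rep (blk p)" t] blk_rep[OF assms(2)] assms(2)
  by (auto simp: jump_def)

lemma jump_kappa:
  assumes "admissible a \<beta>" "r < k"
  shows "jump (total_height t a \<beta>) (\<kappa> r) = - jump (total_height t a \<beta>) r"
proof (cases "\<exists>p. p \<in> Pos \<and> blk p = r")
  case True
  then obtain p where p: "p \<in> Pos" "blk p = r" by auto
  then show ?thesis
    using jump[OF assms(1) p(1), of t] jump[OF assms(1) R_Pos[OF p(1)], of t] by (simp add: blk_R R_R)
next
  case False
  then have *: "\<not> (\<exists>p. p \<in> Pos \<and> blk p = \<kappa> r)"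
    using R_Pos blk_R kappa_kappa[OF assms(2)] by metis
  show ?thesis unfolding jump_def if_not_P[OF False] if_not_P[OF *] by simp
qed

text \<open>\<open>coflux1\<close> and \<open>coflux2\<close> are the coefficients of the jumps of F
  and of G in \<open>omega_B\<close>. The second is indexed by the block of the partner, where the
  jump of G is taken. The halving comes from averaging with the reflected sum.\<close>

definition coflux1 :: "(nat \<Rightarrow> rat) \<Rightarrow> nat \<Rightarrow> rat" where
  "coflux1 G r = (\<Sum>p | p \<in> Pos \<and> blk p = r. c_hat p * G (partner p)) / 2"

definition coflux2 :: "(nat \<Rightarrow> rat) \<Rightarrow> nat \<Rightarrow> rat" where
  "coflux2 F r = (\<Sum>p | p \<in> Pos \<and> blk (partner p) = r. c_hat p * F (R p)) / 2"

text \<open>Write p' for the partner of p. Averaging with the reflected sum produces F(p) G(p') -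
  F(R p) G(R p'), which is (F(p) - F(R p)) G(p') + F(R p) (G(p') - G(R p')). Each summand contains a
  jump, so grouping by blocks and then by arches gives two products per arch.\<close>

lemma omega_B:
  assumes F: "F = total_height t a \<beta>" and G: "G = total_height u a' \<beta>'"
    and adm: "admissible a \<beta>" "admissible a' \<beta>'"
  shows "omega c w \<B> F G = (\<Sum>r\<in>orbs. jump F r * (coflux1 G r - coflux1 G (\<kappa> r))) +
    (\<Sum>r\<in>orbs. jump G r * (coflux2 F r - coflux2 F (\<kappa> r)))"
proof -
  have om: "omega c w \<B> F G = (\<Sum>p\<in>Pos. c_hat p * F p * G (partner p))"
    unfolding sum_over_Pos[symmetric] omega_def
    by (rule sum.cong) (simp_all add: c_hat_def occ_facts algebra_simps)
  \<comment> \<open>Under reindexing by R, \<open>c_hat\<close> changes sign and R commutes with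
    \<open>partner\<close>.\<close>
  have om': "omega c w \<B> F G = (\<Sum>p\<in>Pos. - (c_hat p * F (R p) * G (R (partner p))))"
    unfolding om sum_Pos_R[symmetric, of "\<lambda>p. c_hat p * F p * G (partner p)"]
    by (rule sum.cong) (simp_all add: c_hat_R partner_R)
  have "2 * omega c w \<B> F G =
    (\<Sum>p\<in>Pos. c_hat p * F p * G (partner p) - c_hat p * F (R p) * G (R (partner p)))"
    using om om' by (simp add: sum_subtractf sum_negf)
  also have "\<dots> = (\<Sum>p\<in>Pos. jump F (blk p) * (c_hat p * G (partner p)) +
      jump G (blk (partner p)) * (c_hat p * F (R p)))"
    by (rule sum.cong)
      (simp_all add: F G jump[OF adm(1), symmetric] jump[OF adm(2), symmetric] partner_Pos algebra_simps)
  also have "\<dots> = (\<Sum>r<k. jump F r * (2 * coflux1 G r)) + (\<Sum>r<k. jump G r * (2 * coflux2 F r))"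
    unfolding sum.distrib
    by (subst (1 2) sum_Pos_blk) (simp_all add: blk_lt partner_Pos coflux1_def coflux2_def)
  also have "\<dots> = 2 * ((\<Sum>r<k. jump F r * coflux1 G r) + (\<Sum>r<k. jump G r * coflux2 F r))"
    by (simp add: sum_distrib_left algebra_simps)
  finally have "omega c w \<B> F G = (\<Sum>r<k. jump F r * coflux1 G r) + (\<Sum>r<k. jump G r * coflux2 F r)"
    by simp
  also have "(\<Sum>r<k. jump F r * coflux1 G r) = (\<Sum>r\<in>orbs. jump F r * (coflux1 G r - coflux1 G (\<kappa> r)))"
    by (rule sum_antisymmetric_orbits) (auto simp: kappa_lt kappa_kappa F jump_kappa adm)
  also have "(\<Sum>r<k. jump G r * coflux2 F r) = (\<Sum>r\<in>orbs. jump G r * (coflux2 F r - coflux2 F (\<kappa> r)))"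
    by (rule sum_antisymmetric_orbits) (auto simp: kappa_lt kappa_kappa G jump_kappa adm)
  finally show ?thesis .
qed

definition step_fun :: "nat \<Rightarrow> nat \<Rightarrow> rat" where
  "step_fun r i = sg i (blk_rep r) - sg i (blk_rep (\<kappa> r))"

lemma omega_L_left:
  assumes "\<beta> \<in> bridge_vecs"
  shows "omega c w L (height w \<B> 0 \<beta>) G = (\<Sum>r\<in>orbs. flux \<beta> r * omega c w L (step_fun r) G)"
  unfolding omega_sum_left[symmetric]
  by (rule omega_cong)
    (auto simp: step_fun_def height_outside[OF assms] occurrence_nth[OF count] outside_Pos)

text \<open>On the surviving letters G is kept whole against the bridge part of F and is split only
  against the surviving part of F. The mixed terms then cost two products per arch, where a full
  expansion would have three; \<open>omega_B\<close> supplies the other two.\<close>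

lemma word_form_difference:
  fixes t u :: rat
  assumes adm: "admissible a \<beta>" "admissible a' \<beta>'"
  defines "F \<equiv> total_height t a \<beta>" and "G \<equiv> total_height u a' \<beta>'"
  shows "word_form c w (letters W) t (\<lambda>A. a A + \<beta> A) u (\<lambda>A. a' A + \<beta>' A) = word_form c w L t a u a' +
    (\<Sum>r\<in>orbs. jump F r * (coflux1 G r - coflux1 G (\<kappa> r)) / 2 +
      (coflux2 F r - coflux2 F (\<kappa> r)) * jump G r / 2 +
      flux \<beta> r * omega c w L (step_fun r) G / 2 +
      - omega c w L (step_fun r) (height w L t a) * flux \<beta>' r / 2)"
proof -
  have bv: "\<beta> \<in> bridge_vecs" "\<beta>' \<in> bridge_vecs" using adm by (auto simp: admissible_def)
  have "letters W = L \<union> \<B>" using B_sub by auto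
  then have "omega c w (letters W) F G = omega c w L F G + omega c w \<B> F G"
    using omega_Un[of L \<B> c w F G] finite_letters_W finite_B by auto
  also have "omega c w L F G = omega c w L (height w L t a) G + omega c w L (height w \<B> 0 \<beta>) G"
    unfolding F_def total_height_def[abs_def] by (rule omega_add_left)
  also have "omega c w L (height w L t a) G =
    omega c w L (height w L t a) (height w L u a') + omega c w L (height w L t a) (height w \<B> 0 \<beta>')"
    unfolding G_def total_height_def[abs_def] by (rule omega_add_right)
  also have "omega c w L (height w L t a) (height w \<B> 0 \<beta>') =
    (\<Sum>r\<in>orbs. - omega c w L (step_fun r) (height w L t a) * flux \<beta>' r)"
    by (subst omega_swap) (simp add: omega_L_left[OF bv(2)] sum_negf algebra_simps)
  finally show ?thesis
    unfolding word_form_def height_total[OF adm(1)] height_total[OF adm(2)] F_def[symmetric] G_def[symmetric]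
      omega_B[OF F_def[THEN meta_eq_to_obj_eq] G_def[THEN meta_eq_to_obj_eq] adm] omega_L_left[OF bv(1)]
    by (simp add: sum.distrib sum_subtractf sum_negf add_divide_distrib diff_divide_distrib mult.commute flip: sum_divide_distrib)
qed

end

section \<open>Transport of low-rank fillings through a bridge\<close>

lemma count_list_filter: "P A \<Longrightarrow> count_list (filter P w) A = count_list w A"
  by (induction w) auto

lemma word_form_cong:
  assumes "\<And>A. A \<in> L \<Longrightarrow> x A = x' A" "\<And>A. A \<in> L \<Longrightarrow> y A = y' A"
  shows "word_form c w L t x u y = word_form c w L t x' u y'"
proof -
  have "height w L t x = height w L t x'" "height w L u y = height w L u y'"
    unfolding height_def by (rule ext, simp add: assms)+
  then show ?thesis by (simp add: word_form_def)
qed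

context reflection
begin

definition reduced :: "('a, 'b) nanoword" where
  "reduced = W\<lparr>letters := L, word := filter (\<lambda>A. A \<notin> \<B>) w\<rparr>"

lemma word_form_reduced:
  "nw_form reduced (t, a) (u, a') = word_form c w L t a u a'"
proof -
  let ?w = "filter (\<lambda>A. A \<notin> \<B>) w"
  obtain h where h: "strict_mono_on {..<length ?w} h"
    "h ` {..<length ?w} = {i. i < length w \<and> w ! i \<notin> \<B>}"
    "\<And>i. i < length ?w \<Longrightarrow> ?w ! i = w ! h i"
    using filter_positions[of "\<lambda>A. A \<notin> \<B>" w] by auto
  have cnt: "count_list ?w A = 2" if "A \<in> L" for A
    using that count by (simp add: count_list_filter)
  have occ: "first_occ w A = h (first_occ ?w A)" "last_occ w A = h (last_occ ?w A)" if A: "A \<in> L" for A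
  proof -
    have "{i. i < length w \<and> w ! i = A} = h ` {i. i < length ?w \<and> ?w ! i = A}"
    proof (intro equalityI subsetI)
      fix i assume i: "i \<in> {i. i < length w \<and> w ! i = A}"
      then have "i \<in> h ` {..<length ?w}" using A by (auto simp: h(2))
      then show "i \<in> h ` {i. i < length ?w \<and> ?w ! i = A}" using i h(3) by auto
    next
      fix i assume "i \<in> h ` {i. i < length ?w \<and> ?w ! i = A}"
      then obtain j where j: "i = h j" "j < length ?w" "?w ! j = A" by auto
      then have "h j \<in> h ` {..<length ?w}" by blast
      then show "i \<in> {i. i < length w \<and> w ! i = A}" using j h(3)[OF j(2)] by (auto simp: h(2))
    qed
    also have "\<dots> = {h (first_occ ?w A), h (last_occ ?w A)}"
      unfolding occurrences(2)[OF cnt[OF A]] by simp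
    finally have "{i. i < length w \<and> w ! i = A} = {h (first_occ ?w A), h (last_occ ?w A)}" .
    moreover have "h (first_occ ?w A) < h (last_occ ?w A)"
      using strict_mono_onD[OF h(1)] occurrences(1)[OF cnt[OF A]] occurrence_nth[OF cnt[OF A]] by simp
    ultimately show "first_occ w A = h (first_occ ?w A)" "last_occ w A = h (last_occ ?w A)"
      by (rule occurrencesI)+
  qed
  have "word_form c w L t a u a' = word_form (weight reduced) ?w L t (a \<circ> id) u (a' \<circ> id)"
    by (rule word_form_transfer[where h = h and X = "{..<length ?w}"])
      (use h(1) occ occurrence_nth[OF cnt] in \<open>auto simp: weight_def reduced_def\<close>)
  then show ?thesis by (simp add: nw_form_def reduced_def)
qed

text \<open>Here the two arguments are separated: p depends on the first vector alone and q on the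
  second. The index j < 4 runs over the products of an arch, and the factors 1/2 are absorbed into
  q.\<close>

lemma word_form_products:
  obtains p q :: "nat \<times> nat \<Rightarrow> rat \<times> ('b \<Rightarrow> rat) \<times> ('b \<Rightarrow> rat) \<Rightarrow> rat" where
    "\<And>t a \<beta> u a' \<beta>'. admissible a \<beta> \<Longrightarrow> admissible a' \<beta>' \<Longrightarrow>
      word_form c w (letters W) t (\<lambda>A. a A + \<beta> A) u (\<lambda>A. a' A + \<beta>' A) =
      nw_form reduced (t, a) (u, a') + (\<Sum>i\<in>orbs \<times> {..<4}. p i (t, a, \<beta>) * q i (u, a', \<beta>'))"
proof -
  define p where "p i X = (case i of (r, j) \<Rightarrow> case X of (t, a, \<beta>) \<Rightarrow>
    if j = 0 then jump (total_height t a \<beta>) r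
    else if j = 1 then coflux2 (total_height t a \<beta>) r - coflux2 (total_height t a \<beta>) (\<kappa> r)
    else if j = 2 then flux \<beta> r
    else - omega c w L (step_fun r) (height w L t a))"
    for i :: "nat \<times> nat" and X :: "rat \<times> ('b \<Rightarrow> rat) \<times> ('b \<Rightarrow> rat)"
  define q where "q i X = (case i of (r, j) \<Rightarrow> case X of (u, a, \<beta>) \<Rightarrow>
    if j = 0 then (coflux1 (total_height u a \<beta>) r - coflux1 (total_height u a \<beta>) (\<kappa> r)) / 2
    else if j = 1 then jump (total_height u a \<beta>) r / 2
    else if j = 2 then omega c w L (step_fun r) (total_height u a \<beta>) / 2
    else flux \<beta> r / 2)"
    for i :: "nat \<times> nat" and X :: "rat \<times> ('b \<Rightarrow> rat) \<times> ('b \<Rightarrow> rat)"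
  show ?thesis
  proof (rule that[of p q])
    fix t a \<beta> u a' \<beta>' assume "admissible a \<beta>" "admissible a' \<beta>'"
    note diff = word_form_difference[OF this, of t u]
    have four: "{..<4 :: nat} = {0, 1, 2, 3}" by auto
    have "(\<Sum>i\<in>orbs \<times> {..<4}. p i (t, a, \<beta>) * q i (u, a', \<beta>')) =
      (\<Sum>r\<in>orbs. \<Sum>j<4. p (r, j) (t, a, \<beta>) * q (r, j) (u, a', \<beta>'))"
      by (simp add: sum.cartesian_product)
    also have "\<dots> = (\<Sum>r\<in>orbs.
      jump (total_height t a \<beta>) r *
        (coflux1 (total_height u a' \<beta>') r - coflux1 (total_height u a' \<beta>') (\<kappa> r)) / 2 +
      (coflux2 (total_height t a \<beta>) r - coflux2 (total_height t a \<beta>) (\<kappa> r)) *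
        jump (total_height u a' \<beta>') r / 2 +
      flux \<beta> r * omega c w L (step_fun r) (total_height u a' \<beta>') / 2 +
      - omega c w L (step_fun r) (height w L t a) * flux \<beta>' r / 2)"
      by (rule sum.cong) (simp_all add: four p_def q_def)
    finally show "word_form c w (letters W) t (\<lambda>A. a A + \<beta> A) u (\<lambda>A. a' A + \<beta>' A) =
      nw_form reduced (t, a) (u, a') + (\<Sum>i\<in>orbs \<times> {..<4}. p i (t, a, \<beta>) * q i (u, a', \<beta>'))"
      using diff by (simp only: word_form_reduced)
  qed
qed

text \<open>Up to coordinates off the alphabet, the new subspace is the direct sum of the part of M
  living on L and \<open>bridge_vecs\<close>, with projections \<open>rL\<close> and
  \<open>rB\<close>. The filling of L is completed by the bridge vectors on \<B>.\<close>

lemma low_rank_filling_expand: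
  assumes "low_rank_filling m reduced"
  shows "low_rank_filling (m + 4 * card orbs) W"
proof -
  obtain M where M: "vec_subspace M" "fillable \<tau> (lproj reduced) M (letters reduced)"
    "product_rank_le m (nw_form reduced) (UNIV \<times> M)" using assms unfolding low_rank_filling_def by auto
  obtain p q :: "nat \<times> nat \<Rightarrow> rat \<times> ('b \<Rightarrow> rat) \<times> ('b \<Rightarrow> rat) \<Rightarrow> rat" where pq:
    "\<And>t a \<beta> u a' \<beta>'. admissible a \<beta> \<Longrightarrow> admissible a' \<beta>' \<Longrightarrow>
      word_form c w (letters W) t (\<lambda>A. a A + \<beta> A) u (\<lambda>A. a' A + \<beta>' A) =
      nw_form reduced (t, a) (u, a') + (\<Sum>i\<in>orbs \<times> {..<4}. p i (t, a, \<beta>) * q i (u, a', \<beta>'))"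
    using word_form_products by blast
  define rL where "rL x = (\<lambda>A. if A \<in> L then x A else 0)" for x :: "'b \<Rightarrow> rat"
  define rB where "rB x = (\<lambda>A. if A \<in> \<B> then x A else 0)" for x :: "'b \<Rightarrow> rat"
  define M' where "M' = {x. rL x \<in> M \<and> rB x \<in> bridge_vecs}"
  have "vec_subspace M'"
  proof -
    have "rL (\<lambda>A. x A + y A) = (\<lambda>A. rL x A + rL y A)" "rL (\<lambda>A. q * x A) = (\<lambda>A. q * rL x A)"
      "rL (\<lambda>_. 0) = (\<lambda>_. 0)" "rB (\<lambda>A. x A + y A) = (\<lambda>A. rB x A + rB y A)"
      "rB (\<lambda>A. q * x A) = (\<lambda>A. q * rB x A)" "rB (\<lambda>_. 0) = (\<lambda>_. 0)" for x y q
      by (auto simp: rL_def rB_def)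
    then show ?thesis using M(1) subspace_bridge_vecs unfolding vec_subspace_def M'_def by simp
  qed
  moreover have "fillable \<tau> (lproj W) M' (letters W)"
  proof -
    have zero: "(\<lambda>_. 0) \<in> M" "(\<lambda>_. 0) \<in> bridge_vecs" using M(1) subspace_bridge_vecs by (auto simp: vec_subspace_def)
    have "fillable \<tau> (lproj W) M L" using M(2) by (simp add: reduced_def)
    then have "fillable \<tau> (lproj W) M' L"
    proof (rule fillable_mono)
      fix A assume "A \<in> L" "basis_vec A \<in> M"
      moreover from this have "rL (basis_vec A) = basis_vec A" "rB (basis_vec A) = (\<lambda>_. 0)"
        by (auto simp: rL_def rB_def basis_vec_def)
      ultimately show "basis_vec A \<in> M'" using zero by (simp add: M'_def)
    next
      fix A B s assume "A \<in> L" "B \<in> L" "pair_vec A B s \<in> M"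
      moreover from this have "rL (pair_vec A B s) = pair_vec A B s" "rB (pair_vec A B s) = (\<lambda>_. 0)"
        by (auto simp: rL_def rB_def pair_vec_def basis_vec_def)
      ultimately show "pair_vec A B s \<in> M'" using zero by (simp add: M'_def)
    qed
    moreover have "fillable \<tau> (lproj W) M' \<B>"
    proof (rule fillable_mono[OF fillable_bridge_vecs])
      fix A assume "A \<in> \<B>" "basis_vec A \<in> bridge_vecs"
      moreover from this have "rB (basis_vec A) = basis_vec A" "rL (basis_vec A) = (\<lambda>_. 0)"
        by (auto simp: rL_def rB_def basis_vec_def)
      ultimately show "basis_vec A \<in> M'" using zero by (simp add: M'_def)
    next
      fix A B s assume "A \<in> \<B>" "B \<in> \<B>" "pair_vec A B s \<in> bridge_vecs"
      moreover from this have "rB (pair_vec A B s) = pair_vec A B s" "rL (pair_vec A B s) = (\<lambda>_. 0)"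
        by (auto simp: rL_def rB_def pair_vec_def basis_vec_def)
      ultimately show "pair_vec A B s \<in> M'" using zero by (simp add: M'_def)
    qed
    ultimately have "fillable \<tau> (lproj W) M' (L \<union> \<B>)" by (rule fillable_Un) auto
    moreover have "L \<union> \<B> = letters W" using B_sub by auto
    ultimately show ?thesis by simp
  qed
  moreover have "product_rank_le (m + 4 * card orbs) (nw_form W) (UNIV \<times> M')"
  proof (rule product_rank_le_transfer[OF M(3), where I = "orbs \<times> {..<4}"
        and h = "\<lambda>(t, x). (t, rL x)" and p = "\<lambda>i (t, x). p i (t, rL x, rB x)"
        and q = "\<lambda>i (t, x). q i (t, rL x, rB x)"])
    fix X Y :: "rat \<times> ('b \<Rightarrow> rat)" assume XY: "X \<in> UNIV \<times> M'" "Y \<in> UNIV \<times> M'"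
    obtain t x u y where [simp]: "X = (t, x)" "Y = (u, y)" by fastforce
    have adm: "admissible (rL x) (rB x)" "admissible (rL y) (rB y)"
      using XY by (auto simp: admissible_def M'_def rL_def)
    have "nw_form W X Y =
      word_form c w (letters W) t (\<lambda>A. rL x A + rB x A) u (\<lambda>A. rL y A + rB y A)"
      unfolding nw_form_def by (simp, rule word_form_cong) (auto simp: rL_def rB_def)
    then show "nw_form W X Y =
      nw_form reduced (case X of (t, x) \<Rightarrow> (t, rL x)) (case Y of (t, x) \<Rightarrow> (t, rL x)) +
      (\<Sum>i\<in>orbs \<times> {..<4}. (case X of (t, x) \<Rightarrow> p i (t, rL x, rB x)) *
        (case Y of (t, x) \<Rightarrow> q i (t, rL x, rB x)))"
      by (simp add: pq[OF adm])
  qed (auto simp: M'_def)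
  ultimately show ?thesis unfolding low_rank_filling_def by blast
qed

lemma low_rank_filling_reduce:
  assumes "low_rank_filling m W"
  shows "low_rank_filling (m + 4 * card orbs) reduced"
proof -
  obtain M where M: "vec_subspace M" "fillable \<tau> (lproj W) M (letters W)"
    "product_rank_le m (nw_form W) (UNIV \<times> M)" using assms unfolding low_rank_filling_def by auto
  obtain p q :: "nat \<times> nat \<Rightarrow> rat \<times> ('b \<Rightarrow> rat) \<times> ('b \<Rightarrow> rat) \<Rightarrow> rat" where pq:
    "\<And>t a \<beta> u a' \<beta>'. admissible a \<beta> \<Longrightarrow> admissible a' \<beta>' \<Longrightarrow>
      word_form c w (letters W) t (\<lambda>A. a A + \<beta> A) u (\<lambda>A. a' A + \<beta>' A) =
      nw_form reduced (t, a) (u, a') + (\<Sum>i\<in>orbs \<times> {..<4}. p i (t, a, \<beta>) * q i (u, a', \<beta>'))"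
    using word_form_products by blast
  \<comment> \<open>The sum of M and \<open>bridge_vecs\<close>, as the latter is closed under
    negation. It contains the filling of all letters and that of \<B>, so
    \<open>fillable_Diff\<close> can eliminate \<B> inside it.\<close>
  define K where "K = {x. \<exists>\<beta>\<in>bridge_vecs. (\<lambda>A. x A + \<beta> A) \<in> M}"
  define M' where "M' = {x \<in> K. \<forall>A. A \<notin> L \<longrightarrow> x A = 0}"
  have N0: "(\<lambda>_. 0) \<in> bridge_vecs" and M0: "(\<lambda>_. 0) \<in> M"
    using subspace_bridge_vecs M(1) by (auto simp: vec_subspace_def)
  have K: "vec_subspace K"
    unfolding vec_subspace_def
  proof (intro conjI ballI allI)
    show "(\<lambda>_. 0) \<in> K" unfolding K_def using N0 M0 by (auto intro!: bexI[of _ "\<lambda>_. 0"])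
  next
    fix x y assume "x \<in> K" "y \<in> K"
    then obtain \<beta> \<gamma> where *: "\<beta> \<in> bridge_vecs" "\<gamma> \<in> bridge_vecs" "(\<lambda>A. x A + \<beta> A) \<in> M" "(\<lambda>A. y A + \<gamma> A) \<in> M"
      by (auto simp: K_def)
    have "(\<lambda>A. (x A + \<beta> A) + (y A + \<gamma> A)) \<in> M" by (rule vec_subspace_add[OF M(1) *(3,4)])
    then have "(\<lambda>A. (x A + y A) + (\<beta> A + \<gamma> A)) \<in> M" by (simp add: algebra_simps)
    then show "(\<lambda>A. x A + y A) \<in> K"
      unfolding K_def using vec_subspace_add[OF subspace_bridge_vecs *(1,2)]
      by (intro CollectI bexI[of _ "\<lambda>A. \<beta> A + \<gamma> A"])
  next
    fix x r assume "x \<in> K"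
    then obtain \<beta> where *: "\<beta> \<in> bridge_vecs" "(\<lambda>A. x A + \<beta> A) \<in> M" by (auto simp: K_def)
    have "(\<lambda>A. r * (x A + \<beta> A)) \<in> M" by (rule vec_subspace_scale[OF M(1) *(2)])
    then have "(\<lambda>A. r * x A + r * \<beta> A) \<in> M" by (simp add: algebra_simps)
    then show "(\<lambda>A. r * x A) \<in> K"
      unfolding K_def using vec_subspace_scale[OF subspace_bridge_vecs *(1)]
      by (intro CollectI bexI[of _ "\<lambda>A. r * \<beta> A"])
  qed
  have "vec_subspace M'" using K by (auto simp: vec_subspace_def M'_def)
  moreover have "fillable \<tau> (lproj reduced) M' (letters reduced)"
  proof -
    have MK: "x \<in> K" if "x \<in> M" for x
      unfolding K_def using that N0 by (auto intro!: bexI[of _ "\<lambda>_. 0"])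
    have NK: "x \<in> K" if "x \<in> bridge_vecs" for x
    proof -
      have "(\<lambda>A. (- 1) * x A) \<in> bridge_vecs" by (rule vec_subspace_scale[OF subspace_bridge_vecs that])
      then show ?thesis unfolding K_def using M0 by (auto intro!: bexI[of _ "\<lambda>A. (- 1) * x A"])
    qed
    have "fillable \<tau> (lproj W) K (letters W)" by (rule fillable_mono[OF M(2)]) (auto intro: MK)
    moreover have "fillable \<tau> (lproj W) K \<B>" by (rule fillable_mono[OF fillable_bridge_vecs]) (auto intro: NK)
    ultimately have "fillable \<tau> (lproj W) K L"
      by (intro fillable_Diff K B_sub) (auto intro: lproj_in)
    then have "fillable \<tau> (lproj W) M' L"
      by (rule fillable_mono) (auto simp: M'_def pair_vec_def basis_vec_def)
    then show ?thesis by (simp add: reduced_def)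
  qed
  moreover have "product_rank_le (m + 4 * card orbs) (nw_form reduced) (UNIV \<times> M')"
  proof -
    \<comment> \<open>The correction into M is chosen separately for each x, with no linearity;
      \<open>product_rank_le\<close> allows such factors.\<close>
    define b where "b x = (SOME \<beta>. \<beta> \<in> bridge_vecs \<and> (\<lambda>A. x A + \<beta> A) \<in> M)" for x
    have b: "b x \<in> bridge_vecs \<and> (\<lambda>A. x A + b x A) \<in> M" if "x \<in> M'" for x
    proof -
      have "\<exists>\<beta>. \<beta> \<in> bridge_vecs \<and> (\<lambda>A. x A + \<beta> A) \<in> M" using that by (auto simp: M'_def K_def)
      then show ?thesis unfolding b_def by (rule someI_ex)
    qed
    show ?thesis
    proof (rule product_rank_le_transfer[OF M(3), where I = "orbs \<times> {..<4}"
          and h = "\<lambda>(t, x). (t, \<lambda>A. x A + b x A)" and p = "\<lambda>i (t, x). - p i (t, x, b x)"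
          and q = "\<lambda>i (t, x). q i (t, x, b x)"])
      fix X Y :: "rat \<times> ('b \<Rightarrow> rat)" assume XY: "X \<in> UNIV \<times> M'" "Y \<in> UNIV \<times> M'"
      obtain t x u y where [simp]: "X = (t, x)" "Y = (u, y)" by fastforce
      have adm: "admissible x (b x)" "admissible y (b y)"
        using XY b by (auto simp: admissible_def M'_def)
      show "nw_form reduced X Y = nw_form W (case X of (t, x) \<Rightarrow> (t, \<lambda>A. x A + b x A))
          (case Y of (t, x) \<Rightarrow> (t, \<lambda>A. x A + b x A)) +
        (\<Sum>i\<in>orbs \<times> {..<4}. (case X of (t, x) \<Rightarrow> - p i (t, x, b x)) *
          (case Y of (t, x) \<Rightarrow> q i (t, x, b x)))"
        unfolding nw_form_def[of W] by (simp add: pq[OF adm] sum_negf)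
    qed (use b in auto)
  qed
  ultimately show ?thesis unfolding low_rank_filling_def by blast
qed

end

section \<open>Bridge moves and metamorphoses\<close>

lemma occ_pos_0: "occ_pos (x # xs) (v # vs) 0 j = length x + j"
  by (simp add: occ_pos_def interleave_def)

lemma occ_pos_Suc: "occ_pos (x # xs) (v # vs) (Suc r) j = length x + length v + occ_pos xs vs r j"
  by (simp add: occ_pos_def interleave_def)

lemma interleave_Cons: "interleave (x # xs) (v # vs) = x @ v @ interleave xs vs"
  by (simp add: interleave_def)

lemma nth_interleave:
  assumes "length xs = length vs" "r < length vs" "j < length (vs ! r)"
  shows "occ_pos xs vs r j < length (interleave xs vs) \<and> interleave xs vs ! occ_pos xs vs r j = vs ! r ! j"
  using assms
proof (induction xs vs arbitrary: r rule: list_induct2)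
  case (Cons x xs v vs)
  then show ?case
    by (cases r) (auto simp: occ_pos_0 occ_pos_Suc interleave_Cons nth_append)
qed simp

lemma occ_pos_less:
  assumes "length xs = length vs" "r < r'" "r' < length vs" "j < length (vs ! r)"
  shows "occ_pos xs vs r j < occ_pos xs vs r' j'"
  using assms
proof (induction xs vs arbitrary: r r' rule: list_induct2)
  case (Cons x xs v vs)
  then show ?case
    by (cases r; cases r') (auto simp: occ_pos_0 occ_pos_Suc)
qed simp

lemma interleave_cases:
  assumes "length xs = length vs" "p < length (interleave xs vs @ z)"
  shows "(\<exists>r j. r < length vs \<and> j < length (vs ! r) \<and> p = occ_pos xs vs r j) \<or>
    (interleave xs vs @ z) ! p \<in> set (concat xs @ z)"
  using assms
proof (induction xs vs arbitrary: p rule: list_induct2)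
  case Nil
  then show ?case by (simp add: interleave_def)
next
  case (Cons x xs v vs)
  consider "p < length x" | j where "p = length x + j" "j < length v"
    | q where "p = length x + length v + q" "q < length (interleave xs vs @ z)"
  proof -
    assume 1: "p < length x \<Longrightarrow> thesis" and 2: "\<And>j. p = length x + j \<Longrightarrow> j < length v \<Longrightarrow> thesis"
      and 3: "\<And>q. p = length x + length v + q \<Longrightarrow> q < length (interleave xs vs @ z) \<Longrightarrow> thesis"
    show thesis
      using 1 2[of "p - length x"] 3[of "p - length x - length v"] Cons.prems
      by (cases "p < length x"; cases "p < length x + length v") (auto simp: interleave_Cons)
  qed
  then show ?case
  proof cases
    case 1
    then show ?thesis by (simp add: interleave_Cons nth_append)
  next
    case 2
    then have "0 < length (v # vs) \<and> j < length ((v # vs) ! 0) \<and> p = occ_pos (x # xs) (v # vs) 0 j"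
      by (simp add: occ_pos_0)
    then show ?thesis by blast
  next
    case 3
    have nth: "(interleave (x # xs) (v # vs) @ z) ! p = (interleave xs vs @ z) ! q"
      using 3 by (simp add: interleave_Cons nth_append)
    from Cons.IH[OF 3(2)] show ?thesis
    proof (elim disjE exE conjE)
      fix r j assume "r < length vs" "j < length (vs ! r)" "q = occ_pos xs vs r j"
      then have "Suc r < length (v # vs) \<and> j < length ((v # vs) ! Suc r) \<and>
        p = occ_pos (x # xs) (v # vs) (Suc r) j" using 3 by (simp add: occ_pos_Suc)
      then show ?thesis by blast
    next
      assume "(interleave xs vs @ z) ! q \<in> set (concat xs @ z)"
      then show ?thesis unfolding nth by auto
    qed
  qed
qed

lemma filter_interleave:
  assumes "length xs = length vs" "set (concat vs) \<subseteq> X" "set (concat xs) \<inter> X = {}"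
  shows "filter (\<lambda>A. A \<notin> X) (interleave xs vs) = concat xs"
  using assms
proof (induction xs vs rule: list_induct2)
  case Nil
  then show ?case by (simp add: interleave_def)
next
  case (Cons x xs v vs)
  have "filter (\<lambda>A. A \<notin> X) x = x" "filter (\<lambda>A. A \<notin> X) v = []"
    using Cons.prems by (auto simp: filter_id_conv filter_empty_conv)
  then show ?case using Cons by (auto simp: interleave_Cons)
qed

lemma nw_isomorphic_nanoword:
  assumes "is_nanoword \<alpha> W" "nw_isomorphic W U"
  shows "is_nanoword \<alpha> U"
proof -
  obtain f where f: "bij_betw f (letters W) (letters U)"
    "\<And>A. A \<in> letters W \<Longrightarrow> lproj U (f A) = lproj W A" "word U = map f (word W)"
    using assms(2) unfolding nw_isomorphic_def by auto
  have sub: "set (word W) \<subseteq> letters W" using assms(1) by (simp add: is_nanoword_def)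
  have L: "letters U = f ` letters W" and inj: "inj_on f (letters W)"
    using f(1) by (auto simp: bij_betw_def)
  have "count_list (map f (word W)) (f A) = 2" if A: "A \<in> letters W" for A
  proof -
    have c: "count_list (word W) A = 2" using assms(1) A by (simp add: is_nanoword_def)
    then have "A \<in> set (word W)" by (metis count_notin zero_neq_numeral)
    then show ?thesis using c count_list_inj_map[OF inj_on_subset[OF inj sub]] by simp
  qed
  moreover have "lproj U B \<in> \<alpha>" if "B \<in> letters U" for B
    using that f(2) assms(1) by (auto simp: L is_nanoword_def)
  ultimately show ?thesis using sub by (auto simp: is_nanoword_def L f(3))
qed

lemma nw_isomorphic_nat:
  assumes "is_nanoword \<alpha> W"
  obtains U :: "('a, nat) nanoword" where "nw_isomorphic W U"
proof -
  obtain f where f: "bij_betw f (letters W) {0..<card (letters W)}"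
    using ex_bij_betw_finite_nat[OF finite_letters[OF assms]] by auto
  let ?U = "\<lparr>letters = {0..<card (letters W)}, lproj = lproj W \<circ> inv_into (letters W) f,
    word = map f (word W)\<rparr>"
  have "nw_isomorphic W ?U"
    unfolding nw_isomorphic_def using f by (intro exI[of _ f]) (auto simp: bij_betw_inv_into_left)
  then show thesis by (rule that)
qed

lemma first_occ_append: "A \<notin> set x \<Longrightarrow> first_occ (x @ A # y) A = length x"
  unfolding first_occ_def by (rule Min_eqI) (auto simp: nth_append not_less split: if_splits)

lemma two_occurrences:
  assumes "count_list w A = 2"
  obtains x y z where "w = x @ [A] @ y @ [A] @ z" "A \<notin> set x" "A \<notin> set y" "A \<notin> set z"
proof -
  have "A \<in> set w" using assms by (metis count_notin zero_neq_numeral)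
  then obtain x u where w: "w = x @ A # u" "A \<notin> set x" by (meson split_list_first)
  then have u: "count_list u A = 1" using assms by (simp add: count_list_append count_notin)
  then have "A \<in> set u" by (metis count_notin zero_neq_one)
  then obtain y z where yz: "u = y @ A # z" "A \<notin> set y" by (meson split_list_first)
  then have "count_list z A = 0" using u by (simp add: count_list_append count_notin)
  then show thesis using that[of x y z] w yz by (simp add: count_list_0_iff)
qed

context signed_involution
begin

text \<open>It remains to realize the abstract reflection. Positions of removed letters are coded by
  a block r and a place j in it; the code is injective since the blocks are disjoint intervals. The
  symmetric place is \<open>length (vs ! r) - 1 - j\<close> in block \<kappa>(r), as places are
  counted from 0.\<close>

lemma low_rank_filling_bridge:
  assumes W: "is_nanoword \<alpha> W" and bm: "bridge_move \<tau> W g W'"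
  shows "low_rank_filling m W' \<Longrightarrow> low_rank_filling (m + 4 * g) W" and "low_rank_filling m W \<Longrightarrow> low_rank_filling (m + 4 * g) W'"
proof -
  obtain \<B> xs vs z \<kappa> where br: "is_bridge \<tau> W \<B> xs vs z \<kappa>" and g: "g = arches (length vs) \<kappa>"
    and W': "W' = W\<lparr>letters := letters W - \<B>, word := concat xs @ z\<rparr>"
    using bm by (auto elim: bridge_move.cases)
  obtain \<iota> where qb: "is_quasi_bridge W \<B> xs vs z \<kappa> \<iota>"
    and lp: "\<And>B. B \<in> \<B> \<Longrightarrow> lproj W (\<iota> B) = (\<tau> ^^ bridge_eps W xs vs \<kappa> \<iota> B) (lproj W B)"
    using br unfolding is_bridge_def by auto
  define k where "k = length vs"
  have fac: "is_factor W \<B> xs vs z" and kap: "\<kappa> permutes {..<k}" "\<kappa> \<circ> \<kappa> = id"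
    and iov: "\<And>r. r < k \<Longrightarrow> map \<iota> (vs ! r) = rev (vs ! \<kappa> r)"
    using qb unfolding is_quasi_bridge_def k_def by auto
  have B_sub: "\<B> \<subseteq> letters W" and vs: "set (concat vs) \<subseteq> \<B>" and len: "length xs = length vs"
    and w: "word W = interleave xs vs @ z" and out: "set (concat xs @ z) \<subseteq> letters W - \<B>"
    using fac unfolding is_factor_def by auto
  have kappa_lt: "\<kappa> r < k" if "r < k" for r using permutes_in_image[OF kap(1), of r] that by simp
  have kappa_kappa: "\<kappa> (\<kappa> r) = r" for r using fun_cong[OF kap(2), of r] by simp
  have length_kappa: "length (vs ! \<kappa> r) = length (vs ! r)" if "r < k" for r
    using arg_cong[OF iov[OF that], of length] by simp
  define oc where "oc = (\<lambda>(r, j). occ_pos xs vs r j)"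
  define P where "P = {(r, j). r < k \<and> j < length (vs ! r)}"
  have oc_less: "occ_pos xs vs r j < occ_pos xs vs r' j'" if "r < r'" "r' < k" "j < length (vs ! r)"
    for r r' j j' using occ_pos_less[OF len] that by (simp add: k_def)
  have oc_add: "occ_pos xs vs r j = occ_pos xs vs r 0 + j" for r j by (simp add: occ_pos_def)
  have inj: "inj_on oc P"
  proof (rule inj_onI, clarsimp simp: P_def oc_def)
    fix r j r' j' assume a: "r < k" "j < length (vs ! r)" "r' < k" "j' < length (vs ! r')"
      "occ_pos xs vs r j = occ_pos xs vs r' j'"
    then have "r = r'" using oc_less[of r r' j j'] oc_less[of r' r j' j]
      by (cases r r' rule: linorder_cases) auto
    then show "r = r' \<and> j = j'" using a(5) oc_add[of r j] oc_add[of r j'] by simp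
  qed
  define Pos where "Pos = {p. p < length (word W) \<and> word W ! p \<in> \<B>}"
  have nth: "occ_pos xs vs r j < length (word W)" "word W ! occ_pos xs vs r j = vs ! r ! j"
    if "r < k" "j < length (vs ! r)" for r j
    using nth_interleave[OF len, of r j] that unfolding w k_def by (auto simp: nth_append)
  have in_B: "vs ! r ! j \<in> \<B>" if "r < k" "j < length (vs ! r)" for r j
    using that vs unfolding k_def by (auto dest!: subsetD) (metis nth_mem)
  have Pos_oc: "Pos = oc ` P"
  proof (intro equalityI subsetI)
    fix p assume "p \<in> Pos"
    then have p: "p < length (interleave xs vs @ z)" "(interleave xs vs @ z) ! p \<in> \<B>"
      by (auto simp: Pos_def w)
    then obtain r j where "r < length vs" "j < length (vs ! r)" "p = occ_pos xs vs r j"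
      using interleave_cases[OF len p(1)] out by blast
    then show "p \<in> oc ` P" unfolding oc_def P_def k_def by force
  next
    fix p assume "p \<in> oc ` P"
    then show "p \<in> Pos" using nth in_B by (auto simp: oc_def P_def Pos_def)
  qed
  define dec where "dec = inv_into P oc"
  have dec: "dec (occ_pos xs vs r j) = (r, j)" if "r < k" "j < length (vs ! r)" for r j
    using inv_into_f_f[OF inj, of "(r, j)"] that by (simp add: dec_def oc_def P_def)
  define blk where "blk p = fst (dec p)" for p
  define R where "R p = (case dec p of (r, j) \<Rightarrow> occ_pos xs vs (\<kappa> r) (length (vs ! r) - 1 - j))" for p
  have PosE: "\<exists>r j. r < k \<and> j < length (vs ! r) \<and> p = occ_pos xs vs r j" if "p \<in> Pos" for p
    using that unfolding Pos_oc oc_def P_def by auto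
  have PosI: "occ_pos xs vs r j \<in> Pos" if "r < k" "j < length (vs ! r)" for r j
    using that nth in_B by (simp add: Pos_def)
  have R_oc: "R (occ_pos xs vs r j) = occ_pos xs vs (\<kappa> r) (length (vs ! r) - 1 - j)"
    and blk_oc: "blk (occ_pos xs vs r j) = r" if "r < k" "j < length (vs ! r)" for r j
    using dec[OF that] by (simp_all add: R_def blk_def)
  have idx: "\<kappa> r < k \<and> length (vs ! r) - 1 - j < length (vs ! \<kappa> r)" if "r < k" "j < length (vs ! r)" for r j
    using that kappa_lt length_kappa by auto
  have count: "count_list (word W) A = 2" if "A \<in> letters W" for A
    using W that by (simp add: is_nanoword_def)
  interpret reflection \<alpha> \<tau> \<chi> W \<B> k \<kappa> blk R \<iota> Pos
  proof
    show "Pos = {p. p < length (word W) \<and> word W ! p \<in> \<B>}" by (rule Pos_def)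
    show "R p \<in> Pos" if "p \<in> Pos" for p
    proof -
      obtain r j where rj: "r < k" "j < length (vs ! r)" "p = occ_pos xs vs r j" using PosE \<open>p \<in> Pos\<close> by blast
      then show ?thesis using PosI idx[OF rj(1,2)] by (simp add: R_oc)
    qed
    show "blk p < k" if "p \<in> Pos" for p
      using PosE[OF that] blk_oc by auto
    show "blk (R p) = \<kappa> (blk p)" if "p \<in> Pos" for p
    proof -
      obtain r j where rj: "r < k" "j < length (vs ! r)" "p = occ_pos xs vs r j" using PosE \<open>p \<in> Pos\<close> by blast
      then show ?thesis using idx[OF rj(1,2)] by (simp add: R_oc blk_oc)
    qed
    show "R (R p) = p" if "p \<in> Pos" for p
    proof -
      obtain r j where rj: "r < k" "j < length (vs ! r)" "p = occ_pos xs vs r j" using PosE \<open>p \<in> Pos\<close> by blast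
      then show ?thesis
        using idx[OF rj(1,2)] by (simp add: R_oc kappa_kappa length_kappa)
    qed
    show "sg (R p) (R q) = - sg p q" if pq: "p \<in> Pos" "q \<in> Pos" "blk p = blk q" for p q
    proof -
      obtain r j s i where rj: "r < k" "j < length (vs ! r)" "p = occ_pos xs vs r j"
        and si: "s < k" "i < length (vs ! s)" "q = occ_pos xs vs s i" using PosE pq by metis
      then have s: "s = r" using pq(3) by (simp add: blk_oc)
      have "sg (R p) (R q) = sg (length (vs ! r) - 1 - j) (length (vs ! r) - 1 - i)"
        using rj si s oc_add[of "\<kappa> r" "length (vs ! r) - 1 - j"] oc_add[of "\<kappa> r" "length (vs ! r) - 1 - i"]
        by (simp add: R_oc sg_def)
      also have "\<dots> = - sg j i" using rj(2) si(2) s by (auto simp: sg_def sgn_if of_nat_diff)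
      also have "sg j i = sg p q" using rj si s oc_add[of r j] oc_add[of r i] by (simp add: sg_def)
      finally show ?thesis .
    qed
    show "sg p q = sg (blk p) (blk q)" if pq: "p \<in> Pos" "q \<in> Pos" "blk p \<noteq> blk q" for p q
    proof -
      obtain r j s i where rj: "r < k" "j < length (vs ! r)" "p = occ_pos xs vs r j"
        and si: "s < k" "i < length (vs ! s)" "q = occ_pos xs vs s i" using PosE pq by metis
      have rs: "r \<noteq> s" using pq(3) rj si by (simp add: blk_oc)
      show ?thesis
      proof (cases "r < s")
        case True
        then show ?thesis using oc_less[of r s j i] rj si by (simp add: blk_oc sg_simps)
      next
        case False
        then have "s < r" using rs by simp
        then show ?thesis using oc_less[of s r i j] rj si by (simp add: blk_oc sg_simps)
      qed
    qed
    show "sg i p = sg i q"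
      if i: "i < length (word W)" "i \<notin> Pos" and pq: "p \<in> Pos" "q \<in> Pos" "blk p = blk q" for i p q
    proof -
      obtain r j s l where rj: "r < k" "j < length (vs ! r)" "p = occ_pos xs vs r j"
        and sl: "s < k" "l < length (vs ! s)" "q = occ_pos xs vs s l" using PosE pq by metis
      then have s: "s = r" using pq(3) by (simp add: blk_oc)
      have ni: "i \<noteq> occ_pos xs vs r 0 + d" if "d < length (vs ! r)" for d
        using i(2) PosI[OF rj(1) that] oc_add[of r d] by auto
      \<comment> \<open>The block fills an interval of positions, so a position outside it sees the
        whole block on one side.\<close>
      have "i < occ_pos xs vs r 0 \<or> i \<ge> occ_pos xs vs r 0 + length (vs ! r)"
        using ni[of "i - occ_pos xs vs r 0"] by linarith
      then show ?thesis
        using rj sl s oc_add[of r j] oc_add[of r l] by (elim disjE) (auto simp: sg_simps)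
    qed
    show "word W ! R p = \<iota> (word W ! p)" if p: "p \<in> Pos" for p
    proof -
      obtain r j where rj: "r < k" "j < length (vs ! r)" "p = occ_pos xs vs r j" using PosE p by blast
      have "word W ! R p = vs ! \<kappa> r ! (length (vs ! r) - 1 - j)"
        using rj idx[OF rj(1,2)] nth by (simp add: R_oc)
      also have "\<dots> = rev (vs ! \<kappa> r) ! j" using rj length_kappa by (simp add: rev_nth)
      also have "\<dots> = \<iota> (vs ! r ! j)" using iov[OF rj(1), symmetric] rj by simp
      finally show ?thesis using rj nth by simp
    qed
    show "lproj W (\<iota> B) = (if R (first_occ (word W) B) = first_occ (word W) (\<iota> B)
        then \<tau> (lproj W B) else lproj W B)" if B: "B \<in> \<B>" for B
    proof -
      have "first_occ (word W) B \<in> Pos"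
        using occurrence_nth[OF count] B B_sub by (auto simp: Pos_def)
      then obtain r j where rj: "r < k" "j < length (vs ! r)" "first_occ (word W) B = occ_pos xs vs r j"
        using PosE by blast
      \<comment> \<open>The code (r, j) of the first occurrence of B is unique, so \<epsilon>(B) = 1
        says that R matches the first occurrences of B and \<iota>(B).\<close>
      have "(\<exists>r j. r < length vs \<and> j < length (vs ! r) \<and> occ_pos xs vs r j = first_occ (word W) B \<and>
          occ_pos xs vs (\<kappa> r) (length (vs ! r) - 1 - j) = first_occ (word W) (\<iota> B)) \<longleftrightarrow>
        R (first_occ (word W) B) = first_occ (word W) (\<iota> B)"
        using rj R_oc unfolding k_def[symmetric] by metis
      then show ?thesis unfolding lp[OF B] bridge_eps_def by simp
    qed
  qed (use W B_sub kappa_lt kappa_kappa in auto)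
  have "filter (\<lambda>A. A \<notin> \<B>) (word W) = concat xs @ z"
  proof -
    have "set (concat xs) \<inter> \<B> = {}" "filter (\<lambda>A. A \<notin> \<B>) z = z"
      using out by (auto simp: filter_id_conv)
    then show ?thesis unfolding w using filter_interleave[OF len vs] by simp
  qed
  then have "W' = reduced" unfolding W' reduced_def by simp
  moreover have "g = card {r. r < k \<and> r < \<kappa> r}"
    unfolding g k_def[symmetric] by (rule arches_card) (auto simp: kappa_lt kappa_kappa)
  ultimately show "low_rank_filling m W' \<Longrightarrow> low_rank_filling (m + 4 * g) W" "low_rank_filling m W \<Longrightarrow> low_rank_filling (m + 4 * g) W'"
    using low_rank_filling_expand low_rank_filling_reduce by simp_all
qed

end

text \<open>The single block AA is reflected onto itself. This exchanges the two occurrences of A,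
  so \<iota> is the identity and \<epsilon>(A) = 0.\<close>

lemma bridge_move1:
  assumes W: "is_nanoword \<alpha> W" and w: "word W = x @ [A, A] @ y"
  shows "bridge_move \<tau> W 0 (W\<lparr>letters := letters W - {A}, word := x @ y\<rparr>)"
proof -
  have sub: "set (word W) \<subseteq> letters W" and A: "A \<in> letters W"
    using W w by (auto simp: is_nanoword_def)
  then have "count_list (word W) A = 2" using W by (simp add: is_nanoword_def)
  then have "A \<notin> set x" "A \<notin> set y" unfolding w by (auto simp: count_list_append count_list_0_iff)
  then have "is_factor W {A} [x] [[A, A]] y"
    using sub A w by (auto simp: is_factor_def interleave_def)
  then have "is_quasi_bridge W {A} [x] [[A, A]] y id id"
    by (simp add: is_quasi_bridge_def permutes_id)
  moreover have "bridge_eps W [x] [[A, A]] id id A = 0"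
    unfolding bridge_eps_def by (auto simp: occ_pos_0 less_Suc_eq)
  ultimately have "is_bridge \<tau> W {A} [x] [[A, A]] y id"
    unfolding is_bridge_def by (intro exI[of _ id]) simp
  from bridge_move.intros[OF this] show ?thesis by (simp add: arches_def)
qed

text \<open>Each of the blocks AB and BA is reflected onto itself, not onto the other, so there is
  no arch and \<iota> exchanges A and B. Their first occurrences are symmetric inside the block AB,
  hence \<epsilon> = 1 for both letters and the bridge condition becomes that of the move.\<close>

lemma bridge_move2:
  assumes W: "is_nanoword \<alpha> W" and w: "word W = x @ [A, B] @ y @ [B, A] @ z"
    and lp: "lproj W B = \<tau> (lproj W A)" and tau: "\<And>a. a \<in> \<alpha> \<Longrightarrow> \<tau> (\<tau> a) = a"
  shows "bridge_move \<tau> W 0 (W\<lparr>letters := letters W - {A, B}, word := x @ y @ z\<rparr>)"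
proof -
  have sub: "set (word W) \<subseteq> letters W" using W by (simp add: is_nanoword_def)
  then have L: "A \<in> letters W" "B \<in> letters W" using w by auto
  then have cnt: "count_list (word W) A = 2" "count_list (word W) B = 2" using W by (auto simp: is_nanoword_def)
  have AB: "A \<noteq> B" using cnt(1) unfolding w by (auto simp: count_list_append)
  have notin: "A \<notin> set x" "A \<notin> set y" "A \<notin> set z" "B \<notin> set x" "B \<notin> set y" "B \<notin> set z"
    using cnt AB unfolding w by (auto simp: count_list_append count_list_0_iff)
  define \<iota> where "\<iota> X = (if X = A then B else A)" for X
  have fac: "is_factor W {A, B} [x, y] [[A, B], [B, A]] z"
    using sub L w notin AB by (auto simp: is_factor_def interleave_def)
  have qb: "is_quasi_bridge W {A, B} [x, y] [[A, B], [B, A]] z id \<iota>"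
    using fac AB by (auto simp: is_quasi_bridge_def permutes_id \<iota>_def less_Suc_eq)
  have fA: "first_occ (word W) A = length x"
    unfolding w using first_occ_append[OF notin(1), of "B # y @ [B, A] @ z"] by simp
  have fB: "first_occ (word W) B = Suc (length x)"
    unfolding w using first_occ_append[of B "x @ [A]" "y @ [B, A] @ z"] notin AB by simp
  have "bridge_eps W [x, y] [[A, B], [B, A]] id \<iota> A = 1"
    unfolding bridge_eps_def using fA fB
    by (simp add: \<iota>_def occ_pos_0) (intro exI[of _ 0], simp add: occ_pos_0)
  moreover have "bridge_eps W [x, y] [[A, B], [B, A]] id \<iota> B = 1"
    unfolding bridge_eps_def using fA fB AB
    by (simp add: \<iota>_def occ_pos_0) (intro exI[of _ 0] exI[of _ 1], simp add: occ_pos_0)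
  moreover have "\<tau> (lproj W B) = lproj W A"
    using tau W L lp by (auto simp: is_nanoword_def Pi_iff)
  ultimately have "is_bridge \<tau> W {A, B} [x, y] [[A, B], [B, A]] z id"
    unfolding is_bridge_def using qb lp AB by (intro exI[of _ \<iota>]) (auto simp: \<iota>_def)
  from bridge_move.intros[OF this] show ?thesis by (simp add: arches_def)
qed

text \<open>In the bridge (A|A) with exchanged blocks the occurrence symmetric to the first is the
  last, so \<epsilon>(A) = 0 and \<iota> = id respects every projection. Letters can thus be removed
  one by one.\<close>

lemma bridge_move_letter:
  assumes W: "is_nanoword \<alpha> W" and A: "A \<in> letters W"
  obtains g x where "bridge_move \<tau> W g (W\<lparr>letters := letters W - {A}, word := x\<rparr>)"
    "is_nanoword \<alpha> (W\<lparr>letters := letters W - {A}, word := x\<rparr>)"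
proof -
  have sub: "set (word W) \<subseteq> letters W" using W by (simp add: is_nanoword_def)
  have cnt: "count_list (word W) C = 2" if "C \<in> letters W" for C
    using W that by (simp add: is_nanoword_def)
  obtain x y z where w: "word W = x @ [A] @ y @ [A] @ z" and n: "A \<notin> set x" "A \<notin> set y" "A \<notin> set z"
    using two_occurrences[OF cnt[OF A]] by blast
  define \<kappa> where "\<kappa> = Transposition.transpose 0 (1 :: nat)"
  have fac: "is_factor W {A} [x, y] [[A], [A]] z"
    using sub A w n by (auto simp: is_factor_def interleave_def)
  have "is_quasi_bridge W {A} [x, y] [[A], [A]] z \<kappa> id"
    using fac
    by (auto simp: is_quasi_bridge_def \<kappa>_def less_Suc_eq permutes_swap_id
        Transposition.transpose_apply_first Transposition.transpose_apply_second)
  moreover have "bridge_eps W [x, y] [[A], [A]] \<kappa> id A = 0"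
  proof -
    have False if "r < length [[A], [A]]" "j < length ([[A], [A]] ! r)"
      "occ_pos [x, y] [[A], [A]] r j = first_occ (word W) A"
      "occ_pos [x, y] [[A], [A]] (\<kappa> r) (length ([[A], [A]] ! r) - 1 - j) = first_occ (word W) A" for r j
    proof -
      have "r = 0 \<or> r = 1" using that(1) by auto
      then show False using that(2-4) by (elim disjE) (auto simp: occ_pos_0 occ_pos_Suc \<kappa>_def)
    qed
    then have "\<not> (\<exists>r j. r < length [[A], [A]] \<and> j < length ([[A], [A]] ! r) \<and>
      occ_pos [x, y] [[A], [A]] r j = first_occ (word W) A \<and>
      occ_pos [x, y] [[A], [A]] (\<kappa> r) (length ([[A], [A]] ! r) - 1 - j) = first_occ (word W) A)"
      by blast
    then show ?thesis unfolding bridge_eps_def id_apply by (rule if_not_P)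
  qed
  ultimately have "is_bridge \<tau> W {A} [x, y] [[A], [A]] z \<kappa>"
    unfolding is_bridge_def by (intro exI[of _ id]) simp
  from bridge_move.intros[OF this]
  have "bridge_move \<tau> W (arches 2 \<kappa>) (W\<lparr>letters := letters W - {A}, word := x @ y @ z\<rparr>)"
    by (simp add: numeral_2_eq_2)
  moreover have "is_nanoword \<alpha> (W\<lparr>letters := letters W - {A}, word := x @ y @ z\<rparr>)"
  proof -
    have "count_list (x @ y @ z) C = 2" if "C \<in> letters W - {A}" for C
      using cnt[of C] that by (auto simp: w count_list_append)
    moreover have "set (x @ y @ z) \<subseteq> letters W - {A}" using sub n w by auto
    ultimately show ?thesis using W by (auto simp: is_nanoword_def)
  qed
  ultimately show thesis by (rule that)
qed

lemma metamorphosis_nanoword: "metamorphosis \<alpha> \<tau> W g V \<Longrightarrow> is_nanoword \<alpha> W"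
  by (erule metamorphosis.cases) auto

text \<open>This rules out the junk value \<open>Inf {} = 0\<close> of the bridge norm.\<close>

lemma metamorphosis_to_empty:
  assumes "is_nanoword \<alpha> W"
  shows "\<exists>g. metamorphosis \<alpha> \<tau> W g empty_nanoword"
  using assms
proof (induction "card (letters W)" arbitrary: W rule: less_induct)
  case less
  show ?case
  proof (cases "letters W = {}")
    case True
    then have "nw_isomorphic W empty_nanoword"
      using less.prems by (simp add: nw_isomorphic_def empty_nanoword_def is_nanoword_def bij_betw_def)
    moreover have "is_nanoword \<alpha> empty_nanoword" by (simp add: is_nanoword_def empty_nanoword_def)
    ultimately show ?thesis
      using less.prems metamorphosis.intros elementary_step.intros(1) by metis
  next
    case False
    then obtain A where A: "A \<in> letters W" by auto
    obtain g x where bm: "bridge_move \<tau> W g (W\<lparr>letters := letters W - {A}, word := x\<rparr>)"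
      and nw: "is_nanoword \<alpha> (W\<lparr>letters := letters W - {A}, word := x\<rparr>)"
      using bridge_move_letter[OF less.prems A] by blast
    have "card (letters W - {A}) < card (letters W)"
      using A finite_letters[OF less.prems] by (rule card_Diff1_less[rotated])
    then obtain h where "metamorphosis \<alpha> \<tau> (W\<lparr>letters := letters W - {A}, word := x\<rparr>) h empty_nanoword"
      using less.hyps[of "W\<lparr>letters := letters W - {A}, word := x\<rparr>"] nw by auto
    then show ?thesis
      using metamorphosis.Cons[OF less.prems elementary_step.intros(4)[OF bm]] by blast
  qed
qed

section \<open>Low-rank fillings along metamorphoses\<close>

context signed_involution
begin

lemma low_rank_filling_homotopy_move:
  assumes W: "is_nanoword \<alpha> W" and mv: "homotopy_move \<tau> W W'"
  shows "low_rank_filling m W' \<longleftrightarrow> low_rank_filling m W"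
  using mv
proof cases
  case (move1 x A y)
  then show ?thesis using low_rank_filling_bridge[OF W bridge_move1[OF W move1(2)], of m] by auto
next
  case (move2 x A B y z)
  then show ?thesis using low_rank_filling_bridge[OF W bridge_move2[where \<tau> = \<tau>, OF W move2(2,3) tau_tau], of m] by auto
next
  case (move3 x A B y C z t)
  then show ?thesis using low_rank_filling_move3[OF W move3(2)] by simp
qed

text \<open>Fillings are pulled back from target to source: a bridge move restores letters, and the
  inverse of one eliminates them.\<close>

lemma low_rank_filling_elementary_step:
  assumes "is_nanoword \<alpha> W" "is_nanoword \<alpha> W'" "elementary_step \<tau> W g W'" "low_rank_filling m W'"
  shows "low_rank_filling (m + 4 * g) W"
  using assms(3)
proof cases
  case 1
  then show ?thesis using low_rank_filling_isomorphic assms by simp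
next
  case 2
  then show ?thesis using low_rank_filling_homotopy_move[OF assms(1) 2(2)] assms(4) by simp
next
  case 3
  then show ?thesis using low_rank_filling_homotopy_move[OF assms(2) 3(2)] assms(4) by simp
next
  case 4
  then show ?thesis using low_rank_filling_bridge(1) assms by blast
next
  case 5
  then show ?thesis using low_rank_filling_bridge(2) assms by blast
qed

lemma low_rank_filling_metamorphosis:
  assumes "metamorphosis \<alpha> \<tau> W g V" "letters V = {}"
  shows "low_rank_filling (4 * g) W"
  using assms
proof induction
  case (Nil W)
  then show ?case by (simp add: low_rank_filling_empty)
next
  case (Cons W g W' h V)
  then have "low_rank_filling (4 * h + 4 * g) W"
    using low_rank_filling_elementary_step metamorphosis_nanoword by metis
  then show ?case by (simp add: algebra_simps)
qed

text \<open>The infimum is attained, because a metamorphosis to the empty nanoword exists. The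
  filling is found on the copy with letters in \<open>nat\<close> and returned by the
  isomorphism.\<close>

lemma low_rank_filling_bridge_norm:
  assumes W: "is_nanoword \<alpha> W"
  shows "low_rank_filling (4 * bridge_norm \<alpha> \<tau> W) W"
proof -
  let ?G = "{g. \<exists>U :: ('a, nat) nanoword. nw_isomorphic W U \<and> metamorphosis \<alpha> \<tau> U g empty_nanoword}"
  obtain U :: "('a, nat) nanoword" where "nw_isomorphic W U" using nw_isomorphic_nat[OF W] .
  then have "?G \<noteq> {}" using metamorphosis_to_empty nw_isomorphic_nanoword[OF W] by blast
  then have "bridge_norm \<alpha> \<tau> W \<in> ?G" unfolding bridge_norm_def by (rule Inf_nat_def1)
  then obtain V :: "('a, nat) nanoword" where V: "nw_isomorphic W V"
    "metamorphosis \<alpha> \<tau> V (bridge_norm \<alpha> \<tau> W) empty_nanoword" by auto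
  have "low_rank_filling (4 * bridge_norm \<alpha> \<tau> W) V"
    by (rule low_rank_filling_metamorphosis[OF V(2)]) (simp add: empty_nanoword_def)
  then show ?thesis using low_rank_filling_isomorphic[OF W nw_isomorphic_nanoword[OF W V(1)] V(1)] by simp
qed

end

section \<open>The form of a nanoword in terms of heights\<close>

lemma drop_split:
  assumes "i < j" "j \<le> length w"
  shows "drop i w = [w ! i] @ take (j - Suc i) (drop (Suc i) w) @ drop j w"
proof -
  have "drop i w = w ! i # drop (Suc i) w" using assms by (simp add: Cons_nth_drop_Suc)
  also have "drop (Suc i) w = take (j - Suc i) (drop (Suc i) w) @ drop (j - Suc i) (drop (Suc i) w)"
    by (rule append_take_drop_id[symmetric])
  also have "drop (j - Suc i) (drop (Suc i) w) = drop j w" using assms by simp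
  finally show ?thesis by simp
qed

lemma alternates_iff:
  assumes cnt: "count_list w A = 2" "count_list w B = 2"
  shows "alternates w A B \<longleftrightarrow> first_occ w A < first_occ w B \<and> first_occ w B < last_occ w A \<and>
    last_occ w A < last_occ w B"
proof
  assume "alternates w A B"
  then obtain x y z t u where w: "w = x @ [A] @ y @ [B] @ z @ [A] @ t @ [B] @ u"
    unfolding alternates_def by auto
  have AB: "A \<noteq> B" using cnt(1) unfolding w by auto
  have n: "A \<notin> set x" "A \<notin> set y" "A \<notin> set z" "A \<notin> set t" "A \<notin> set u"
    "B \<notin> set x" "B \<notin> set y" "B \<notin> set z" "B \<notin> set t" "B \<notin> set u"
    using cnt AB unfolding w by (auto simp: count_list_0_iff)
  let ?i = "length x" and ?j = "length x + length y + 1" and ?k = "length x + length y + length z + 2"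
    and ?l = "length x + length y + length z + length t + 3"
  have nth: "w ! ?i = A" "w ! ?j = B" "w ! ?k = A" "w ! ?l = B" "?l < length w"
    unfolding w by (simp_all add: nth_append)
  have *: "{i. i < length w \<and> w ! i = D} = {i, j}"
    if "count_list w D = 2" "i < j" "j < length w" "w ! i = D" "w ! j = D" for D i j
  proof -
    have "{i, j} \<subseteq> {first_occ w D, last_occ w D}"
      unfolding occurrences(2)[OF that(1), symmetric] using that by auto
    then show ?thesis unfolding occurrences(2)[OF that(1)] using that(2) by auto
  qed
  have "first_occ w A = ?i \<and> last_occ w A = ?k"
    using occurrencesI[OF *[OF cnt(1), of ?i ?k]] nth by simp
  moreover have "first_occ w B = ?j \<and> last_occ w B = ?l"
    using occurrencesI[OF *[OF cnt(2), of ?j ?l]] nth by simp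
  ultimately show "first_occ w A < first_occ w B \<and> first_occ w B < last_occ w A \<and>
    last_occ w A < last_occ w B" by simp
next
  let ?i = "first_occ w A" and ?j = "first_occ w B" and ?k = "last_occ w A" and ?l = "last_occ w B"
  assume ord: "?i < ?j \<and> ?j < ?k \<and> ?k < ?l"
  have l: "?l < length w" using occurrence_nth[OF cnt(2)] by simp
  have "w = take ?i w @ drop ?i w" by simp
  also have "drop ?i w = [w ! ?i] @ take (?j - Suc ?i) (drop (Suc ?i) w) @ drop ?j w"
    using ord l by (intro drop_split) auto
  also have "drop ?j w = [w ! ?j] @ take (?k - Suc ?j) (drop (Suc ?j) w) @ drop ?k w"
    using ord l by (intro drop_split) auto
  also have "drop ?k w = [w ! ?k] @ take (?l - Suc ?k) (drop (Suc ?k) w) @ drop ?l w"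
    using ord l by (intro drop_split) auto
  also have "drop ?l w = [w ! ?l] @ drop (Suc ?l) w" using l by (simp add: Cons_nth_drop_Suc)
  finally have "w = take ?i w @ [A] @ take (?j - Suc ?i) (drop (Suc ?i) w) @
    [B] @ take (?k - Suc ?j) (drop (Suc ?j) w) @ [A] @ take (?l - Suc ?k) (drop (Suc ?k) w) @
    [B] @ drop (Suc ?l) w"
    using occurrence_nth[OF cnt(1)] occurrence_nth[OF cnt(2)] by simp
  then show "alternates w A B" unfolding alternates_def by blast
qed

lemma loop_height_self:
  assumes "count_list w A = 2"
  shows "loop_height w A (first_occ w A) = 1" "loop_height w A (last_occ w A) = 1"
  using occurrences(1)[OF assms] by (simp_all add: loop_height_def sg_simps)

lemma loop_height_between:
  assumes "count_list w A = 2" "p \<noteq> first_occ w A" "p \<noteq> last_occ w A"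
  shows "loop_height w A p = (if first_occ w A < p \<and> p < last_occ w A then 2 else 0)"
  using occurrences(1)[OF assms(1)] assms(2,3)
  by (cases p "first_occ w A" rule: linorder_cases; cases p "last_occ w A" rule: linorder_cases)
    (simp_all add: loop_height_def sg_simps)

lemma occurrences_distinct:
  assumes "count_list w A = 2" "count_list w B = 2" "A \<noteq> B"
  shows "first_occ w A \<noteq> first_occ w B" "first_occ w A \<noteq> last_occ w B"
    "last_occ w A \<noteq> first_occ w B" "last_occ w A \<noteq> last_occ w B"
  using occurrence_nth[OF assms(1)] occurrence_nth[OF assms(2)] assms(3) by metis+

text \<open>For D different from A, the heights at the two ends of D differ exactly when one end
  lies inside the loop of A and the other outside; the sign tells which letter comes first.\<close>

lemma loop_height_link_number:
  assumes "count_list w A = 2" "count_list w D = 2"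
  shows "loop_height w A (first_occ w D) - loop_height w A (last_occ w D) = 2 * of_int (link_number w A D)"
proof (cases "A = D")
  case True
  then show ?thesis using loop_height_self[OF assms(1)] by (auto simp: link_number_def alternates_iff assms)
next
  case False
  note d = occurrences_distinct[OF assms False]
  show ?thesis
    using d occurrences(1)[OF assms(1)] occurrences(1)[OF assms(2)]
    by (simp add: link_number_def alternates_iff assms loop_height_between d[symmetric])
qed

definition circ_set :: "'b list \<Rightarrow> 'b set \<Rightarrow> 'b \<Rightarrow> 'b \<Rightarrow> 'b set" where
  "circ_set w L A B = {D \<in> L. first_occ w A < first_occ w D \<and> first_occ w D < last_occ w A \<and>
     first_occ w B < last_occ w D \<and> last_occ w D < last_occ w B}"

text \<open>For D different from A and B all heights are 0 or 2, and each product is 4 times the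
  indicator of a \<open>circ_set\<close>. For D = A the loop of A has height 1 at both ends, leaving
  a difference of heights of the loop of B, which is a link number; the case D = B is alike.\<close>

lemma loop_height_wedge:
  assumes cnt: "count_list w A = 2" "count_list w B = 2" "count_list w D = 2" and D: "D \<in> L"
  shows "(loop_height w A (first_occ w D) * loop_height w B (last_occ w D) -
      loop_height w A (last_occ w D) * loop_height w B (first_occ w D)) / 2 =
    2 * ((if D \<in> circ_set w L A B then 1 else 0) - (if D \<in> circ_set w L B A then 1 else 0)) +
    (if D = A then of_int (link_number w A B) else 0) +
    (if D = B then of_int (link_number w A B) else 0)"
proof -
  have anti: "link_number w B A = - link_number w A B"
    by (auto simp: link_number_def alternates_iff cnt)
  consider "D = A" "D = B" | "D = A" "D \<noteq> B" | "D \<noteq> A" "D = B" | "D \<noteq> A" "D \<noteq> B" by auto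
  then show ?thesis
  proof cases
    case 1
    then show ?thesis using loop_height_self[OF cnt(1)]
      by (auto simp: circ_set_def link_number_def alternates_iff cnt)
  next
    case 2
    have "loop_height w B (first_occ w A) - loop_height w B (last_occ w A) = - 2 * of_int (link_number w A B)"
      using loop_height_link_number[OF cnt(2,1)] anti by simp
    then show ?thesis using 2 loop_height_self[OF cnt(1)] by (simp add: circ_set_def)
  next
    case 3
    have "loop_height w A (first_occ w B) - loop_height w A (last_occ w B) = 2 * of_int (link_number w A B)"
      using loop_height_link_number[OF cnt(1,2)] .
    then show ?thesis using 3 loop_height_self[OF cnt(2)] by (simp add: circ_set_def)
  next
    case 4
    note d = occurrences_distinct[OF cnt(3,1) 4(1)] occurrences_distinct[OF cnt(3,2) 4(2)]
    show ?thesis using 4 D by (auto simp: circ_set_def loop_height_between cnt d)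
  qed
qed

lemma omega_letters:
  assumes cnt: "\<And>D. D \<in> L \<Longrightarrow> count_list w D = 2" and fin: "finite L" and AB: "A \<in> L" "B \<in> L"
  shows "omega c w L (loop_height w A) (loop_height w B) / 2 =
    2 * ((\<Sum>D\<in>circ_set w L A B. c D) - (\<Sum>D\<in>circ_set w L B A. c D)) +
    of_int (link_number w A B) * (c A + c B)"
proof -
  have sub: "circ_set w L X Y \<subseteq> L" for X Y by (auto simp: circ_set_def)
  have ind: "(\<Sum>D\<in>L. if D \<in> circ_set w L X Y then c D else 0) = (\<Sum>D\<in>circ_set w L X Y. c D)" for X Y
    using sum.inter_restrict[OF fin, of c "circ_set w L X Y"] sub[of X Y] by (simp add: Int_absorb1)
  have "omega c w L (loop_height w A) (loop_height w B) / 2 = (\<Sum>D\<in>L. c D *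
    ((loop_height w A (first_occ w D) * loop_height w B (last_occ w D) -
      loop_height w A (last_occ w D) * loop_height w B (first_occ w D)) / 2))"
    by (simp add: omega_def sum_divide_distrib)
  also have "\<dots> = (\<Sum>D\<in>L. 2 * (if D \<in> circ_set w L A B then c D else 0) -
    2 * (if D \<in> circ_set w L B A then c D else 0) +
    (if D = A then of_int (link_number w A B) * c A else 0) +
    (if D = B then of_int (link_number w A B) * c B else 0))"
    by (rule sum.cong[OF refl], subst loop_height_wedge[where L = L])
      (use cnt AB in \<open>auto simp: algebra_simps\<close>)
  also have "\<dots> = 2 * (\<Sum>D\<in>circ_set w L A B. c D) - 2 * (\<Sum>D\<in>circ_set w L B A. c D) +
    of_int (link_number w A B) * c A + of_int (link_number w A B) * c B"
    using AB fin by (simp add: sum.distrib sum_subtractf ind flip: sum_distrib_left)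
  finally show ?thesis by (simp add: algebra_simps)
qed

lemma omega_base:
  assumes cnt: "\<And>D. D \<in> L \<Longrightarrow> count_list w D = 2" and A: "A \<in> L"
  shows "omega c w L (loop_height w A) (\<lambda>_. 1) / 2 = (\<Sum>D\<in>L. of_int (link_number w A D) * c D)"
proof -
  have "omega c w L (loop_height w A) (\<lambda>_. 1) =
    (\<Sum>D\<in>L. 2 * (of_int (link_number w A D) * c D))"
    unfolding omega_def
    by (rule sum.cong) (use loop_height_link_number[OF cnt[OF A] cnt] in \<open>simp_all add: algebra_simps\<close>)
  then show ?thesis by (simp flip: sum_distrib_left)
qed

lemma omega_sum_right:
  "omega c w L F (\<lambda>p. \<Sum>i\<in>I. q i * G i p) = (\<Sum>i\<in>I. q i * omega c w L F (G i))"
  unfolding omega_swap[of c w L F] omega_sum_left by (simp add: omega_swap[of c w L _ F] sum_negf)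

text \<open>The option type follows the set of the pairing: \<open>None\<close> is s, of constant
  height 1.\<close>

definition basis_height :: "'b list \<Rightarrow> 'b option \<Rightarrow> nat \<Rightarrow> rat" where
  "basis_height w X = (case X of None \<Rightarrow> (\<lambda>_. 1) | Some A \<Rightarrow> loop_height w A)"

definition pair_coord :: "rat \<times> ('b \<Rightarrow> rat) \<Rightarrow> 'b option \<Rightarrow> rat" where
  "pair_coord x X = (case X of None \<Rightarrow> fst x | Some A \<Rightarrow> snd x A)"

lemma height_basis:
  assumes "finite L"
  shows "height w L (fst x) (snd x) =
    (\<lambda>p. \<Sum>X\<in>insert None (Some ` L). pair_coord x X * basis_height w X p)"
proof
  fix p
  have "(\<Sum>X\<in>insert None (Some ` L). pair_coord x X * basis_height w X p) =
    fst x + (\<Sum>X\<in>Some ` L. pair_coord x X * basis_height w X p)"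
    using assms by (subst sum.insert) (auto simp: pair_coord_def basis_height_def)
  also have "(\<Sum>X\<in>Some ` L. pair_coord x X * basis_height w X p) = (\<Sum>A\<in>L. snd x A * loop_height w A p)"
    by (subst sum.reindex) (auto simp: pair_coord_def basis_height_def)
  finally show "height w L (fst x) (snd x) p =
    (\<Sum>X\<in>insert None (Some ` L). pair_coord x X * basis_height w X p)"
    by (simp add: height_def)
qed

lemma (in signed_involution) nw_form_expand:
  assumes "is_nanoword \<alpha> W"
  shows "nw_form W x y = (\<Sum>(X, Y)\<in>insert None (Some ` letters W) \<times> insert None (Some ` letters W).
    pair_coord x X * pair_coord y Y *
      (omega (weight W) (word W) (letters W) (basis_height (word W) X) (basis_height (word W) Y) / 2))"
  unfolding nw_form_def word_form_def height_basis[OF finite_letters[OF assms]]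
    omega_sum_left omega_sum_right sum.cartesian_product[symmetric]
  by (simp add: sum_distrib_left sum_divide_distrib mult.assoc)

text \<open>Place i of v becomes place |w| + |v| - 1 - i, so first and last occurrences of its
  letters trade roles.\<close>

lemma first_last_product:
  assumes W: "is_nanoword \<alpha> W" and V: "is_nanoword \<alpha> V"
  defines "P \<equiv> nw_product W (nw_opposite V)"
  defines "w \<equiv> word W" and "v \<equiv> word V"
  shows "A \<in> letters W \<Longrightarrow> first_occ (word P) (Inl A) = first_occ w A"
    and "A \<in> letters W \<Longrightarrow> last_occ (word P) (Inl A) = last_occ w A"
    and "B \<in> letters V \<Longrightarrow> first_occ (word P) (Inr B) = length w + length v - 1 - last_occ v B"
    and "B \<in> letters V \<Longrightarrow> last_occ (word P) (Inr B) = length w + length v - 1 - first_occ v B"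
proof -
  have P: "word P = map Inl w @ map Inr (rev v)"
    by (simp add: P_def nw_product_def nw_opposite_def w_def v_def)
  {
    assume A: "A \<in> letters W"
    have cnt: "count_list w A = 2" using W A by (simp add: is_nanoword_def w_def)
    have "word P ! i = Inl A \<longleftrightarrow> i < length w \<and> w ! i = A" if "i < length (word P)" for i
      using that by (cases "i < length w") (auto simp: P nth_append)
    then have "{i. i < length (word P) \<and> word P ! i = Inl A} = {i. i < length w \<and> w ! i = A}"
      by (auto simp: P)
    also have "\<dots> = {first_occ w A, last_occ w A}" by (rule occurrences(2)[OF cnt])
    finally show "first_occ (word P) (Inl A) = first_occ w A" "last_occ (word P) (Inl A) = last_occ w A"
      using occurrences(1)[OF cnt] by (rule occurrencesI)+
  }
  {
    assume B: "B \<in> letters V"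
    let ?r = "\<lambda>i. length w + length v - 1 - i"
    have cnt: "count_list v B = 2" using V B by (simp add: is_nanoword_def v_def)
    have "{i. i < length (word P) \<and> word P ! i = Inr B} = ?r ` {i. i < length v \<and> v ! i = B}"
    proof (intro equalityI subsetI)
      fix i assume "i \<in> {i. i < length (word P) \<and> word P ! i = Inr B}"
      then have i: "length w \<le> i" "i < length w + length v" "rev v ! (i - length w) = B"
        by (auto simp: P nth_append split: if_splits)
      then have "v ! ?r i = B"
        by (simp add: rev_nth) (metis Nat.add_diff_assoc add.commute diff_Suc_eq_diff_pred diff_diff_left
            diff_diff_right less_imp_le_nat plus_1_eq_Suc)
      moreover have "i = ?r (?r i)" "?r i < length v" using i by auto
      ultimately show "i \<in> ?r ` {i. i < length v \<and> v ! i = B}" by blast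
    next
      fix i assume "i \<in> ?r ` {i. i < length v \<and> v ! i = B}"
      then obtain j where j: "i = ?r j" "j < length v" "v ! j = B" by auto
      then have "i - length w = length v - Suc j" "length w \<le> i" "i < length w + length v" by auto
      then show "i \<in> {i. i < length (word P) \<and> word P ! i = Inr B}"
        using j by (simp add: P nth_append rev_nth)
    qed
    also have "\<dots> = {?r (last_occ v B), ?r (first_occ v B)}"
      unfolding occurrences(2)[OF cnt] by auto
    finally have "{i. i < length (word P) \<and> word P ! i = Inr B} = {?r (last_occ v B), ?r (first_occ v B)}" .
    moreover have "?r (last_occ v B) < ?r (first_occ v B)"
      using occurrences(1)[OF cnt] occurrence_nth[OF cnt] by auto
    ultimately show "first_occ (word P) (Inr B) = ?r (last_occ v B)"
      "last_occ (word P) (Inr B) = ?r (first_occ v B)"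
      by (rule occurrencesI)+
  }
qed

lemma count_list_map_inj: "inj f \<Longrightarrow> count_list (map f xs) (f x) = count_list xs x"
  by (induction xs) (auto dest: injD)

lemma is_nanoword_product_opposite:
  fixes W :: "('a, 'b) nanoword" and V :: "('a, 'c) nanoword"
  assumes W: "is_nanoword \<alpha> W" and V: "is_nanoword \<alpha> V"
  shows "is_nanoword \<alpha> (nw_product W (nw_opposite V))"
proof -
  have [simp]: "count_list (map Inr ys) (Inl A) = 0" "count_list (map Inl xs) (Inr B) = 0"
    for A :: 'b and B :: 'c and xs :: "'b list" and ys :: "'c list"
    by (auto simp: count_list_0_iff)
  have "count_list (map Inl (word W) @ map Inr (rev (word V))) (Inl A) = count_list (word W) A" for A
    by (simp add: count_list_append count_list_map_inj)
  moreover have "count_list (map Inl (word W) @ map Inr (rev (word V))) (Inr B) = count_list (word V) B" for B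
    by (simp add: count_list_append count_list_map_inj)
  ultimately show ?thesis
    using W V by (auto simp: is_nanoword_def nw_product_def nw_opposite_def)
qed

lemma (in signed_involution) omega_product:
  assumes W: "is_nanoword \<alpha> W" and V: "is_nanoword \<alpha> V"
  defines "P \<equiv> nw_product W (nw_opposite V)"
  defines "om \<equiv> \<lambda>X Y. omega (weight P) (word P) (letters P) (basis_height (word P) X) (basis_height (word P) Y)"
  shows "A \<in> letters W \<Longrightarrow> A' \<in> letters W \<Longrightarrow> om (Some (Inl A)) (Some (Inl A')) =
      omega (weight W) (word W) (letters W) (loop_height (word W) A) (loop_height (word W) A')"
    and "B \<in> letters V \<Longrightarrow> B' \<in> letters V \<Longrightarrow> om (Some (Inr B)) (Some (Inr B')) =
      - omega (weight V) (word V) (letters V) (loop_height (word V) B) (loop_height (word V) B')"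
    and "A \<in> letters W \<Longrightarrow> B \<in> letters V \<Longrightarrow> om (Some (Inl A)) (Some (Inr B)) = 0"
    and "A \<in> letters W \<Longrightarrow> om (Some (Inl A)) None =
      omega (weight W) (word W) (letters W) (loop_height (word W) A) (\<lambda>_. 1)"
    and "B \<in> letters V \<Longrightarrow> om (Some (Inr B)) None =
      - omega (weight V) (word V) (letters V) (loop_height (word V) B) (\<lambda>_. 1)"
proof -
  define w v where "w = word W" and "v = word V"
  have cw: "count_list w A = 2" if "A \<in> letters W" for A using W that by (simp add: is_nanoword_def w_def)
  have cv: "count_list v A = 2" if "A \<in> letters V" for A using V that by (simp add: is_nanoword_def v_def)
  note fl = first_last_product[OF W V, folded P_def w_def v_def]
  have split: "omega (weight P) (word P) (letters P) F G =
    (\<Sum>D\<in>letters W. weight W D * (F (first_occ w D) * G (last_occ w D) - F (last_occ w D) * G (first_occ w D))) +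
    (\<Sum>D\<in>letters V. weight V D * (F (length w + length v - Suc (last_occ v D)) *
      G (length w + length v - Suc (first_occ v D)) -
      F (length w + length v - Suc (first_occ v D)) * G (length w + length v - Suc (last_occ v D))))" for F G
  proof -
    have L: "letters P = Inl ` letters W \<union> Inr ` letters V"
      by (auto simp: P_def nw_product_def nw_opposite_def)
    have wt: "weight P (Inl A) = weight W A" "weight P (Inr B) = weight V B" for A B
      by (simp_all add: weight_def P_def nw_product_def nw_opposite_def)
    show ?thesis
      unfolding omega_def L
      by (subst sum.union_disjoint)
        (use finite_letters[OF W] finite_letters[OF V] in \<open>auto simp: sum.reindex wt fl\<close>)
  qed
  have ll: "loop_height (word P) (Inl A) p = loop_height w A p" if "A \<in> letters W" "p < length w" for A p
    using that by (simp add: loop_height_def fl)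
  have lr: "loop_height (word P) (Inl A) (length w + length v - Suc p) = 0" if "A \<in> letters W" "p < length v" for A p
    using that occurrence_nth[OF cw, of A] by (simp add: loop_height_def fl sg_simps)
  have rl: "loop_height (word P) (Inr B) p = 0" if "B \<in> letters V" "p < length w" for B p
    using that occurrence_nth[OF cv, of B] by (simp add: loop_height_def fl sg_simps)
  have rev: "sg (length w + length v - Suc p) (length w + length v - Suc q) = sg q p"
    if "p < length v" "q < length v" for p q
    using that by (cases p q rule: linorder_cases) (simp_all add: sg_simps)
  have rr: "loop_height (word P) (Inr B) (length w + length v - Suc p) = loop_height v B p"
    if "B \<in> letters V" "p < length v" for B p
    using that occurrence_nth[OF cv, of B] rev[of p "last_occ v B"] rev[of p "first_occ v B"]
      sg_swap[of "last_occ v B" p] sg_swap[of "first_occ v B" p] by (simp add: loop_height_def fl)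
  note bd = occurrence_nth(1,2)[OF cw] occurrence_nth(1,2)[OF cv]
  show "om (Some (Inl A)) (Some (Inl A')) =
      omega (weight W) (word W) (letters W) (loop_height (word W) A) (loop_height (word W) A')"
    if "A \<in> letters W" "A' \<in> letters W"
    unfolding om_def split using that by (simp add: basis_height_def lr bd ll omega_def w_def[symmetric])
  show "om (Some (Inr B)) (Some (Inr B')) =
      - omega (weight V) (word V) (letters V) (loop_height (word V) B) (loop_height (word V) B')"
    if "B \<in> letters V" "B' \<in> letters V"
    unfolding om_def split using that
    by (simp add: basis_height_def rl rr bd omega_def v_def[symmetric] sum_negf[symmetric] algebra_simps)
  show "om (Some (Inl A)) (Some (Inr B)) = 0" if "A \<in> letters W" "B \<in> letters V"
    unfolding om_def split using that by (simp add: basis_height_def rl lr bd)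
  show "om (Some (Inl A)) None = omega (weight W) (word W) (letters W) (loop_height (word W) A) (\<lambda>_. 1)"
    if "A \<in> letters W"
    unfolding om_def split using that by (simp add: basis_height_def lr bd ll omega_def w_def[symmetric])
  show "om (Some (Inr B)) None = - omega (weight V) (word V) (letters V) (loop_height (word V) B) (\<lambda>_. 1)"
    if "B \<in> letters V"
    unfolding om_def split using that
    by (simp add: basis_height_def rl rr bd omega_def v_def[symmetric] sum_negf[symmetric] algebra_simps)
qed

section \<open>From vector spaces to fillings of the pairing\<close>

lemma pi_gen_tau:
  assumes tau: "\<tau> \<in> \<alpha> \<rightarrow> \<alpha>" and a: "a \<in> \<alpha>"
  shows "pi_gen \<alpha> \<tau> a \<otimes>\<^bsub>pi_group \<alpha> \<tau>\<^esub> pi_gen \<alpha> \<tau> (\<tau> a) = \<one>\<^bsub>pi_group \<alpha> \<tau>\<^esub>"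
proof -
  let ?F = "free_Abelian_group \<alpha>"
  interpret F: comm_group ?F by (rule abelian_free_Abelian_group)
  let ?r = "{frag_of a + frag_of (\<tau> a) | a. a \<in> \<alpha>}"
  have r: "?r \<subseteq> carrier ?F"
    using tau by (auto simp: Pi_iff dest!: subsetD[OF keys_add])
  have sub: "subgroup (pi_relations \<alpha> \<tau>) ?F"
    unfolding pi_relations_def using r by (rule F.generate_is_subgroup)
  interpret N: normal "pi_relations \<alpha> \<tau>" ?F
    using sub by (rule F.subgroup_imp_normal)
  have mem: "frag_of a + frag_of (\<tau> a) \<in> pi_relations \<alpha> \<tau>"
    unfolding pi_relations_def by (rule generate.incl) (use a in auto)
  have "pi_gen \<alpha> \<tau> a \<otimes>\<^bsub>pi_group \<alpha> \<tau>\<^esub> pi_gen \<alpha> \<tau> (\<tau> a) =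
    pi_relations \<alpha> \<tau> #>\<^bsub>?F\<^esub> (frag_of a \<otimes>\<^bsub>?F\<^esub> frag_of (\<tau> a))"
    unfolding pi_gen_def pi_group_def FactGroup_def using N.rcos_sum[of "frag_of a" "frag_of (\<tau> a)"] a tau
    by (auto simp: Pi_iff)
  also have "\<dots> = pi_relations \<alpha> \<tau>"
    using N.rcos_const[OF F.group_axioms, of "frag_of a + frag_of (\<tau> a)"] mem by simp
  finally show ?thesis by (simp add: pi_group_def FactGroup_def)
qed

text \<open>\<open>nw_pairing\<close> has its own base point and \<open>pairing_sum\<close> adds
  another one, so letters lie two options deep. The base points of the summands are outside the
  image, as they should be.\<close>

definition embed :: "'b + 'c \<Rightarrow> ('b option + 'c option) option" where
  "embed X = Some (map_sum Some Some X)"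

lemma embed_simps [simp]: "embed (Inl A) = Some (Inl (Some A))" "embed (Inr B) = Some (Inr (Some B))"
  by (simp_all add: embed_def)

lemma embed_image:
  "embed ` (A <+> B) = (\<lambda>a. Some (Inl (Some a))) ` A \<union> (\<lambda>b. Some (Inr (Some b))) ` B"
  by (simp add: Plus_def image_Un image_image)

lemma inj_embed: "inj (embed :: 'b + 'c \<Rightarrow> _)"
proof (rule injI)
  fix x y :: "'b + 'c" assume "embed x = embed y"
  then show "x = y" by (cases x; cases y) (simp_all add: embed_def)
qed

definition embed_opt :: "('b + 'c) option \<Rightarrow> ('b option + 'c option) option" where
  "embed_opt X = (case X of None \<Rightarrow> None | Some D \<Rightarrow> embed D)"

lemma embed_opt_simps [simp]: "embed_opt None = None" "embed_opt (Some D) = embed D"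
  by (simp_all add: embed_opt_def)

lemma embed_neq_None [simp]: "embed D \<noteq> None" "None \<noteq> embed D"
  by (simp_all add: embed_def)

lemma inj_embed_opt: "inj embed_opt"
  using inj_embed by (auto simp: inj_def embed_opt_def split: option.splits)

text \<open>A derivation is turned into a list of integral vectors. That a letter occurs in one
  vector only is recorded by a filtered list of length 1; the vanishing off S preserves this when a
  new vector is put in front.\<close>

lemma fillable_list:
  assumes "fillable \<tau> pr M S"
    and "\<And>D. D \<in> S \<Longrightarrow> e D \<in> pset0 p \<and> pproj p (e D) = pr D" and inj: "inj e"
  shows "\<exists>\<Lambda>. (\<forall>x\<in>set \<Lambda>. short_vector \<tau> p x \<and> (\<lambda>D. of_int (Poly_Mapping.lookup x (e D))) \<in> M \<and>
      (\<forall>D. D \<notin> S \<longrightarrow> Poly_Mapping.lookup x (e D) = 0)) \<and>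
    (\<forall>D\<in>S. length (filter (\<lambda>x. Poly_Mapping.lookup x (e D) \<noteq> 0) \<Lambda>) = 1)"
  using assms(1,2)
proof (induction)
  case empty
  show ?case by (intro exI[of _ "[]"]) simp
next
  case (single S A)
  obtain \<Lambda> where \<Lambda>: "\<forall>x\<in>set \<Lambda>. short_vector \<tau> p x \<and>
      (\<lambda>D. of_int (Poly_Mapping.lookup x (e D))) \<in> M \<and> (\<forall>D. D \<notin> S \<longrightarrow> Poly_Mapping.lookup x (e D) = 0)"
    "\<forall>D\<in>S. length (filter (\<lambda>x. Poly_Mapping.lookup x (e D) \<noteq> 0) \<Lambda>) = 1"
    using single.IH[OF single.prems[OF insertI2]] by blast
  let ?x = "frag_of (e A)"
  have "(\<lambda>D. of_int (Poly_Mapping.lookup ?x (e D))) = basis_vec A"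
    by (auto simp: basis_vec_def inj_eq[OF inj])
  moreover have "short_vector \<tau> p ?x" using single.prems by (auto simp: short_vector_def)
  moreover have "filter (\<lambda>x. Poly_Mapping.lookup x (e A) \<noteq> 0) \<Lambda> = []"
    using \<Lambda>(1) single.hyps by (auto simp: filter_empty_conv)
  ultimately show ?case
    using \<Lambda> single.hyps by (intro exI[of _ "?x # \<Lambda>"]) (auto simp: inj_eq[OF inj])
next
  case (pair S A B s)
  obtain \<Lambda> where \<Lambda>: "\<forall>x\<in>set \<Lambda>. short_vector \<tau> p x \<and>
      (\<lambda>D. of_int (Poly_Mapping.lookup x (e D))) \<in> M \<and> (\<forall>D. D \<notin> S \<longrightarrow> Poly_Mapping.lookup x (e D) = 0)"
    "\<forall>D\<in>S. length (filter (\<lambda>x. Poly_Mapping.lookup x (e D) \<noteq> 0) \<Lambda>) = 1"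
    using pair.IH[OF pair.prems[OF insertI2[OF insertI2]]] by blast
  have AB: "A \<noteq> B" "s = 1 \<or> s = - 1" using pair.hyps by (auto simp: short_pair_def)
  define x where "x = (if s = 1 then frag_of (e A) + frag_of (e B) else frag_of (e A) - frag_of (e B))"
  have lx: "Poly_Mapping.lookup x (e D) = (if D = A then 1 else if D = B then (if s = 1 then 1 else - 1) else 0)"
    for D using AB by (simp add: x_def lookup_add lookup_minus inj_eq[OF inj])
  have "(\<lambda>D. of_int (Poly_Mapping.lookup x (e D))) = pair_vec A B s"
    using AB by (auto simp: lx pair_vec_def basis_vec_def)
  moreover have "short_vector \<tau> p x"
  proof -
    have "e A \<in> pset0 p" "e B \<in> pset0 p" "pproj p (e A) = pr A" "pproj p (e B) = pr B" "e A \<noteq> e B"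
      using pair.prems AB by (auto simp: inj_eq[OF inj])
    then show ?thesis
      using pair.hyps(4) unfolding short_vector_def x_def short_pair_def by (auto 4 4)
  qed
  moreover have "filter (\<lambda>x. Poly_Mapping.lookup x (e A) \<noteq> 0) \<Lambda> = []"
    "filter (\<lambda>x. Poly_Mapping.lookup x (e B) \<noteq> 0) \<Lambda> = []"
    using \<Lambda>(1) pair.hyps by (auto simp: filter_empty_conv)
  ultimately show ?case
    using \<Lambda> pair.hyps AB by (intro exI[of _ "x # \<Lambda>"]) (auto simp: lx)
qed

lemma unique_index:
  assumes "length (filter P xs) = 1"
  shows "\<exists>!i. i < length xs \<and> P (xs ! i)"
proof -
  have "card {i. i < length xs \<and> P (xs ! i)} = 1" using assms by (simp add: length_filter_conv_card)
  then obtain i where "{i. i < length xs \<and> P (xs ! i)} = {i}" by (metis card_1_singletonE)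
  then have "j < length xs \<and> P (xs ! j) \<longleftrightarrow> j = i" for j by (simp add: set_eq_iff)
  then show ?thesis by simp
qed

section \<open>The homomorphism phi and the genus of the sum pairing\<close>

locale pi_hom =
  fixes \<alpha> :: "'a set" and \<tau> :: "'a \<Rightarrow> 'a" and \<phi> :: "('a \<Rightarrow>\<^sub>0 int) set \<Rightarrow> int"
  assumes tau_in: "\<tau> \<in> \<alpha> \<rightarrow> \<alpha>" and tau_inv: "\<forall>a \<in> \<alpha>. \<tau> (\<tau> a) = a"
    and hom: "\<phi> \<in> hom (pi_group \<alpha> \<tau>) integer_group"
    and unit: "\<forall>a \<in> \<alpha>. \<phi> (pi_gen \<alpha> \<tau> a) \<in> {1, - 1}"
begin

abbreviation "G \<equiv> pi_group \<alpha> \<tau>"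

sublocale G: comm_group G using tau_in by (rule comm_group_pi_group)

sublocale h: group_hom G integer_group \<phi>
  by (rule group_hom.intro[OF G.group_axioms group_integer_group group_hom_axioms.intro[OF hom]])

lemma phi_mult: "x \<in> carrier G \<Longrightarrow> y \<in> carrier G \<Longrightarrow> \<phi> (x \<otimes>\<^bsub>G\<^esub> y) = \<phi> x + \<phi> y"
  using h.hom_mult by simp

lemma phi_one: "\<phi> \<one>\<^bsub>G\<^esub> = 0" using h.hom_one by simp

lemma phi_inv: "x \<in> carrier G \<Longrightarrow> \<phi> (inv\<^bsub>G\<^esub> x) = - \<phi> x" using h.hom_inv by simp

lemma phi_nat_pow: "x \<in> carrier G \<Longrightarrow> \<phi> (x [^]\<^bsub>G\<^esub> (n :: nat)) = int n * \<phi> x"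
  using h.hom_nat_pow by simp

lemma phi_int_pow: "x \<in> carrier G \<Longrightarrow> \<phi> (x [^]\<^bsub>G\<^esub> (n :: int)) = n * \<phi> x"
  using h.hom_int_pow by simp

lemma phi_finprod:
  assumes "finite A" "\<And>x. x \<in> A \<Longrightarrow> f x \<in> carrier G"
  shows "\<phi> (finprod G f A) = (\<Sum>x\<in>A. \<phi> (f x))"
  using assms
proof (induction rule: finite_induct)
  case (insert x A)
  then show ?case by (subst G.finprod_insert) (auto simp: phi_mult)
qed (simp add: phi_one)

definition \<chi> :: "'a \<Rightarrow> rat" where "\<chi> a = of_int (\<phi> (pi_gen \<alpha> \<tau> a))"

sublocale signed_involution \<alpha> \<tau> \<chi>
proof
  fix a assume a: "a \<in> \<alpha>"
  then show ta: "\<tau> a \<in> \<alpha>" using tau_in by auto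
  show "\<tau> (\<tau> a) = a" using tau_inv a by auto
  have "\<phi> (pi_gen \<alpha> \<tau> a) + \<phi> (pi_gen \<alpha> \<tau> (\<tau> a)) = 0"
    using phi_mult[OF pi_gen_closed[OF a] pi_gen_closed[OF ta]] pi_gen_tau[OF tau_in a] phi_one by simp
  then show "\<chi> (\<tau> a) = - \<chi> a" by (simp add: \<chi>_def flip: of_int_minus)
  show "\<chi> a \<noteq> 0" using unit a by (auto simp: \<chi>_def)
qed

lemma gen_closed: "is_nanoword \<alpha> W \<Longrightarrow> D \<in> letters W \<Longrightarrow> pi_gen \<alpha> \<tau> (lproj W D) \<in> carrier G"
  by (rule pi_gen_closed) (auto simp: is_nanoword_def)

lemma phi_nw_form_base:
  assumes W: "is_nanoword \<alpha> W" and A: "A \<in> letters W"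
  shows "of_int (\<phi> (nw_form_base \<alpha> \<tau> W A)) =
    omega (weight W) (word W) (letters W) (loop_height (word W) A) (\<lambda>_. 1) / 2"
proof -
  have cnt: "count_list (word W) D = 2" if "D \<in> letters W" for D
    using W that by (simp add: is_nanoword_def)
  have "\<phi> (nw_form_base \<alpha> \<tau> W A) =
    (\<Sum>D\<in>letters W. link_number (word W) A D * \<phi> (pi_gen \<alpha> \<tau> (lproj W D)))"
    unfolding nw_form_base_def
    by (subst phi_finprod) (auto simp: finite_letters[OF W] gen_closed[OF W] phi_int_pow)
  moreover have "omega (weight W) (word W) (letters W) (loop_height (word W) A) (\<lambda>_. 1) / 2 =
    (\<Sum>D\<in>letters W. of_int (link_number (word W) A D) * weight W D)"
    by (rule omega_base) (use cnt A in auto)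
  ultimately show ?thesis by (simp only: of_int_sum of_int_mult weight_def \<chi>_def)
qed

lemma phi_nw_form_letters:
  assumes W: "is_nanoword \<alpha> W" and A: "A \<in> letters W" and B: "B \<in> letters W"
  shows "of_int (\<phi> (nw_form_letters \<alpha> \<tau> W A B)) =
    omega (weight W) (word W) (letters W) (loop_height (word W) A) (loop_height (word W) B) / 2"
proof -
  have cnt: "count_list (word W) D = 2" if "D \<in> letters W" for D
    using W that by (simp add: is_nanoword_def)
  have circ: "nw_circ \<alpha> \<tau> W X Y \<in> carrier G"
    "\<phi> (nw_circ \<alpha> \<tau> W X Y) = (\<Sum>D\<in>circ_set (word W) (letters W) X Y. \<phi> (pi_gen \<alpha> \<tau> (lproj W D)))" for X Y
  proof -
    have sub: "circ_set (word W) (letters W) X Y \<subseteq> letters W" by (auto simp: circ_set_def)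
    then have g: "D \<in> circ_set (word W) (letters W) X Y \<Longrightarrow> pi_gen \<alpha> \<tau> (lproj W D) \<in> carrier G" for D
      using gen_closed[OF W] by blast
    show "nw_circ \<alpha> \<tau> W X Y \<in> carrier G"
      unfolding nw_circ_def circ_set_def[symmetric] by (rule G.finprod_closed) (use g in auto)
    show "\<phi> (nw_circ \<alpha> \<tau> W X Y) =
      (\<Sum>D\<in>circ_set (word W) (letters W) X Y. \<phi> (pi_gen \<alpha> \<tau> (lproj W D)))"
      unfolding nw_circ_def circ_set_def[symmetric]
      by (rule phi_finprod) (use g finite_subset[OF sub finite_letters[OF W]] in auto)
  qed
  have "\<phi> (nw_form_letters \<alpha> \<tau> W A B) = 2 * (\<phi> (nw_circ \<alpha> \<tau> W A B) - \<phi> (nw_circ \<alpha> \<tau> W B A)) +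
    link_number (word W) A B * (\<phi> (pi_gen \<alpha> \<tau> (lproj W A)) + \<phi> (pi_gen \<alpha> \<tau> (lproj W B)))"
    unfolding nw_form_letters_def Let_def
    using circ(1) gen_closed[OF W A] gen_closed[OF W B]
    by (simp add: phi_mult phi_inv phi_nat_pow phi_int_pow)
  moreover have "omega (weight W) (word W) (letters W) (loop_height (word W) A) (loop_height (word W) B) / 2 =
    2 * ((\<Sum>D\<in>circ_set (word W) (letters W) A B. weight W D) -
      (\<Sum>D\<in>circ_set (word W) (letters W) B A. weight W D)) +
    of_int (link_number (word W) A B) * (weight W A + weight W B)"
    by (rule omega_letters) (use cnt finite_letters[OF W] A B in auto)
  ultimately show ?thesis
    by (simp only: circ(2) of_int_sum of_int_mult of_int_add of_int_diff of_int_numeral weight_def \<chi>_def)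
qed

lemma phi_bilinear_form:
  assumes "is_pairing \<alpha> \<tau> p"
  shows "\<phi> (bilinear_form \<alpha> \<tau> p x y) = (\<Sum>(A, B)\<in>pset p \<times> pset p.
    Poly_Mapping.lookup x A * Poly_Mapping.lookup y B * \<phi> (pform p A B))"
proof -
  have fin: "finite (pset p)" and cl: "\<And>A B. A \<in> pset p \<Longrightarrow> B \<in> pset p \<Longrightarrow> pform p A B \<in> carrier G"
    using assms by (auto simp: is_pairing_def)
  show ?thesis
    unfolding bilinear_form_def
    by (subst phi_finprod) (use fin cl in \<open>auto simp: phi_int_pow intro!: sum.cong\<close>)
qed

context
  fixes W :: "('a, 'b) nanoword" and V :: "('a, 'c) nanoword"
  assumes W: "is_nanoword \<alpha> W" and V: "is_nanoword \<alpha> V"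
begin

abbreviation (input) "pr \<equiv>
  pairing_sum \<alpha> \<tau> (nw_pairing \<alpha> \<tau> W) (pairing_opposite \<alpha> \<tau> (nw_pairing \<alpha> \<tau> V))"

abbreviation (input) "PW \<equiv> nw_product W (nw_opposite V)"

lemma is_pairing_pr: "is_pairing \<alpha> \<tau> pr"
  by (intro is_pairing_sum is_pairing_opposite is_pairing_nw_pairing tau_in W V)

lemma pset0_pr: "pset0 pr = embed ` letters PW"
  by (auto simp: pset0_def pairing_sum_def nw_pairing_def pairing_opposite_def nw_product_def
      nw_opposite_def embed_image Plus_def image_Un image_image)

lemma pset_pr: "pset pr = embed_opt ` insert None (Some ` letters PW)"
proof -
  have "pset pr = insert None (pset0 pr)" by (auto simp: pset0_def pairing_sum_def)
  then show ?thesis unfolding pset0_pr by (auto simp: image_iff)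
qed

lemma nanoword_PW: "is_nanoword \<alpha> PW" by (rule is_nanoword_product_opposite[OF W V])

lemma letters_PW: "letters PW = Inl ` letters W \<union> Inr ` letters V"
  by (auto simp: nw_product_def nw_opposite_def)

text \<open>After applying \<phi>, the sum pairing is the pairing of w v^-.
  \<open>omega_product\<close> settles most cases; those with s in first place and the one pairing a
  letter of V with a letter of W follow by antisymmetry.\<close>

lemma phi_pform:
  assumes X: "X \<in> insert None (Some ` letters PW)" and Y: "Y \<in> insert None (Some ` letters PW)"
  shows "of_int (\<phi> (pform pr (embed_opt X) (embed_opt Y))) =
    omega (weight PW) (word PW) (letters PW) (basis_height (word PW) X) (basis_height (word PW) Y) / 2"
proof -
  note phi = phi_nw_form_base[OF W] phi_nw_form_base[OF V] phi_nw_form_letters[OF W] phi_nw_form_letters[OF V]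
  have pW: "pform (nw_pairing \<alpha> \<tau> W) P Q \<in> carrier G"
    if "P \<in> insert None (Some ` letters W)" "Q \<in> insert None (Some ` letters W)" for P Q
    using is_pairing_nw_pairing[OF tau_in W] that by (auto simp: is_pairing_def nw_pairing_def)
  have pV: "pform (nw_pairing \<alpha> \<tau> V) P Q \<in> carrier G"
    if "P \<in> insert None (Some ` letters V)" "Q \<in> insert None (Some ` letters V)" for P Q
    using is_pairing_nw_pairing[OF tau_in V] that by (auto simp: is_pairing_def nw_pairing_def)
  have baseW: "nw_form_base \<alpha> \<tau> W A \<in> carrier G" if "A \<in> letters W" for A
    using pW[of "Some A" None] that by (simp add: nw_pairing_def)
  have baseV: "nw_form_base \<alpha> \<tau> V A \<in> carrier G" if "A \<in> letters V" for A
    using pV[of "Some A" None] that by (simp add: nw_pairing_def)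
  have lettersV: "nw_form_letters \<alpha> \<tau> V A B \<in> carrier G" if "A \<in> letters V" "B \<in> letters V" for A B
    using pV[of "Some A" "Some B"] that by (simp add: nw_pairing_def)
  note defs = pairing_sum_def pairing_opposite_def nw_pairing_def
  define om' where "om' X Y =
    omega (weight PW) (word PW) (letters PW) (basis_height (word PW) X) (basis_height (word PW) Y)" for X Y
  note om = omega_product[OF W V, folded om'_def]
  have swap: "om' P Q = - om' Q P" for P Q unfolding om'_def by (rule omega_swap)
  have None: "om' None None = 0" using swap[of None None] by simp
  consider "X = None" | A where "X = Some (Inl A)" "A \<in> letters W" | B where "X = Some (Inr B)" "B \<in> letters V"
    using X letters_PW by auto
  then have "of_int (\<phi> (pform pr (embed_opt X) (embed_opt Y))) = om' X Y / 2"
  proof cases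
    case 1
    consider "Y = None" | A where "Y = Some (Inl A)" "A \<in> letters W" | B where "Y = Some (Inr B)" "B \<in> letters V"
      using Y letters_PW by auto
    then show ?thesis
    proof cases
      case 1
      then show ?thesis using \<open>X = None\<close> None by (simp add: defs phi_one phi_mult phi_inv)
    next
      case 2
      then show ?thesis using \<open>X = None\<close> swap[of None]
        by (simp add: defs phi_inv baseW om phi)
    next
      case 3
      then show ?thesis using \<open>X = None\<close> swap[of None]
        by (simp add: defs phi_inv baseV om phi)
    qed
  next
    case (2 A)
    consider "Y = None" | A where "Y = Some (Inl A)" "A \<in> letters W" | B where "Y = Some (Inr B)" "B \<in> letters V"
      using Y letters_PW by auto
    then show ?thesis
      by cases (use 2 in \<open>simp_all add: defs phi_one om phi\<close>)
  next
    case (3 B)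
    consider "Y = None" | A where "Y = Some (Inl A)" "A \<in> letters W" | B where "Y = Some (Inr B)" "B \<in> letters V"
      using Y letters_PW by auto
    then show ?thesis
    proof cases
      case 1
      then show ?thesis using 3 by (simp add: defs phi_inv baseV om phi)
    next
      case (2 A)
      then show ?thesis using 3 swap[of "Some (Inr B)" "Some (Inl A)"] by (simp add: defs phi_one om)
    next
      case (3 B')
      then show ?thesis using \<open>X = Some (Inr B)\<close> \<open>B \<in> letters V\<close>
        by (simp add: defs phi_inv lettersV om phi)
    qed
  qed
  then show ?thesis by (simp add: om'_def)
qed

lemma phi_bilinear_form_pr:
  "of_int (\<phi> (bilinear_form \<alpha> \<tau> pr x y)) = nw_form PW
     (of_int (Poly_Mapping.lookup x None), \<lambda>D. of_int (Poly_Mapping.lookup x (embed D)))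
     (of_int (Poly_Mapping.lookup y None), \<lambda>D. of_int (Poly_Mapping.lookup y (embed D)))"
proof -
  let ?I = "insert None (Some ` letters PW)"
  have inj: "inj_on embed_opt ?I" using inj_embed_opt by (rule inj_on_subset) simp
  have coord: "pair_coord (of_int (Poly_Mapping.lookup x None), \<lambda>D. of_int (Poly_Mapping.lookup x (embed D))) X =
    of_int (Poly_Mapping.lookup x (embed_opt X))" for X and x :: "('b option + 'c option) option \<Rightarrow>\<^sub>0 int"
    by (simp add: pair_coord_def split: option.splits)
  have "\<phi> (bilinear_form \<alpha> \<tau> pr x y) = (\<Sum>A\<in>embed_opt ` ?I. \<Sum>B\<in>embed_opt ` ?I.
    Poly_Mapping.lookup x A * Poly_Mapping.lookup y B * \<phi> (pform pr A B))"
    unfolding phi_bilinear_form[OF is_pairing_pr] pset_pr sum.cartesian_product by simp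
  also have "\<dots> = (\<Sum>X\<in>?I. \<Sum>Y\<in>?I. Poly_Mapping.lookup x (embed_opt X) *
    Poly_Mapping.lookup y (embed_opt Y) * \<phi> (pform pr (embed_opt X) (embed_opt Y)))"
    by (simp only: sum.reindex[OF inj] o_def)
  finally have "of_int (\<phi> (bilinear_form \<alpha> \<tau> pr x y)) = (\<Sum>X\<in>?I. \<Sum>Y\<in>?I.
    of_int (Poly_Mapping.lookup x (embed_opt X)) * of_int (Poly_Mapping.lookup y (embed_opt Y)) *
    (of_int (\<phi> (pform pr (embed_opt X) (embed_opt Y))) :: rat))" by (simp only: of_int_sum of_int_mult)
  then show ?thesis
    unfolding nw_form_expand[OF nanoword_PW] sum.cartesian_product[symmetric] coord
    by (simp only: phi_pform cong: sum.cong)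
qed

text \<open>The entries of the filling matrix are values of the form on
  \<open>UNIV \<times> M\<close>, hence sums of m products, which bounds the rank by m.\<close>

lemma genus_le:
  assumes "low_rank_filling m PW"
  shows "genus \<alpha> \<tau> \<phi> pr \<le> real m / 2"
proof -
  obtain M where M: "vec_subspace M" "fillable \<tau> (lproj PW) M (letters PW)"
    "product_rank_le m (nw_form PW) (UNIV \<times> M)" using assms unfolding low_rank_filling_def by auto
  have pproj: "embed D \<in> pset0 pr \<and> pproj pr (embed D) = lproj PW D" if "D \<in> letters PW" for D
  proof
    show "embed D \<in> pset0 pr" unfolding pset0_pr using that by (rule imageI)
    show "pproj pr (embed D) = lproj PW D"
      by (cases D) (simp_all add: pairing_sum_def nw_pairing_def pairing_opposite_def nw_product_def
          nw_opposite_def)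
  qed
  obtain \<Lambda> where \<Lambda>: "\<And>x. x \<in> set \<Lambda> \<Longrightarrow> short_vector \<tau> pr x \<and>
      (\<lambda>D. of_int (Poly_Mapping.lookup x (embed D))) \<in> M"
    "\<And>D. D \<in> letters PW \<Longrightarrow> length (filter (\<lambda>x. Poly_Mapping.lookup x (embed D) \<noteq> 0) \<Lambda>) = 1"
    using fillable_list[OF M(2) pproj inj_embed] by blast
  define \<Lambda>' where "\<Lambda>' = frag_of (pbase pr) # \<Lambda>"
  have base: "pbase pr = None" by (simp add: pairing_sum_def)
  have fill: "is_filling \<tau> pr \<Lambda>'"
    unfolding is_filling_def
  proof (intro conjI ballI)
    show "\<exists>i\<^sub>0<length \<Lambda>'. \<Lambda>' ! i\<^sub>0 = frag_of (pbase pr) \<and>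
      (\<forall>i<length \<Lambda>'. i \<noteq> i\<^sub>0 \<longrightarrow> short_vector \<tau> pr (\<Lambda>' ! i))"
      using \<Lambda>(1) by (intro exI[of _ 0]) (auto simp: \<Lambda>'_def nth_Cons')
  next
    fix A assume "A \<in> pset0 pr"
    then obtain D where D: "D \<in> letters PW" "A = embed D" unfolding pset0_pr by auto
    then have "length (filter (\<lambda>x. Poly_Mapping.lookup x A \<noteq> 0) \<Lambda>') = 1"
      using \<Lambda>(2)[OF D(1)] by (simp add: \<Lambda>'_def base)
    then show "\<exists>!i. i < length \<Lambda>' \<and> Poly_Mapping.lookup (\<Lambda>' ! i) A \<noteq> 0" by (rule unique_index)
  qed
  \<comment> \<open>The vector s has only zero coordinates at letters, and 0 lies in M.\<close>
  have in_M: "(\<lambda>D. of_int (Poly_Mapping.lookup x (embed D))) \<in> M" if "x \<in> set \<Lambda>'" for x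
    using that \<Lambda>(1) M(1) by (auto simp: \<Lambda>'_def base vec_subspace_def)
  obtain f g where fg: "\<And>x y. x \<in> UNIV \<times> M \<Longrightarrow> y \<in> UNIV \<times> M \<Longrightarrow> nw_form PW x y = (\<Sum>l<m. f l x * g l y)"
    using M(3) unfolding product_rank_le_def by auto
  define vec_of :: "_ \<Rightarrow> rat \<times> ('b + 'c \<Rightarrow> rat)" where
    "vec_of x = (of_int (Poly_Mapping.lookup x None), \<lambda>D. of_int (Poly_Mapping.lookup x (embed D)))" for x
  have "vec_space.rank (length \<Lambda>') (filling_matrix \<alpha> \<tau> \<phi> pr \<Lambda>') \<le> m"
  proof (rule rank_le_sum_of_products)
    show "filling_matrix \<alpha> \<tau> \<phi> pr \<Lambda>' \<in> carrier_mat (length \<Lambda>') (length \<Lambda>')"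
      by (simp add: filling_matrix_def)
    fix i j assume ij: "i < length \<Lambda>'" "j < length \<Lambda>'"
    then have "filling_matrix \<alpha> \<tau> \<phi> pr \<Lambda>' $$ (i, j) = nw_form PW (vec_of (\<Lambda>' ! i)) (vec_of (\<Lambda>' ! j))"
      by (simp add: filling_matrix_def phi_bilinear_form_pr vec_of_def)
    also have "\<dots> = (\<Sum>l<m. f l (vec_of (\<Lambda>' ! i)) * g l (vec_of (\<Lambda>' ! j)))"
      by (rule fg) (use ij in_M in \<open>auto simp: vec_of_def\<close>)
    finally show "filling_matrix \<alpha> \<tau> \<phi> pr \<Lambda>' $$ (i, j) =
      (\<Sum>l<m. f l (vec_of (\<Lambda>' ! i)) * g l (vec_of (\<Lambda>' ! j)))" .
  qed
  moreover have "Inf {vec_space.rank (length \<Lambda>) (filling_matrix \<alpha> \<tau> \<phi> pr \<Lambda>) | \<Lambda>. is_filling \<tau> pr \<Lambda>} \<le>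
    vec_space.rank (length \<Lambda>') (filling_matrix \<alpha> \<tau> \<phi> pr \<Lambda>')"
    by (rule cInf_lower) (use fill in auto)
  ultimately show ?thesis unfolding genus_def by simp
qed

end

end

theorem corollary9p4p3:
  fixes \<alpha> :: "'a set" and \<tau> :: "'a \<Rightarrow> 'a"
    and \<phi> :: "('a \<Rightarrow>\<^sub>0 int) set \<Rightarrow> int"
    and w :: "('a, 'b) nanoword" and v :: "('a, 'c) nanoword"
  assumes "\<tau> \<in> \<alpha> \<rightarrow> \<alpha>" and "\<forall>a \<in> \<alpha>. \<tau> (\<tau> a) = a"
    and "\<phi> \<in> hom (pi_group \<alpha> \<tau>) integer_group"
    and "\<forall>a \<in> \<alpha>. \<phi> (pi_gen \<alpha> \<tau> a) \<in> {1, - 1}"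
    and "is_nanoword \<alpha> w" and "is_nanoword \<alpha> v"
  shows "real (bridge_metric \<alpha> \<tau> w v) \<ge>
    1 / 2 * genus \<alpha> \<tau> \<phi>
      (pairing_sum \<alpha> \<tau> (nw_pairing \<alpha> \<tau> w) (pairing_opposite \<alpha> \<tau> (nw_pairing \<alpha> \<tau> v)))"
proof -
  interpret pi_hom \<alpha> \<tau> \<phi> using assms(1-4) by unfold_locales
  \<comment> \<open>With m = 4 times the metric, \<open>genus_le\<close> bounds the genus by twice
    the metric.\<close>
  have "low_rank_filling (4 * bridge_metric \<alpha> \<tau> w v) (nw_product w (nw_opposite v))"
    unfolding bridge_metric_def
    by (rule low_rank_filling_bridge_norm[OF is_nanoword_product_opposite[OF assms(5,6)]])
  from genus_le[OF assms(5,6) this] show ?thesis by simp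
qed

end
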